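(* Let $(M,\mathbf{G})$ be an R-flat spray manifold, where $\mathbf G$ is defined on a conical region $\mathcal C$ of $TM\setminus\{0\}$. Then there exist non-trivial (i.e. not identically zero) local Funk functions of $\mathbf{G}$; here "local" means defined on a conical open neighbourhood of a given point of $\mathcal{C}$.
   Context: A conical region $\mathcal{C}$ of $TM\setminus\{0\}$ is an open set such that each $\mathcal{C}_x=\mathcal{C}\cap (T_xM\setminus\{0\})$ is closed under $y\mapsto\lambda y$, $\lambda>0$. A spray on $M$ is a smooth vector field on a conical region $\mathcal C$, locally $\mathbf{G}=y^i\frac{\partial}{\partial x^i}-2G^i\frac{\partial}{\partial y^i}$ with $G^i=G^i(x,y)$ positively homogeneous of degree two in $y$. Put $\partial_k=\partial/\partial x^k$, $\dot\partial_k=\partial/\partial y^k$, $G^r_i=\dot\partial_iG^r$, $\delta_i=\partial_i-G^r_i\dot\partial_r$. The Riemann curvature is $R^i_{\ k}=2\partial_kG^i-y^j\partial_j\dot\partial_kG^i+2G^j\dot\partial_j\dot\partial_kG^i-(\dot\partial_jG^i)(\dot\partial_kG^j)$. The spray is R-flat if $R^i_{\ k}=0$. For a function $P$ put $P_{;k}=\delta_kP$ and $P_{.k}=\dot\partial_kP$. A Funk function of $\mathbf{G}$ is a smooth function $P=P(x,y)$, positively homogeneous of degree one in $y$, satisfying $P_{;k}=P\,P_{.k}$. *)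

theory Defs
  imports "HOL-Analysis.Analysis"
begin

section \<open>Smooth maps between Euclidean spaces\<close>

text \<open>Intended for open sets \<open>S\<close> only: derivatives are taken at points of \<open>S\<close>, not within \<open>S\<close>.\<close>

primrec times_differentiable_on ::
  "nat \<Rightarrow> 'a::euclidean_space set \<Rightarrow> ('a \<Rightarrow> 'b::euclidean_space) \<Rightarrow> bool" where
  "times_differentiable_on 0 S f \<longleftrightarrow> continuous_on S f"
| "times_differentiable_on (Suc n) S f \<longleftrightarrow>
     (\<forall>x\<in>S. f differentiable (at x)) \<and>
     (\<forall>h. times_differentiable_on n S (\<lambda>x. frechet_derivative f (at x) h))"

definition smooth_on :: "'a::euclidean_space set \<Rightarrow> ('a \<Rightarrow> 'b::euclidean_space) \<Rightarrow> bool" where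
  "smooth_on S f \<longleftrightarrow> (\<forall>n. times_differentiable_on n S f)"

section \<open>Smooth manifolds\<close>

text \<open>A chart is a pair of a domain and a coordinate map; the values of the coordinate map
  outside the domain are irrelevant.\<close>

type_synonym ('a, 'e) chart = "'a set \<times> ('a \<Rightarrow> 'e)"

abbreviation chart_dom :: "('a, 'e) chart \<Rightarrow> 'a set" where
  "chart_dom c \<equiv> fst c"

abbreviation chart_map :: "('a, 'e) chart \<Rightarrow> 'a \<Rightarrow> 'e" where
  "chart_map c \<equiv> snd c"

definition chart_inv :: "('a, 'e) chart \<Rightarrow> 'e \<Rightarrow> 'a" where
  "chart_inv c = inv_into (chart_dom c) (chart_map c)"

definition chart_image :: "('a, 'e) chart \<Rightarrow> 'a set \<Rightarrow> 'e set" where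
  "chart_image c W = chart_map c ` (W \<inter> chart_dom c)"

definition transition :: "('a, 'e) chart \<Rightarrow> ('a, 'e) chart \<Rightarrow> 'e \<Rightarrow> 'e" where
  "transition c c' = chart_map c' \<circ> chart_inv c"

definition smooth_manifold ::
  "'a topology \<Rightarrow> ('a, 'e::euclidean_space) chart set \<Rightarrow> bool" where
  "smooth_manifold M A \<longleftrightarrow>
     Hausdorff_space M \<and> second_countable M \<and>
     topspace M = (\<Union>c\<in>A. chart_dom c) \<and>
     (\<forall>c\<in>A. openin M (chart_dom c) \<and> open (chart_image c (chart_dom c)) \<and>
        homeomorphic_map (subtopology M (chart_dom c))
          (top_of_set (chart_image c (chart_dom c))) (chart_map c)) \<and>
     (\<forall>c\<in>A. \<forall>c'\<in>A. smooth_on (chart_image c (chart_dom c')) (transition c c'))"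

section \<open>Tangent vectors and the tangent bundle\<close>

text \<open>A tangent vector at \<open>p\<close> is given by its components in all the charts around \<open>p\<close>, related
  by the Jacobians of the transition maps.  The components in the other charts are set to \<open>0\<close>,
  so that equality of tangent vectors is equality of functions.\<close>

definition tangent_space ::
  "('a, 'e::euclidean_space) chart set \<Rightarrow> 'a \<Rightarrow> (('a, 'e) chart \<Rightarrow> 'e) set" where
  "tangent_space A p =
     {v. (\<forall>c. \<not> (c \<in> A \<and> p \<in> chart_dom c) \<longrightarrow> v c = 0) \<and>
         (\<forall>c\<in>A. \<forall>c'\<in>A. p \<in> chart_dom c \<inter> chart_dom c' \<longrightarrow>
            v c' = frechet_derivative (transition c c') (at (chart_map c p)) (v c))}"

type_synonym ('a, 'e) tangent = "'a \<times> (('a, 'e) chart \<Rightarrow> 'e)"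

definition tangent_bundle ::
  "('a, 'e::euclidean_space) chart set \<Rightarrow> ('a, 'e) tangent set" where
  "tangent_bundle A = (SIGMA p:(\<Union>c\<in>A. chart_dom c). tangent_space A p)"

text \<open>The chart \<open>u \<mapsto> (x, y)\<close> of the tangent bundle induced by the chart \<open>c\<close>.\<close>

definition tangent_chart ::
  "('a, 'e::euclidean_space) chart set \<Rightarrow> ('a, 'e) chart \<Rightarrow> (('a, 'e) tangent, 'e \<times> 'e) chart" where
  "tangent_chart A c =
     ({(p, v) \<in> tangent_bundle A. p \<in> chart_dom c}, \<lambda>(p, v). (chart_map c p, v c))"

definition tangent_atlas ::
  "('a, 'e::euclidean_space) chart set \<Rightarrow> (('a, 'e) tangent, 'e \<times> 'e) chart set" where
  "tangent_atlas A = tangent_chart A ` A"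

definition tangent_topology ::
  "('a, 'e::euclidean_space) chart set \<Rightarrow> ('a, 'e) tangent topology" where
  "tangent_topology A = topology_generated_by
     {{u \<in> chart_dom (tangent_chart A c). chart_map (tangent_chart A c) u \<in> V} | c V.
        c \<in> A \<and> open V}"

definition tangent_scale :: "real \<Rightarrow> ('a, 'e::euclidean_space) tangent \<Rightarrow> ('a, 'e) tangent" where
  "tangent_scale t u = (fst u, \<lambda>c. t *\<^sub>R snd u c)"

definition slit_tangent_bundle ::
  "('a, 'e::euclidean_space) chart set \<Rightarrow> ('a, 'e) tangent set" where
  "slit_tangent_bundle A = {(p, v) \<in> tangent_bundle A. v \<noteq> (\<lambda>c. 0)}"

definition conical_region ::
  "('a, 'e::euclidean_space) chart set \<Rightarrow> ('a, 'e) tangent set \<Rightarrow> bool" where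
  "conical_region A C \<longleftrightarrow>
     openin (tangent_topology A) C \<and> C \<subseteq> slit_tangent_bundle A \<and>
     (\<forall>u\<in>C. \<forall>t>0. tangent_scale t u \<in> C)"

type_synonym ('b, 'f) vector_field = "'b \<Rightarrow> ('b, 'f) chart \<Rightarrow> 'f"

definition smooth_vector_field_on ::
  "('b, 'f::euclidean_space) chart set \<Rightarrow> 'b set \<Rightarrow> ('b, 'f) vector_field \<Rightarrow> bool" where
  "smooth_vector_field_on B W X \<longleftrightarrow>
     (\<forall>u\<in>W. X u \<in> tangent_space B u) \<and>
     (\<forall>c\<in>B. smooth_on (chart_image c W) (\<lambda>z. X (chart_inv c z) c))"

section \<open>Sprays\<close>

text \<open>The points \<open>(x, y)\<close> of a subset \<open>U\<close> of the tangent bundle, and the functions on \<open>U\<close>,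
  in the coordinates induced by the chart \<open>c\<close>.\<close>

definition tangent_image ::
  "('a, 'e::euclidean_space) chart set \<Rightarrow> ('a, 'e) chart \<Rightarrow> ('a, 'e) tangent set \<Rightarrow> ('e \<times> 'e) set" where
  "tangent_image A c U = chart_image (tangent_chart A c) U"

definition local_expr ::
  "('a, 'e::euclidean_space) chart set \<Rightarrow> ('a, 'e) chart \<Rightarrow> (('a, 'e) tangent \<Rightarrow> 'b) \<Rightarrow> 'e \<times> 'e \<Rightarrow> 'b" where
  "local_expr A c P z = P (chart_inv (tangent_chart A c) z)"

text \<open>A vector field \<open>G\<close> on a part of the tangent bundle has, in the chart \<open>c\<close>, components in
  \<open>\<partial>/\<partial>x\<close> and \<open>\<partial>/\<partial>y\<close>; the latter are written \<open>-2G\<^sup>i\<close>.\<close>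

definition spray_coeff ::
  "('a, real^'n) chart set \<Rightarrow> (('a, real^'n) tangent, (real^'n) \<times> (real^'n)) vector_field
   \<Rightarrow> ('a, real^'n) chart \<Rightarrow> 'n \<Rightarrow> (real^'n) \<times> (real^'n) \<Rightarrow> real" where
  "spray_coeff A G c i z = - (1/2) * snd (local_expr A c G z (tangent_chart A c)) $ i"

definition spray ::
  "('a, real^'n) chart set \<Rightarrow> ('a, real^'n) tangent set
   \<Rightarrow> (('a, real^'n) tangent, (real^'n) \<times> (real^'n)) vector_field \<Rightarrow> bool" where
  "spray A C G \<longleftrightarrow>
     conical_region A C \<and>
     smooth_vector_field_on (tangent_atlas A) C G \<and>
     (\<forall>c\<in>A. \<forall>(x, y)\<in>tangent_image A c C.
        fst (local_expr A c G (x, y) (tangent_chart A c)) = y \<and>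
        (\<forall>i. \<forall>t>0. spray_coeff A G c i (x, t *\<^sub>R y) = t\<^sup>2 * spray_coeff A G c i (x, y)))"

definition partial_x :: "'n \<Rightarrow> ((real^'n) \<times> (real^'n) \<Rightarrow> real) \<Rightarrow> (real^'n) \<times> (real^'n) \<Rightarrow> real" where
  "partial_x k f z = frechet_derivative f (at z) (axis k 1, 0)"

definition partial_y :: "'n \<Rightarrow> ((real^'n) \<times> (real^'n) \<Rightarrow> real) \<Rightarrow> (real^'n) \<times> (real^'n) \<Rightarrow> real" where
  "partial_y k f z = frechet_derivative f (at z) (0, axis k 1)"

text \<open>In the following two definitions \<open>g i\<close> stands for the spray coefficient \<open>G\<^sup>i\<close>.\<close>

definition riemann_curvature ::
  "('n \<Rightarrow> (real^'n) \<times> (real^'n) \<Rightarrow> real) \<Rightarrow> 'n \<Rightarrow> 'n \<Rightarrow> (real^'n) \<times> (real^'n) \<Rightarrow> real" where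
  "riemann_curvature g i k z =
     2 * partial_x k (g i) z
     - (\<Sum>j\<in>UNIV. snd z $ j * partial_x j (partial_y k (g i)) z)
     + 2 * (\<Sum>j\<in>UNIV. g j z * partial_y j (partial_y k (g i)) z)
     - (\<Sum>j\<in>UNIV. partial_y j (g i) z * partial_y k (g j) z)"

definition horizontal_derivative ::
  "('n \<Rightarrow> (real^'n) \<times> (real^'n) \<Rightarrow> real) \<Rightarrow> 'n \<Rightarrow> ((real^'n) \<times> (real^'n) \<Rightarrow> real)
   \<Rightarrow> (real^'n) \<times> (real^'n) \<Rightarrow> real" where
  "horizontal_derivative g k f z =
     partial_x k f z - (\<Sum>r\<in>UNIV. partial_y k (g r) z * partial_y r f z)"

definition R_flat ::
  "('a, real^'n) chart set \<Rightarrow> ('a, real^'n) tangent set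
   \<Rightarrow> (('a, real^'n) tangent, (real^'n) \<times> (real^'n)) vector_field \<Rightarrow> bool" where
  "R_flat A C G \<longleftrightarrow>
     (\<forall>c\<in>A. \<forall>z\<in>tangent_image A c C. \<forall>i k. riemann_curvature (spray_coeff A G c) i k z = 0)"

definition funk_function ::
  "('a, real^'n) chart set
   \<Rightarrow> (('a, real^'n) tangent, (real^'n) \<times> (real^'n)) vector_field
   \<Rightarrow> ('a, real^'n) tangent set \<Rightarrow> (('a, real^'n) tangent \<Rightarrow> real) \<Rightarrow> bool" where
  "funk_function A G U P \<longleftrightarrow>
     (\<forall>c\<in>A. smooth_on (tangent_image A c U) (local_expr A c P)) \<and>
     (\<forall>u\<in>U. \<forall>t>0. P (tangent_scale t u) = t * P u) \<and>
     (\<forall>c\<in>A. \<forall>z\<in>tangent_image A c U. \<forall>k.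
        horizontal_derivative (spray_coeff A G c) k (local_expr A c P) z =
          local_expr A c P z * partial_y k (local_expr A c P) z)"

end

theory Submission
  imports Defs
begin

text \<open>
  Write \<open>G\<close> for the vector of spray coefficients in a chart and \<open>N z k\<close> for its derivative at \<open>z = (x, y)\<close> in
  the fibre direction \<open>k\<close>.  The Funk equation says that the derivative of \<open>P\<close> at \<open>z\<close> annihilates the
  vectors \<open>(k, - (N z k + P z k))\<close> for all \<open>k\<close>.  It is a quasilinear first-order system, and it can be solved
  by characteristics: for each constant \<open>s\<close> the vectors \<open>(k, - (N z k + s k))\<close> span
  a distribution, and a function that is constant, with value \<open>s\<close>, along leaves belonging to \<open>s\<close> solves the
  system.  These distributions are integrable when the spray is R-flat.  Indeed, the curvature of the
  horizontal distribution arises from \<open>R\<^sup>i\<^sub>k\<close> by differentiating along the fibre and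
  antisymmetrising, hence it vanishes (\<open>horizontal_integrability\<close>), and the term \<open>s k\<close> contributes
  nothing because second fibre derivatives of \<open>G\<close> are symmetric.  So \<open>P\<close> may be prescribed on the
  fibre over one point \<open>x0\<close>, for instance as a linear functional \<open>\<alpha>\<close> that does not vanish at the given
  vector, and it can then be propagated along the leaves.

  Concretely, a point \<open>(x, y)\<close> is joined to the fibre over \<open>x0\<close> by the curve \<open>Y\<close> of the leaf that lies over
  the segment from \<open>x\<close> to \<open>x0\<close>, and \<open>P (x, y) = \<alpha> (Y 1)\<close>.  As this number is also the constant \<open>s\<close> of
  the leaf, \<open>Y\<close> solves an integral equation in which the end value \<open>Y 1\<close> occurs.  For \<open>x\<close> near
  \<open>x0\<close> it is a contraction, uniformly on a cone of vectors \<open>y\<close> by homogeneity, so \<open>Y\<close> exists and is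
  unique.  It depends smoothly on \<open>(x, y)\<close> since its derivatives solve linear equations of the
  same type (\<open>solves_imp_Ck_family\<close>).  Uniqueness, applied to the equation, gives homogeneity of \<open>P\<close>; applied
  to the linearised equation, it gives the Funk equation (\<open>funk_function_on_Q\<close>): in the direction
  \<open>(k, W k)\<close> tangent to the leaf the derivative of \<open>Y\<close> at time \<open>t\<close> is \<open>1 - t\<close> times the fibre
  component of the corresponding tangent vector at time \<open>t\<close>, and this is zero at the end of the curve.

  On the manifold, the function is transported to the part of the tangent bundle over one chart.  The Funk
  equation in any other chart follows from the transformation law of the spray coefficients, in which the
  second derivatives of the coordinate change cancel (\<open>funk_equation_transformation\<close>).
\<close>

section \<open>Families of class \<open>C\<^sup>k\<close> depending continuously on a time\<close>

abbreviation D :: "('p::real_normed_vector \<Rightarrow> 'e::real_normed_vector) \<Rightarrow> 'p \<Rightarrow> 'p \<Rightarrow> 'e" where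
  "D f x \<equiv> frechet_derivative f (at x)"

text \<open>The parameter \<open>t\<close> plays the role of the time of a differential equation: all derivatives are
  taken in \<open>q\<close> alone and are jointly continuous in \<open>(t, q)\<close>, so that the compact time interval
  \<open>{0..1}\<close> can be used without one-sided time derivatives.  Joint continuity is demanded at every
  order because differentiability in \<open>q\<close> says nothing about continuity in \<open>t\<close>.\<close>

primrec Ck_family :: "nat \<Rightarrow> real set \<Rightarrow> 'q::euclidean_space set \<Rightarrow>
    (real \<Rightarrow> 'q \<Rightarrow> 'e::euclidean_space) \<Rightarrow> bool" where
  "Ck_family 0 T Q g \<longleftrightarrow> continuous_on (T \<times> Q) (\<lambda>(t, q). g t q)"
| "Ck_family (Suc n) T Q g \<longleftrightarrow>
     continuous_on (T \<times> Q) (\<lambda>(t, q). g t q) \<and>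
     (\<forall>t\<in>T. \<forall>q\<in>Q. g t differentiable (at q)) \<and>
     (\<forall>v. Ck_family n T Q (\<lambda>t q. D (g t) q v))"

lemma Ck_family_continuous:
  "Ck_family n T Q g \<Longrightarrow> continuous_on (T \<times> Q) (\<lambda>(t, q). g t q)"
  by (cases n) auto

lemma Ck_family_continuous_pair:
  "Ck_family n T Q g \<Longrightarrow> continuous_on (T \<times> Q) (\<lambda>x. g (fst x) (snd x))"
  using Ck_family_continuous[of n T Q g] by (simp add: case_prod_beta)

lemma Ck_family_continuous_time:
  assumes "Ck_family n T Q g" "q \<in> Q"
  shows "continuous_on T (\<lambda>t. g t q)"
  by (rule continuous_on_compose2[OF Ck_family_continuous_pair[OF assms(1)], of T "\<lambda>t. (t, q)", simplified])
    (use assms in \<open>auto intro!: continuous_intros\<close>)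

lemma Ck_family_has_derivative:
  assumes "Ck_family (Suc n) T Q g" "t \<in> T" "q \<in> Q"
  shows "(g t has_derivative D (g t) q) (at q)"
  using assms by (simp add: frechet_derivative_works)

lemma Ck_family_subset:
  assumes "Ck_family n T Q g" "T' \<subseteq> T" "Q' \<subseteq> Q"
  shows "Ck_family n T' Q' g"
  using assms
proof (induction n arbitrary: g)
  case 0
  then show ?case by (auto intro: continuous_on_subset[OF _ Sigma_mono])
next
  case (Suc n)
  then have "continuous_on (T' \<times> Q') (\<lambda>(t, q). g t q)"
    by (auto intro: continuous_on_subset[OF _ Sigma_mono])
  with Suc show ?case by (auto simp: subset_iff)
qed

lemma Ck_family_Suc_imp: "Ck_family (Suc n) T Q g \<Longrightarrow> Ck_family n T Q g"
  by (induction n arbitrary: g) auto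

lemma Ck_family_le: "m \<le> n \<Longrightarrow> Ck_family n T Q g \<Longrightarrow> Ck_family m T Q g"
  by (induction n rule: dec_induct) (auto dest: Ck_family_Suc_imp simp del: Ck_family.simps)

lemma Ck_family_cong:
  assumes "open Q" "\<And>t q. t \<in> T \<Longrightarrow> q \<in> Q \<Longrightarrow> g t q = h t q" "Ck_family n T Q g"
  shows "Ck_family n T Q h"
  using assms(2,3)
proof (induction n arbitrary: g h)
  case 0
  have "continuous_on (T \<times> Q) (\<lambda>(t, q). g t q) \<longleftrightarrow> continuous_on (T \<times> Q) (\<lambda>(t, q). h t q)"
    by (rule continuous_on_cong) (use 0 in auto)
  then show ?case using 0 by simp
next
  case (Suc n)
  have dh: "(h t has_derivative D (g t) q) (at q)" if "t \<in> T" "q \<in> Q" for t q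
    by (rule has_derivative_transform_within_open[OF Ck_family_has_derivative[OF Suc.prems(2) that] assms(1) that(2)])
      (use Suc.prems(1) that in auto)
  have "continuous_on (T \<times> Q) (\<lambda>(t, q). g t q) \<longleftrightarrow> continuous_on (T \<times> Q) (\<lambda>(t, q). h t q)"
    by (rule continuous_on_cong) (use Suc.prems in auto)
  then have "Ck_family 0 T Q h"
    using Suc.prems by simp
  moreover have "Ck_family n T Q (\<lambda>t q. D (h t) q v)" for v
  proof (rule Suc.IH[of "\<lambda>t q. D (g t) q v"])
    show "D (g t) q v = D (h t) q v" if "t \<in> T" "q \<in> Q" for t q
      using frechet_derivative_at[OF dh[OF that]] by simp
  qed (use Suc.prems in simp)
  ultimately show ?case
    using dh by (auto simp: differentiable_def)
qed

lemma Ck_family_SucI: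
  assumes "open Q" "continuous_on (T \<times> Q) (\<lambda>(t, q). g t q)"
    and d: "\<And>t q. t \<in> T \<Longrightarrow> q \<in> Q \<Longrightarrow> (g t has_derivative g' t q) (at q)"
    and "\<And>v. Ck_family n T Q (\<lambda>t q. g' t q v)"
  shows "Ck_family (Suc n) T Q g"
proof -
  have "Ck_family n T Q (\<lambda>t q. D (g t) q v)" for v
    by (rule Ck_family_cong[OF assms(1) _ assms(4)[of v]]) (simp add: frechet_derivative_at[OF d, symmetric])
  then show ?thesis using assms(2) d by (auto simp: differentiable_def)
qed

lemma Ck_family_time:
  assumes "open Q" "continuous_on T c"
  shows "Ck_family n T Q (\<lambda>t q. c t)"
  using assms(2)
proof (induction n arbitrary: c)
  case 0
  have "continuous_on (T \<times> Q) (\<lambda>x. c (fst x))"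
    by (rule continuous_on_compose2[OF 0]) (auto intro!: continuous_intros)
  then show ?case by (simp add: case_prod_beta)
next
  case (Suc n)
  have "continuous_on (T \<times> Q) (\<lambda>x. c (fst x))"
    by (rule continuous_on_compose2[OF Suc.prems]) (auto intro!: continuous_intros)
  then show ?case
    using Suc.IH[of "\<lambda>_. 0"]
    by (intro Ck_family_SucI[OF assms(1), where g' = "\<lambda>_ _ _. 0"]) (auto simp: case_prod_beta)
qed

lemma Ck_family_bounded_linear:
  assumes "open Q" "bounded_linear L" "Ck_family n T Q g"
  shows "Ck_family n T Q (\<lambda>t q. L (g t q))"
  using assms(3)
proof (induction n arbitrary: g)
  case 0
  then show ?case
    using bounded_linear.continuous_on[OF assms(2)] by (auto simp: case_prod_beta)
next
  case (Suc n)
  show ?case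
  proof (rule Ck_family_SucI[OF assms(1), where g' = "\<lambda>t q v. L (D (g t) q v)"])
    show "continuous_on (T \<times> Q) (\<lambda>(t, q). L (g t q))"
      using bounded_linear.continuous_on[OF assms(2) Ck_family_continuous_pair[OF Suc.prems]]
      by (simp add: case_prod_beta)
    show "((\<lambda>q. L (g t q)) has_derivative (\<lambda>v. L (D (g t) q v))) (at q)"
      if "t \<in> T" "q \<in> Q" for t q
      by (rule bounded_linear.has_derivative[OF assms(2) Ck_family_has_derivative[OF Suc.prems that]])
    show "Ck_family n T Q (\<lambda>t q. L (D (g t) q v))" for v
      using Suc by auto
  qed
qed

lemma Ck_family_ident:
  assumes "open Q"
  shows "Ck_family n T Q (\<lambda>t q. q)"
proof (cases n)
  case 0
  then show ?thesis by (auto simp: case_prod_beta intro!: continuous_intros)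
next
  case (Suc m)
  then show ?thesis
    by (auto intro!: Ck_family_SucI[OF assms, where g' = "\<lambda>_ _ v. v"] Ck_family_time[OF assms]
        continuous_intros simp: case_prod_beta)
qed

lemma Ck_family_add:
  assumes "open Q" "Ck_family n T Q f" "Ck_family n T Q g"
  shows "Ck_family n T Q (\<lambda>t q. f t q + g t q)"
  using assms(2,3)
proof (induction n arbitrary: f g)
  case 0
  then show ?case by (auto simp: case_prod_beta intro!: continuous_intros)
next
  case (Suc n)
  show ?case
    by (rule Ck_family_SucI[OF assms(1), where g' = "\<lambda>t q v. D (f t) q v
          + D (g t) q v"])
      (use Suc Ck_family_has_derivative[OF Suc.prems(1)] Ck_family_has_derivative[OF Suc.prems(2)] in
        \<open>auto simp: case_prod_beta intro!: continuous_intros has_derivative_add\<close>)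
qed

lemma Ck_family_sum:
  assumes "open Q" "\<And>i. i \<in> I \<Longrightarrow> Ck_family n T Q (f i)"
  shows "Ck_family n T Q (\<lambda>t q. \<Sum>i\<in>I. f i t q)"
  using assms(2)
  by (induction I rule: infinite_finite_induct)
    (auto intro!: Ck_family_time[OF assms(1)] Ck_family_add[OF assms(1)])

lemma Ck_family_bilinear:
  assumes "open Q" "bounded_bilinear pr" "Ck_family n T Q f" "Ck_family n T Q g"
  shows "Ck_family n T Q (\<lambda>t q. pr (f t q) (g t q))"
  using assms(3,4)
proof (induction n arbitrary: f g)
  case 0
  then show ?case
    by (auto simp: case_prod_beta intro!: bounded_bilinear.continuous_on[OF assms(2)])
next
  case (Suc n)
  show ?case
  proof (rule Ck_family_SucI[OF assms(1), where g' = "\<lambda>t q v. pr (f t q) (D (g t) q v)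
          + pr (D (f t) q v) (g t q)"])
    show "continuous_on (T \<times> Q) (\<lambda>(t, q). pr (f t q) (g t q))"
      using bounded_bilinear.continuous_on[OF assms(2) Ck_family_continuous_pair[OF Suc.prems(1)]
          Ck_family_continuous_pair[OF Suc.prems(2)]]
      by (simp add: case_prod_beta)
    show "((\<lambda>q. pr (f t q) (g t q)) has_derivative (\<lambda>v. pr (f t q) (D (g t) q v)
          + pr (D (f t) q v) (g t q))) (at q)" if "t \<in> T" "q \<in> Q" for t q
      by (rule bounded_bilinear.FDERIV[OF assms(2) Ck_family_has_derivative[OF Suc.prems(1) that]
            Ck_family_has_derivative[OF Suc.prems(2) that]])
    show "Ck_family n T Q (\<lambda>t q. pr (f t q) (D (g t) q v)
          + pr (D (f t) q v) (g t q))" for v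
      using Suc.prems Ck_family_Suc_imp[OF Suc.prems(1)] Ck_family_Suc_imp[OF Suc.prems(2)]
      by (intro Ck_family_add[OF assms(1)] Suc.IH) auto
  qed
qed

lemma Ck_family_Pair:
  assumes "open Q" "Ck_family n T Q f" "Ck_family n T Q g"
  shows "Ck_family n T Q (\<lambda>t q. (f t q, g t q))"
proof -
  have "bounded_linear (\<lambda>x::'b. (x, 0::'c))" "bounded_linear (\<lambda>x::'c. (0::'b, x))"
    by (auto intro!: bounded_linear_Pair bounded_linear_zero bounded_linear_ident)
  from Ck_family_add[OF assms(1) Ck_family_bounded_linear[OF assms(1) this(1) assms(2)]
      Ck_family_bounded_linear[OF assms(1) this(2) assms(3)]]
  show ?thesis by simp
qed

lemma linear_eq_Basis_sum:
  assumes "linear L"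
  shows "L (x::'a::euclidean_space) = (\<Sum>i\<in>Basis. (x \<bullet> i) *\<^sub>R L i)"
proof -
  have "L x = L (\<Sum>i\<in>Basis. (x \<bullet> i) *\<^sub>R i)" by (simp add: euclidean_representation)
  also have "\<dots> = (\<Sum>i\<in>Basis. (x \<bullet> i) *\<^sub>R L i)"
    by (simp add: linear_sum[OF assms] linear_scale[OF assms])
  finally show ?thesis .
qed

text \<open>A family of linear maps is controlled through its values on fixed vectors; expanding the argument
  in the standard basis turns the application into a finite sum of products.\<close>

lemma Ck_family_apply:
  fixes L :: "real \<Rightarrow> 'q::euclidean_space \<Rightarrow> 'p::euclidean_space \<Rightarrow> 'e::euclidean_space"
  assumes "open Q" "\<And>w. Ck_family n T Q (\<lambda>t q. L t q w)"
    and "\<And>t q. t \<in> T \<Longrightarrow> q \<in> Q \<Longrightarrow> linear (L t q)"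
    and "Ck_family n T Q g"
  shows "Ck_family n T Q (\<lambda>t q. L t q (g t q))"
proof -
  have "Ck_family n T Q (\<lambda>t q. \<Sum>i\<in>Basis. (g t q \<bullet> i) *\<^sub>R L t q i)"
    by (intro Ck_family_sum Ck_family_bilinear[OF _ bounded_bilinear_scaleR] assms
        Ck_family_bounded_linear[OF _ bounded_linear_inner_left])
  then show ?thesis
    by (rule Ck_family_cong[OF assms(1), rotated]) (rule linear_eq_Basis_sum[symmetric], rule assms)
qed

lemma continuous_on_family_compose:
  assumes f: "continuous_on (T \<times> \<Omega>) (\<lambda>(t, p). f t p)" and g: "continuous_on (T \<times> Q) (\<lambda>(t, q). g t q)"
    and into: "\<And>t q. t \<in> T \<Longrightarrow> q \<in> Q \<Longrightarrow> g t q \<in> \<Omega>"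
  shows "continuous_on (T \<times> Q) (\<lambda>(t, q). f t (g t q))"
proof -
  have "continuous_on (T \<times> Q) (\<lambda>x. (fst x, g (fst x) (snd x)))"
    using g by (intro continuous_on_Pair continuous_on_fst continuous_on_id) (simp add: case_prod_beta)
  from continuous_on_compose2[OF f this] into show ?thesis
    by (force simp: case_prod_beta)
qed

lemma Ck_family_compose:
  assumes "open Q" "Ck_family n T \<Omega> f" "Ck_family n T Q g"
    and into: "\<And>t q. t \<in> T \<Longrightarrow> q \<in> Q \<Longrightarrow> g t q \<in> \<Omega>"
  shows "Ck_family n T Q (\<lambda>t q. f t (g t q))"
  using assms(2,3)
proof (induction n arbitrary: f)
  case 0
  then show ?case using continuous_on_family_compose[OF _ _ into] by simp
next
  case (Suc n)
  show ?case
  proof (rule Ck_family_SucI[OF assms(1), where g' = "\<lambda>t q v. D (f t) (g t q)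
        (D (g t) q v)"])
    show "continuous_on (T \<times> Q) (\<lambda>(t, q). f t (g t q))"
      using continuous_on_family_compose[OF _ _ into] Suc.prems[THEN Ck_family_continuous] by simp
    show "((\<lambda>q. f t (g t q)) has_derivative (\<lambda>v. D (f t) (g t q)
        (D (g t) q v))) (at q)" if "t \<in> T" "q \<in> Q" for t q
      using diff_chain_at[OF Ck_family_has_derivative[OF Suc.prems(2) that]
          Ck_family_has_derivative[OF Suc.prems(1) that(1) into[OF that]]]
      by (simp add: o_def)
    show "Ck_family n T Q (\<lambda>t q. D (f t) (g t q)
        (D (g t) q v))" for v
    proof (rule Ck_family_apply[OF assms(1), where L = "\<lambda>t q. D (f t) (g t q)"])
      show "Ck_family n T Q (\<lambda>t q. D (f t) (g t q) w)" for w
        using Suc.prems Ck_family_Suc_imp[OF Suc.prems(2)]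
        by (intro Suc.IH[of "\<lambda>t p. D (f t) p w"]) auto
      show "linear (D (f t) (g t q))" if "t \<in> T" "q \<in> Q" for t q
        using Suc.prems(1) into[OF that] that by (auto intro: linear_frechet_derivative)
      show "Ck_family n T Q (\<lambda>t q. D (g t) q v)"
        using Suc.prems by auto
    qed
  qed
qed

lemma times_differentiable_on_imp_continuous_on:
  "times_differentiable_on n S f \<Longrightarrow> continuous_on S f"
  by (cases n)
    (auto simp: differentiable_imp_continuous_on differentiable_on_def differentiable_at_withinI)

lemma Ck_family_of_times_differentiable_on:
  "times_differentiable_on n S f \<Longrightarrow> Ck_family n T S (\<lambda>_. f)"
proof (induction n arbitrary: f)
  case 0
  then have "continuous_on (T \<times> S) (\<lambda>x. f (snd x))"
    by (auto intro!: continuous_on_compose2[of S f] continuous_intros)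
  then show ?case by (simp add: case_prod_beta)
next
  case (Suc n)
  have "continuous_on (T \<times> S) (\<lambda>x. f (snd x))"
    using times_differentiable_on_imp_continuous_on[OF Suc.prems]
    by (auto intro!: continuous_on_compose2[of S f] continuous_intros)
  then show ?case using Suc by (auto simp: case_prod_beta)
qed

lemma times_differentiable_on_of_Ck_family:
  assumes "Ck_family n T S g" "t \<in> T"
  shows "times_differentiable_on n S (g t)"
  using assms(1)
proof (induction n arbitrary: g)
  case 0
  have "continuous_on S (\<lambda>q. (\<lambda>(t, q). g t q) (t, q))"
    by (rule continuous_on_compose2[OF Ck_family_continuous[OF 0]])
      (use assms(2) in \<open>auto intro!: continuous_intros\<close>)
  then show ?case by simp
next
  case (Suc n)
  then show ?case using assms(2) by auto
qed

lemma smooth_on_imp_Ck_family: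
  "smooth_on S f \<Longrightarrow> Ck_family n T S (\<lambda>_. f)"
  by (simp add: smooth_on_def Ck_family_of_times_differentiable_on)

lemma smooth_on_of_Ck_family:
  "(\<And>n. Ck_family n T S g) \<Longrightarrow> t \<in> T \<Longrightarrow> smooth_on S (g t)"
  unfolding smooth_on_def using times_differentiable_on_of_Ck_family by blast

section \<open>Uniform first-order expansion and time integrals\<close>

lemma Ck_family_frozen_time:
  assumes "open Q" "Ck_family n T Q g" "s \<in> T"
  shows "Ck_family n T' Q (\<lambda>t q. g s q)"
  using assms(2)
proof (induction n arbitrary: g)
  case 0
  have "continuous_on (T' \<times> Q) (\<lambda>x. g s (snd x))"
    by (rule continuous_on_compose2[OF Ck_family_continuous_pair[OF 0], of _ "\<lambda>x. (s, snd x)", simplified])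
      (use assms(3) in \<open>auto intro!: continuous_on_Pair continuous_on_snd continuous_on_id continuous_on_const\<close>)
  then show ?case by (simp add: case_prod_beta)
next
  case (Suc n)
  have "continuous_on (T' \<times> Q) (\<lambda>x. g s (snd x))"
    by (rule continuous_on_compose2[OF Ck_family_continuous_pair[OF Suc.prems], of _ "\<lambda>x. (s, snd x)", simplified])
      (use assms(3) in \<open>auto intro!: continuous_on_Pair continuous_on_snd continuous_on_id continuous_on_const\<close>)
  with Suc assms(3) show ?case by (auto simp: case_prod_beta)
qed

text \<open>The first-order Taylor remainder is small uniformly in time along a continuous curve \<open>p\<close>: by
  compactness of \<open>T\<close> the derivative varies little on one tube around the curve, and the mean value
  inequality applies in each ball of the tube.  This is what makes it possible to differentiate
  under time integrals and to linearise integral equations.\<close>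

lemma Ck_family_uniform_remainder:
  fixes f :: "real \<Rightarrow> 'p::euclidean_space \<Rightarrow> 'e::euclidean_space"
  assumes "open \<Omega>" "Ck_family (Suc 0) T \<Omega> f" "compact T" "continuous_on T p" "p ` T \<subseteq> \<Omega>" "e > 0"
  obtains d where "d > 0"
    "\<And>t x. t \<in> T \<Longrightarrow> norm (x - p t) < d \<Longrightarrow> x \<in> \<Omega> \<and>
       norm (f t x - f t (p t) - D (f t) (p t) (x - p t)) \<le> e * norm (x - p t)"
proof -
  let ?D = "\<lambda>i t x. D (f t) x i"
  have "compact (p ` T)" by (rule compact_continuous_image[OF assms(4,3)])
  then obtain r where r: "r > 0" "(\<Union>x\<in>p ` T. ball x r) \<subseteq> \<Omega>"
    using compact_subset_open_imp_ball_epsilon_subset[OF _ assms(1,5)] by metis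
  have in\<Omega>: "x \<in> \<Omega>" if "t \<in> T" "norm (x - p t) < r" for t x
  proof -
    have "x \<in> ball (p t) r" using that by (simp add: dist_norm norm_minus_commute)
    then show ?thesis using r(2) that(1) by blast
  qed
  define c where "c = e / real (DIM('p))"
  have c: "c > 0" using assms(6) by (simp add: c_def)
  have "\<exists>X. 0 \<in> X \<and> open X \<and> (\<forall>w\<in>X \<inter> ball 0 r. \<forall>t\<in>T. dist (?D i t (p t + w)) (?D i t (p t)) \<le> c)" for i
  proof -
    have cD: "continuous_on (T \<times> \<Omega>) (\<lambda>x. ?D i (fst x) (snd x))"
      using assms(2) by (simp add: case_prod_beta)
    have "continuous_on (ball 0 r \<times> T) (\<lambda>x. (snd x, p (snd x) + fst x))"
      by (intro continuous_on_Pair continuous_on_add continuous_on_fst continuous_on_snd continuous_on_id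
          continuous_on_compose2[OF assms(4)]) auto
    then have "continuous_on (ball 0 r \<times> T) (\<lambda>x. ?D i (snd x) (p (snd x) + fst x))"
      by (rule continuous_on_compose2[OF cD, of _ "\<lambda>x. (snd x, p (snd x) + fst x)", simplified])
        (auto intro!: in\<Omega>)
    from continuous_on_prod_compactE[OF this assms(3), of 0 c] show ?thesis
      using r(1) c by (simp, metis)
  qed
  then have "\<forall>i. \<exists>X. 0 \<in> X \<and> open X \<and>
      (\<forall>w\<in>X \<inter> ball 0 r. \<forall>t\<in>T. dist (?D i t (p t + w)) (?D i t (p t)) \<le> c)" by blast
  from choice[OF this] obtain X where X0: "\<forall>i. 0 \<in> X i \<and> open (X i) \<and>
      (\<forall>w\<in>X i \<inter> ball 0 r. \<forall>t\<in>T. dist (?D i t (p t + w)) (?D i t (p t)) \<le> c)" by blast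
  then have X: "\<And>i. 0 \<in> X i" "\<And>i. open (X i)"
    "\<And>i w t. w \<in> X i \<Longrightarrow> norm w < r \<Longrightarrow> t \<in> T \<Longrightarrow> dist (?D i t (p t + w)) (?D i t (p t)) \<le> c"
    by auto
  have "open (\<Inter>i\<in>Basis. X i)" "0 \<in> (\<Inter>i\<in>Basis. X i)" using X by auto
  then obtain d' where d': "d' > 0" "ball 0 d' \<subseteq> (\<Inter>i\<in>Basis. X i)"
    using openE by blast
  define d where "d = min d' r"
  have d: "d > 0" using d' r by (simp add: d_def)
  have "x \<in> \<Omega> \<and>
       norm (f t x - f t (p t) - D (f t) (p t) (x - p t)) \<le> e * norm (x - p t)"
    if t: "t \<in> T" and x: "norm (x - p t) < d" for t x
  proof
    have der: "(f t has_derivative D (f t) x) (at x)" if "norm (x - p t) < d" for x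
      using Ck_family_has_derivative[OF assms(2) t in\<Omega>[OF t]] that by (simp add: d_def)
    show "x \<in> \<Omega>" using in\<Omega>[OF t] x by (simp add: d_def)
    have "norm (f t x - f t (p t) - D (f t) (p t) (x - p t)) \<le> norm (x - p t) * e"
    proof (rule differentiable_bound_linearization[where S = "ball (p t) d" and f' = "\<lambda>x. D (f t) x"])
      show "p t + s *\<^sub>R (x - p t) \<in> ball (p t) d" if "s \<in> {0..1}" for s
      proof -
        have "\<bar>s\<bar> * norm (x - p t) \<le> 1 * norm (x - p t)"
          using that by (intro mult_right_mono) auto
        with x show ?thesis by (simp add: dist_norm)
      qed
      show "p t \<in> ball (p t) d" using d by simp
      show "(f t has_derivative D (f t) x) (at x within ball (p t) d)"
        if "x \<in> ball (p t) d" for x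
        by (rule has_derivative_at_withinI, rule der) (use that in \<open>simp add: dist_norm norm_minus_commute\<close>)
      show "onorm (D (f t) x - D (f t) (p t)) \<le> e"
        if "x \<in> ball (p t) d" for x
      proof -
        have xd: "norm (x - p t) < d" using that by (simp add: dist_norm norm_minus_commute)
        have "bounded_linear (D (f t) x - D (f t) (p t))"
          unfolding fun_diff_def using d
          by (intro bounded_linear_sub has_derivative_bounded_linear[OF der] xd) simp
        then have "onorm (D (f t) x - D (f t) (p t))
            \<le> (\<Sum>i\<in>Basis. norm ((D (f t) x - D (f t) (p t)) i))"
          by (rule onorm_componentwise)
        also have "\<dots> \<le> (\<Sum>i\<in>(Basis::'p set). c)"
        proof (rule sum_mono)
          fix i :: 'p assume "i \<in> Basis"
          moreover have "x - p t \<in> ball 0 d'" using xd by (simp add: d_def)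
          ultimately have "x - p t \<in> X i" using d'(2) by blast
          from X(3)[OF this _ t] xd
          show "norm ((D (f t) x - D (f t) (p t)) i) \<le> c"
            by (simp add: d_def dist_norm)
        qed
        also have "\<dots> = e" by (simp add: c_def)
        finally show ?thesis .
      qed
    qed
    then show "norm (f t x - f t (p t) - D (f t) (p t) (x - p t)) \<le> e * norm (x - p t)"
      by (simp add: mult.commute)
  qed
  with d show thesis by (rule that)
qed

lemma continuous_family_uniform:
  fixes g :: "real \<Rightarrow> 'q::metric_space \<Rightarrow> 'e::metric_space"
  assumes "continuous_on (T \<times> Q) (\<lambda>(t, q). g t q)" "compact T" "q \<in> Q" "e > 0"
  obtains d where "d > 0"
    "\<And>t q'. t \<in> T \<Longrightarrow> q' \<in> Q \<Longrightarrow> dist q' q < d \<Longrightarrow> dist (g t q') (g t q) \<le> e"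
proof -
  have "continuous_on (Q \<times> T) (\<lambda>x. (\<lambda>(t, q). g t q) (snd x, fst x))"
    by (rule continuous_on_compose2[OF assms(1)])
      (auto intro!: continuous_on_Pair continuous_on_fst continuous_on_snd continuous_on_id)
  then have "continuous_on (Q \<times> T) (\<lambda>(q, t). g t q)" by (simp add: case_prod_beta)
  from continuous_on_prod_compactE[OF this assms(2-4)] obtain X where
    X: "q \<in> X" "open X" "\<forall>q'\<in>X \<inter> Q. \<forall>t\<in>T. dist (case (q', t) of (q, t) \<Rightarrow> g t q) (case (q, t) of (q, t) \<Rightarrow> g t q) \<le> e"
    by blast
  obtain d where d: "d > 0" "ball q d \<subseteq> X" using openE[OF X(2,1)] by blast
  have "dist (g t q') (g t q) \<le> e" if "t \<in> T" "q' \<in> Q" "dist q' q < d" for t q'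
  proof -
    have "q' \<in> X" using d(2) that(3) by (auto simp: dist_commute)
    then show ?thesis using X(3) that by auto
  qed
  with d(1) show thesis by (rule that)
qed

lemma continuous_familyI:
  fixes g :: "real \<Rightarrow> 'q::metric_space \<Rightarrow> 'e::metric_space"
  assumes time: "\<And>q. q \<in> Q \<Longrightarrow> continuous_on T (\<lambda>t. g t q)"
    and unif: "\<And>q e. q \<in> Q \<Longrightarrow> e > 0 \<Longrightarrow> \<exists>d>0. \<forall>q'\<in>Q. dist q' q < d \<longrightarrow> (\<forall>t\<in>T. dist (g t q') (g t q) \<le> e)"
  shows "continuous_on (T \<times> Q) (\<lambda>(t, q). g t q)"
proof -
  have main: "\<exists>d>0. \<forall>t'\<in>T. \<forall>q'\<in>Q. dist (t', q') (t, q) < d \<longrightarrow> dist (g t' q') (g t q) < e"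
    if tq: "t \<in> T" "q \<in> Q" "e > 0" for t q e
  proof -
  obtain d1 where d1: "d1 > 0" "\<And>t'. t' \<in> T \<Longrightarrow> dist t' t < d1 \<Longrightarrow> dist (g t' q) (g t q) < e / 2"
    using time[OF tq(2)] tq unfolding continuous_on_iff by (meson half_gt_zero)
  obtain d2 where d2: "d2 > 0" "\<And>q' t. q' \<in> Q \<Longrightarrow> t \<in> T \<Longrightarrow> dist q' q < d2 \<Longrightarrow> dist (g t q') (g t q) \<le> e / 2"
    using unif[OF tq(2), of "e / 2"] tq(3) by auto
  have "dist (g t' q') (g t q) < e"
    if "t' \<in> T" "q' \<in> Q" "dist (t', q') (t, q) < min d1 d2" for t' q'
  proof -
    have "dist t' t < d1" "dist q' q < d2"
      using that(3) dist_fst_le[of "(t', q')" "(t, q)"] dist_snd_le[of "(t', q')" "(t, q)"] by auto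
    then have "dist (g t' q) (g t q) < e / 2" "dist (g t' q') (g t' q) \<le> e / 2"
      using d1 d2 that by auto
    then show ?thesis using dist_triangle[of "g t' q'" "g t q" "g t' q"] by linarith
  qed
  then show ?thesis
    using d1(1) d2(1) by (intro exI[of _ "min d1 d2"]) auto
  qed
  show ?thesis
    unfolding continuous_on_iff using main by auto
qed

lemma integrable_on_initial:
  fixes f :: "real \<Rightarrow> 'e::euclidean_space"
  assumes "continuous_on {0..1} f" "t \<in> {0..1}"
  shows "f integrable_on {0..t}"
  using assms by (intro integrable_continuous_real) (auto intro: continuous_on_subset)

lemma norm_integral_initial_le:
  fixes f :: "real \<Rightarrow> 'e::euclidean_space"
  assumes "continuous_on {0..1} f" "t \<in> {0..1}" "\<And>s. s \<in> {0..1} \<Longrightarrow> norm (f s) \<le> B"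
  shows "norm (integral {0..t} f) \<le> B"
proof -
  have "norm (integral {0..t} f) \<le> B * (t - 0)"
    using assms by (intro integral_bound) (auto intro: continuous_on_subset)
  also have "\<dots> \<le> B * 1"
    using assms(2) order_trans[OF norm_ge_zero assms(3)[of 0]] by (intro mult_left_mono) auto
  finally show ?thesis by simp
qed

lemma continuous_on_family_slice:
  assumes "continuous_on (T \<times> Q) (\<lambda>(t, q). g t q)" "q \<in> Q"
  shows "continuous_on T (\<lambda>t. g t q)"
proof -
  have "continuous_on T (\<lambda>t. (\<lambda>(t, q). g t q) (t, q))"
    by (rule continuous_on_compose2[OF assms(1)])
      (use assms(2) in \<open>auto intro!: continuous_on_Pair continuous_on_id continuous_on_const\<close>)
  then show ?thesis by simp
qed

lemma continuous_on_family_integral: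
  fixes g :: "real \<Rightarrow> 'q::metric_space \<Rightarrow> 'e::euclidean_space"
  assumes "continuous_on ({0..1} \<times> Q) (\<lambda>(t, q). g t q)"
  shows "continuous_on ({0..1} \<times> Q) (\<lambda>(t, q). integral {0..t} (\<lambda>s. g s q))"
proof (rule continuous_familyI)
  note slice = continuous_on_family_slice[OF assms]
  show "continuous_on {0..1} (\<lambda>t. integral {0..t} (\<lambda>s. g s q))" if "q \<in> Q" for q
    by (rule indefinite_integral_continuous_1[OF integrable_continuous_real[OF slice[OF that]]])
  fix q e assume q: "q \<in> Q" and e: "(e::real) > 0"
  obtain d where d: "d > 0"
    "\<And>t q'. t \<in> {0..1} \<Longrightarrow> q' \<in> Q \<Longrightarrow> dist q' q < d \<Longrightarrow> dist (g t q') (g t q) \<le> e"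
    using continuous_family_uniform[OF assms compact_Icc q e] by blast
  have "dist (integral {0..t} (\<lambda>s. g s q')) (integral {0..t} (\<lambda>s. g s q)) \<le> e"
    if "q' \<in> Q" "dist q' q < d" "t \<in> {0..1}" for q' t
    unfolding dist_norm
    using that q d(2) slice
    by (subst Henstock_Kurzweil_Integration.integral_diff[symmetric])
      (auto intro!: norm_integral_initial_le integrable_on_initial continuous_on_diff simp: dist_norm)
  with d(1) show "\<exists>d>0. \<forall>q'\<in>Q. dist q' q < d \<longrightarrow> (\<forall>t\<in>{0..1}.
      dist (integral {0..t} (\<lambda>s. g s q')) (integral {0..t} (\<lambda>s. g s q)) \<le> e)" by blast
qed

lemma has_derivative_family_integral:
  fixes g :: "real \<Rightarrow> 'q::euclidean_space \<Rightarrow> 'e::euclidean_space"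
  assumes "open Q" "Ck_family (Suc 0) {0..1} Q g" "t \<in> {0..1}" "q \<in> Q"
  shows "((\<lambda>q. integral {0..t} (\<lambda>s. g s q)) has_derivative
      (\<lambda>v. integral {0..t} (\<lambda>s. D (g s) q v))) (at q)"
proof -
  let ?D = "\<lambda>s q v. D (g s) q v"
  have cD: "continuous_on {0..1} (\<lambda>s. ?D s q v)" for v
  proof -
    have "Ck_family 0 {0..1} Q (\<lambda>t q. ?D t q v)" using assms(2) by simp
    from Ck_family_continuous_time[OF this assms(4)] show ?thesis .
  qed
  have cg: "continuous_on {0..1} (\<lambda>s. g s q)" if "q \<in> Q" for q
    by (rule Ck_family_continuous_time[OF assms(2) that])
  have lin: "linear (?D s q)" if "s \<in> {0..1}" for s
    using assms that by (auto intro: linear_frechet_derivative)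
  have "linear (\<lambda>v. integral {0..t} (\<lambda>s. ?D s q v))"
  proof (rule linearI)
    fix v w and c :: real
    have "integral {0..t} (\<lambda>s. ?D s q (v + w)) = integral {0..t} (\<lambda>s. ?D s q v + ?D s q w)"
      by (rule Henstock_Kurzweil_Integration.integral_cong) (use assms(3) lin in \<open>auto simp: linear_add\<close>)
    then show "integral {0..t} (\<lambda>s. ?D s q (v + w)) = integral {0..t} (\<lambda>s. ?D s q v) + integral {0..t} (\<lambda>s. ?D s q w)"
      using cD assms(3) by (simp add: Henstock_Kurzweil_Integration.integral_add integrable_on_initial)
    have "integral {0..t} (\<lambda>s. ?D s q (c *\<^sub>R v)) = integral {0..t} (\<lambda>s. c *\<^sub>R ?D s q v)"
      by (rule Henstock_Kurzweil_Integration.integral_cong) (use assms(3) lin in \<open>auto simp: linear_scale\<close>)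
    then show "integral {0..t} (\<lambda>s. ?D s q (c *\<^sub>R v)) = c *\<^sub>R integral {0..t} (\<lambda>s. ?D s q v)"
      by simp
  qed
  moreover have "\<exists>d>0. \<forall>x. norm (x - q) < d \<longrightarrow> norm (integral {0..t} (\<lambda>s. g s x) - integral {0..t} (\<lambda>s. g s q)
      - integral {0..t} (\<lambda>s. ?D s q (x - q))) \<le> e * norm (x - q)" if e: "e > 0" for e
  proof -
    have "(\<lambda>_. q) ` {0..1::real} \<subseteq> Q" using assms(4) by auto
    from Ck_family_uniform_remainder[OF assms(1,2) compact_Icc continuous_on_const this e]
    obtain d where d: "d > 0"
      "\<And>s x. s \<in> {0..1} \<Longrightarrow> norm (x - q) < d \<Longrightarrow> x \<in> Q \<and> norm (g s x - g s q - ?D s q (x - q)) \<le> e * norm (x - q)"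
      by blast
    have "norm (integral {0..t} (\<lambda>s. g s x) - integral {0..t} (\<lambda>s. g s q)
      - integral {0..t} (\<lambda>s. ?D s q (x - q))) \<le> e * norm (x - q)" if x: "norm (x - q) < d" for x
    proof -
      have xQ: "x \<in> Q" using d(2)[of 0 x] x by simp
      have "norm (integral {0..t} (\<lambda>s. g s x - g s q - ?D s q (x - q))) \<le> e * norm (x - q)"
        using d(2) x assms(3) by (intro norm_integral_initial_le continuous_on_diff cg cD xQ assms(4)) auto
      also have "integral {0..t} (\<lambda>s. g s x - g s q - ?D s q (x - q)) = integral {0..t} (\<lambda>s. g s x)
          - integral {0..t} (\<lambda>s. g s q) - integral {0..t} (\<lambda>s. ?D s q (x - q))"
        using assms(3)
        by (subst Henstock_Kurzweil_Integration.integral_diff |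
            (intro integrable_on_initial continuous_on_diff cg cD xQ assms(3,4); fail) | simp)+
      finally show ?thesis .
    qed
    with d(1) show ?thesis by blast
  qed
  ultimately show ?thesis
    by (simp add: has_derivative_at_alt linear_conv_bounded_linear)
qed

lemma Ck_family_integral:
  fixes g :: "real \<Rightarrow> 'q::euclidean_space \<Rightarrow> 'e::euclidean_space"
  assumes "open Q" "Ck_family n {0..1} Q g"
  shows "Ck_family n {0..1} Q (\<lambda>t q. integral {0..t} (\<lambda>s. g s q))"
  using assms(2)
proof (induction n arbitrary: g)
  case 0
  then show ?case using continuous_on_family_integral by auto
next
  case (Suc n)
  have "Ck_family (Suc 0) {0..1} Q g" using Suc.prems by (auto intro: Ck_family_continuous)
  note has_derivative_family_integral[OF assms(1) this]
  moreover have "Ck_family n {0..1} Q (\<lambda>t q. integral {0..t} (\<lambda>s. D (g s) q v))" for v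
    by (rule Suc.IH) (use Suc.prems in simp)
  ultimately show ?case
    by (intro Ck_family_SucI[OF assms(1)] continuous_on_family_integral Ck_family_continuous[OF Suc.prems])
qed

section \<open>Second derivatives and a non-local integral equation\<close>

text \<open>For small \<open>l\<close> parallel to \<open>k\<close>, the increment \<open>f (q + t l) - f q\<close> is the integral of the derivative along
  \<open>l\<close>.  Differentiating this identity in the direction \<open>h\<close> under the integral, and then in \<open>t\<close> at
  \<open>0\<close>, produces the two mixed derivatives.\<close>

lemma second_derivative_symmetric:
  fixes f :: "'p::euclidean_space \<Rightarrow> 'e::euclidean_space"
  assumes S: "open S" and f: "times_differentiable_on (Suc (Suc 0)) S f" and z: "z \<in> S"
  shows "D (\<lambda>z. D f z h) z k
       = D (\<lambda>z. D f z k) z h"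
proof -
  let ?D = "\<lambda>v z. D f z v"
  have d1: "(f has_derivative (\<lambda>v. ?D v x)) (at x)" if "x \<in> S" for x
    using f that by (simp add: frechet_derivative_works)
  have d2: "(?D v has_derivative D (?D v) x) (at x)" if "x \<in> S" for x v
    using f that by (simp add: frechet_derivative_works)
  obtain r where r: "r > 0" "ball z r \<subseteq> S" using openE[OF S z] by blast
  obtain e where e: "e > 0" "norm (e *\<^sub>R k) < r / 2"
  proof
    show "r / (2 * (norm k + 1)) > 0" using r(1) by (auto intro!: divide_pos_pos add_nonneg_pos)
    have "norm k / (norm k + 1) < 1" by (simp add: add_nonneg_pos)
    from mult_strict_left_mono[OF this, of "r / 2"] r(1)
    show "norm ((r / (2 * (norm k + 1))) *\<^sub>R k) < r / 2"
      by (simp add: abs_of_nonneg)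
  qed
  define l where "l = e *\<^sub>R k"
  define Q where "Q = ball z (r / 2)"
  have Q: "open Q" "z \<in> Q" "Q \<subseteq> S" using r by (auto simp: Q_def)
  have into: "q + t *\<^sub>R l \<in> S" if "t \<in> {0..1}" "q \<in> Q" for t q
  proof -
    have "norm (t *\<^sub>R l) \<le> norm l" using that(1) by (simp add: mult_left_le_one_le)
    then have "norm (t *\<^sub>R l) < r / 2" using e(2) by (simp add: l_def)
    moreover have "norm (q - z) < r / 2" using that(2) by (simp add: Q_def dist_norm norm_minus_commute)
    ultimately have "norm ((q + t *\<^sub>R l) - z) < r"
      using norm_triangle_ineq[of "q - z" "t *\<^sub>R l"] by (simp add: algebra_simps)
    then have "q + t *\<^sub>R l \<in> ball z r" by (simp only: mem_ball dist_norm norm_minus_commute)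
    then show ?thesis using r(2) by blast
  qed
  have g: "Ck_family (Suc 0) {0..1} Q (\<lambda>t q. (\<lambda>_. ?D l) t (q + t *\<^sub>R l))"
  proof (rule Ck_family_compose[OF Q(1), where f = "\<lambda>_. ?D l"])
    show "Ck_family (Suc 0) {0..1} S (\<lambda>_. ?D l)"
      by (rule Ck_family_of_times_differentiable_on) (use f in simp)
    show "Ck_family (Suc 0) {0..1} Q (\<lambda>t q. q + t *\<^sub>R l)"
      by (intro Ck_family_add Ck_family_ident Ck_family_time Q continuous_on_scaleR
          continuous_on_id continuous_on_const)
  qed (rule into)
  have path: "((\<lambda>s. F (q + s *\<^sub>R l)) has_vector_derivative F' l) (at t within {0..1})"
    if "(F has_derivative F') (at (q + t *\<^sub>R l))" for F :: "'p \<Rightarrow> 'e" and F' q and t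
  proof -
    have "((\<lambda>s. q + s *\<^sub>R l) has_derivative (\<lambda>s. s *\<^sub>R l)) (at t within {0..1})"
      by (auto intro!: derivative_eq_intros)
    from has_derivative_compose[OF this that]
    show ?thesis
      by (simp add: has_vector_derivative_def linear_scale[OF has_derivative_linear[OF that]])
  qed
  have ftc: "f (q + t *\<^sub>R l) - f q = integral {0..t} (\<lambda>s. ?D l (q + s *\<^sub>R l))"
    if t: "t \<in> {0..1}" and q: "q \<in> Q" for t q
  proof -
    have "((\<lambda>s. ?D l (q + s *\<^sub>R l)) has_integral (f (q + t *\<^sub>R l) - f (q + 0 *\<^sub>R l))) {0..t}"
    proof (rule fundamental_theorem_of_calculus)
      fix s assume s: "s \<in> {0..t}"
      then have "q + s *\<^sub>R l \<in> S" using into[of s q] t q by auto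
      from path[OF d1[OF this]]
      show "((\<lambda>s. f (q + s *\<^sub>R l)) has_vector_derivative ?D l (q + s *\<^sub>R l)) (at s within {0..t})"
        by (rule has_vector_derivative_within_subset) (use t in auto)
    qed (use t in auto)
    then show ?thesis by (simp add: integral_unique)
  qed
  have eq: "?D h (z + t *\<^sub>R l) - ?D h z = integral {0..t} (\<lambda>s. D (?D l) (z + s *\<^sub>R l) h)"
    if t: "t \<in> {0..1}" for t
  proof -
    have shift: "((\<lambda>q. F (q + c)) has_derivative F') (at z)" if "(F has_derivative F') (at (z + c))"
      for F :: "'p \<Rightarrow> 'e" and F' c
    proof -
      have "((\<lambda>q. q + c) has_derivative (\<lambda>v. v)) (at z)" by (auto intro!: derivative_eq_intros)
      from has_derivative_compose[OF this that] show ?thesis by simp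
    qed
    have "((\<lambda>q. f (q + t *\<^sub>R l) - f q) has_derivative (\<lambda>v. ?D v (z + t *\<^sub>R l) - ?D v z)) (at z)"
      by (intro has_derivative_diff shift d1 into t Q) (use Q in auto)
    then have "((\<lambda>q. integral {0..t} (\<lambda>s. ?D l (q + s *\<^sub>R l))) has_derivative
        (\<lambda>v. ?D v (z + t *\<^sub>R l) - ?D v z)) (at z)"
      by (rule has_derivative_transform_within_open[OF _ Q(1,2)]) (rule ftc[OF t])
    from has_derivative_unique[OF this has_derivative_family_integral[OF Q(1) g t Q(2)]]
    have "?D h (z + t *\<^sub>R l) - ?D h z =
        integral {0..t} (\<lambda>s. D (\<lambda>q. ?D l (q + s *\<^sub>R l)) z h)"
      by (rule fun_cong)
    also have "\<dots> = integral {0..t} (\<lambda>s. D (?D l) (z + s *\<^sub>R l) h)"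
    proof (rule Henstock_Kurzweil_Integration.integral_cong)
      fix s assume "s \<in> {0..t}"
      then have "z + s *\<^sub>R l \<in> S" using into[of s z] t Q by auto
      from fun_cong[OF frechet_derivative_at[OF shift[OF d2[OF this]]]]
      show "D (\<lambda>q. ?D l (q + s *\<^sub>R l)) z h = D (?D l) (z + s *\<^sub>R l) h"
        by (rule sym)
    qed
    finally show ?thesis .
  qed
  have cont: "continuous_on {0..1} (\<lambda>s. D (?D l) (z + s *\<^sub>R l) h)"
  proof (rule continuous_on_compose2[of S "\<lambda>x. D (?D l) x h"])
    show "continuous_on S (\<lambda>x. D (?D l) x h)" using f by simp
    show "continuous_on {0..1} (\<lambda>s. z + s *\<^sub>R l)" by (intro continuous_intros)
    show "(\<lambda>s. z + s *\<^sub>R l) ` {0..1} \<subseteq> S" using into Q by auto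
  qed
  have "((\<lambda>t. ?D h (z + t *\<^sub>R l) - ?D h z) has_vector_derivative D (?D h) z l)
      (at 0 within {0..1})"
    using path[of "?D h" _ z 0] d2[of z h] Q
    by (auto intro!: derivative_eq_intros)
  moreover have "((\<lambda>t. ?D h (z + t *\<^sub>R l) - ?D h z) has_vector_derivative D (?D l) z h)
      (at 0 within {0..1})"
  proof (rule has_vector_derivative_transform[where f = "\<lambda>t. integral {0..t} (\<lambda>s. D (?D l) (z + s *\<^sub>R l) h)"])
    show "((\<lambda>t. integral {0..t} (\<lambda>s. D (?D l) (z + s *\<^sub>R l) h)) has_vector_derivative
        D (?D l) z h) (at 0 within {0..1})"
      using integral_has_vector_derivative[OF cont, of 0] by simp
  qed (use eq in auto)
  ultimately have "D (?D h) z l = D (?D l) z h"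
    by (rule vector_derivative_unique_within[rotated])
      (simp add: trivial_limit_within islimpt_Icc)
  moreover have "D (?D l) z h = e *\<^sub>R D (?D k) z h"
  proof -
    have "((\<lambda>x. e *\<^sub>R ?D k x) has_derivative (\<lambda>v. e *\<^sub>R D (?D k) z v)) (at z)"
      by (rule bounded_linear.has_derivative[OF bounded_linear_scaleR_right d2[OF z]])
    then have "(?D l has_derivative (\<lambda>v. e *\<^sub>R D (?D k) z v)) (at z)"
      by (rule has_derivative_transform_within_open[OF _ S z])
        (simp add: l_def linear_scale[OF has_derivative_linear[OF d1]])
    from fun_cong[OF frechet_derivative_at[OF this], of h] show ?thesis by (rule sym)
  qed
  moreover have "D (?D h) z l = e *\<^sub>R D (?D h) z k"
    unfolding l_def by (rule linear_scale[OF has_derivative_linear[OF d2[OF z]]])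
  ultimately show ?thesis using e(1) by simp
qed

text \<open>A substitute for Gronwall's inequality that tolerates non-local terms: at a point where the norm is
  maximal, the term \<open>c * s\<close> is absorbed into the left-hand side.\<close>

lemma sup_bound_absorb:
  fixes d :: "real \<Rightarrow> 'e::euclidean_space"
  assumes "continuous_on {0..1} d" "c < 1"
    and step: "\<And>t s. t \<in> {0..1} \<Longrightarrow> (\<And>\<tau>. \<tau> \<in> {0..1} \<Longrightarrow> norm (d \<tau>) \<le> s) \<Longrightarrow> norm (d t) \<le> B + c * s"
    and "t \<in> {0..1}"
  shows "norm (d t) \<le> B / (1 - c)"
proof -
  have "continuous_on {0..1} (\<lambda>t. norm (d t))" by (intro continuous_on_norm assms)
  from continuous_attains_sup[OF compact_Icc _ this] obtain m where
    m: "m \<in> {0..1}" "\<And>t. t \<in> {0..1} \<Longrightarrow> norm (d t) \<le> norm (d m)" by auto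
  have "norm (d m) \<le> B + c * norm (d m)" by (rule step[OF m])
  then have "norm (d m) \<le> B / (1 - c)" using assms(2) by (simp add: pos_le_divide_eq algebra_simps)
  then show ?thesis using m(2)[OF assms(4)] by simp
qed

text \<open>The state is a pair because the equations considered below involve both the current value and the
  value at time \<open>1\<close> of the unknown.  The difference of two such pairs is at most twice the supremum of
  the difference of the unknowns, so the constant \<open>1/4\<close> makes the integral operator a contraction
  with factor \<open>1/2\<close>.\<close>

definition quarter_lipschitz :: "('q \<times> ('e \<times> 'e)) set \<Rightarrow>
    (real \<Rightarrow> 'q::euclidean_space \<times> ('e::euclidean_space \<times> 'e) \<Rightarrow> 'e) \<Rightarrow> bool" where
  "quarter_lipschitz \<Omega> f \<longleftrightarrow> (\<forall>t\<in>{0..1}. \<forall>q u u'. (q, u) \<in> \<Omega> \<longrightarrow> (q, u') \<in> \<Omega> \<longrightarrow>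
     norm (f t (q, u) - f t (q, u')) \<le> norm (u - u') / 4)"

definition solves where
  "solves Q f \<beta> y \<longleftrightarrow> continuous_on ({0..1::real} \<times> Q) (\<lambda>(t, q). y t q) \<and>
     (\<forall>q\<in>Q. \<forall>t\<in>{0..1}. y t q = \<beta> t q + integral {0..t} (\<lambda>\<tau>. f \<tau> (q, (y \<tau> q, y 1 q))))"

lemma norm_pair_diff_le:
  fixes a b c d :: "'e::real_normed_vector"
  assumes "norm (a - c) \<le> s" "norm (b - d) \<le> s"
  shows "norm ((a, b) - (c, d)) \<le> 2 * s"
  using assms norm_Pair_le[of "a - c" "b - d"] by simp

text \<open>Banach's fixed point theorem.  The time is clamped to \<open>{0..1}\<close>, which embeds the continuous functions on
  this interval into the bounded continuous functions on the whole line.\<close>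

lemma integral_equation_solution_fixed:
  fixes f :: "real \<Rightarrow> ('e::euclidean_space \<times> 'e) \<Rightarrow> 'e"
  assumes cf: "continuous_on ({0..1} \<times> UNIV) (\<lambda>(t, u). f t u)"
    and lip: "\<And>t u u'. t \<in> {0..1} \<Longrightarrow> norm (f t u - f t u') \<le> norm (u - u') / 4"
    and cb: "continuous_on {0..1} \<beta>"
  shows "\<exists>y. continuous_on {0..1} y \<and>
    (\<forall>t\<in>{0..1}. y t = \<beta> t + integral {0..t} (\<lambda>\<tau>. f \<tau> (y \<tau>, y 1)))"
proof -
  define cl :: "real \<Rightarrow> real" where "cl t = max 0 (min 1 t)" for t
  have cl: "cl t \<in> {0..1}" "t \<in> {0..1} \<Longrightarrow> cl t = t" for t by (auto simp: cl_def)
  have ccl: "continuous_on UNIV cl" unfolding cl_def by (intro continuous_intros)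
  have cfy: "continuous_on {0..1} (\<lambda>\<tau>. f \<tau> (y \<tau>, y 1))" if "continuous_on {0..1} y" for y
  proof -
    have "continuous_on {0..1} (\<lambda>\<tau>. (\<lambda>(t, u). f t u) (\<tau>, (y \<tau>, y 1)))"
      by (rule continuous_on_compose2[OF cf])
        (use that in \<open>auto intro!: continuous_on_Pair continuous_on_id continuous_on_const\<close>)
    then show ?thesis by simp
  qed
  define S where "S y t = \<beta> t + integral {0..t} (\<lambda>\<tau>. f \<tau> (y \<tau>, y 1))" for y t
  have cS: "continuous_on {0..1} (S y)" if "continuous_on {0..1} y" for y
    unfolding S_def
    by (intro continuous_on_add cb indefinite_integral_continuous_1 integrable_continuous_real cfy that)
  have bS: "(\<lambda>t. S y (cl t)) \<in> bcontfun" if "continuous_on {0..1} y" for y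
  proof -
    have "continuous_on UNIV (\<lambda>t. S y (cl t))"
      by (rule continuous_on_compose2[OF cS[OF that] ccl]) (use cl in auto)
    moreover have "bounded (S y ` {0..1})"
      by (intro compact_imp_bounded compact_continuous_image cS that) auto
    then have "bounded (range (\<lambda>t. S y (cl t)))"
      by (rule bounded_subset) (use cl in auto)
    ultimately show ?thesis by (simp add: bcontfun_def)
  qed
  define F :: "(real \<Rightarrow>\<^sub>C 'e) \<Rightarrow> (real \<Rightarrow>\<^sub>C 'e)" where "F Y = Bcontfun (\<lambda>t. S (apply_bcontfun Y) (cl t))" for Y
  have F: "apply_bcontfun (F Y) t = S (apply_bcontfun Y) (cl t)" for Y t
    unfolding F_def by (subst Bcontfun_inverse) (auto intro!: bS)
  have "\<exists>!Y. F Y = Y"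
  proof (rule banach_fix_type[of "1/2"])
    show "\<forall>X Y. dist (F X) (F Y) \<le> 1 / 2 * dist X Y"
    proof (intro allI dist_bound)
      fix X Y t
      have "dist (F X t) (F Y t) = norm (integral {0..cl t} (\<lambda>\<tau>. f \<tau> (X \<tau>, X 1) - f \<tau> (Y \<tau>, Y 1)))"
        unfolding F S_def dist_norm
        by (subst Henstock_Kurzweil_Integration.integral_diff)
          (auto intro!: integrable_on_initial cfy cl)
      also have "\<dots> \<le> 1 / 2 * dist X Y"
      proof (rule norm_integral_initial_le)
        show "continuous_on {0..1} (\<lambda>\<tau>. f \<tau> (X \<tau>, X 1) - f \<tau> (Y \<tau>, Y 1))"
          by (intro continuous_on_diff cfy) auto
        fix \<tau> :: real assume "\<tau> \<in> {0..1}"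
        then have "norm (f \<tau> (X \<tau>, X 1) - f \<tau> (Y \<tau>, Y 1)) \<le> norm ((X \<tau>, X 1) - (Y \<tau>, Y 1)) / 4"
          by (rule lip)
        also have "\<dots> \<le> 2 * dist X Y / 4"
          by (intro divide_right_mono norm_pair_diff_le) (auto simp: dist_bounded dist_norm[symmetric])
        finally show "norm (f \<tau> (X \<tau>, X 1) - f \<tau> (Y \<tau>, Y 1)) \<le> 1 / 2 * dist X Y" by simp
      qed (rule cl)
      finally show "dist (F X t) (F Y t) \<le> 1 / 2 * dist X Y" .
    qed
  qed auto
  then obtain Y where "F Y = Y" by blast
  then have "Y t = S Y t" if "t \<in> {0..1}" for t
    using F[of Y t] cl(2)[OF that] by simp
  then have "\<forall>t\<in>{0..1}. Y t = \<beta> t + integral {0..t} (\<lambda>\<tau>. f \<tau> (Y \<tau>, Y 1))"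
    unfolding S_def by blast
  then show ?thesis
    using continuous_on_apply_bcontfun by blast
qed

text \<open>Solving for each parameter separately suffices: joint continuity follows since two solutions for
  nearby parameters differ by a small inhomogeneity plus a term that can be absorbed.\<close>

lemma integral_equation_solution:
  fixes f :: "real \<Rightarrow> ('q::euclidean_space \<times> ('e::euclidean_space \<times> 'e)) \<Rightarrow> 'e"
  assumes cf: "continuous_on ({0..1} \<times> (Q \<times> UNIV)) (\<lambda>(t, p). f t p)"
    and lip: "quarter_lipschitz (Q \<times> UNIV) f"
    and cb: "continuous_on ({0..1} \<times> Q) (\<lambda>(t, q). \<beta> t q)"
  shows "\<exists>y. solves Q f \<beta> y"
proof -
  have lip: "norm (f t (q, u) - f t (q, u')) \<le> norm (u - u') / 4" if "t \<in> {0..1}" "q \<in> Q" for t q u u'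
    using lip that unfolding quarter_lipschitz_def by blast
  have "\<exists>y. continuous_on {0..1} y \<and>
      (\<forall>t\<in>{0..1}. y t = \<beta> t q + integral {0..t} (\<lambda>\<tau>. f \<tau> (q, (y \<tau>, y 1))))" if q: "q \<in> Q" for q
  proof (rule integral_equation_solution_fixed)
    have "continuous_on ({0..1} \<times> UNIV) (\<lambda>x. (\<lambda>(t, p). f t p) (fst x, (q, snd x)))"
      by (rule continuous_on_compose2[OF cf])
        (use q in \<open>auto intro!: continuous_on_Pair continuous_on_fst continuous_on_snd continuous_on_id continuous_on_const\<close>)
    then show "continuous_on ({0..1} \<times> UNIV) (\<lambda>(t, u). f t (q, u))" by (simp add: case_prod_beta)
  next
    show "continuous_on {0..1} (\<lambda>t. \<beta> t q)" by (rule continuous_on_family_slice[OF cb q])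
  qed (rule lip[OF _ q])
  then have "\<forall>q. \<exists>y. q \<in> Q \<longrightarrow> continuous_on {0..1} y \<and>
      (\<forall>t\<in>{0..1}. y t = \<beta> t q + integral {0..t} (\<lambda>\<tau>. f \<tau> (q, (y \<tau>, y 1))))" by blast
  from choice[OF this] obtain Y where Y: "\<And>q. q \<in> Q \<Longrightarrow> continuous_on {0..1} (Y q)"
    "\<And>q t. q \<in> Q \<Longrightarrow> t \<in> {0..1} \<Longrightarrow> Y q t = \<beta> t q + integral {0..t} (\<lambda>\<tau>. f \<tau> (q, (Y q \<tau>, Y q 1)))"
    by blast
  have cfy: "continuous_on ({0..1} \<times> Q) (\<lambda>(\<tau>, q'). f \<tau> (q', (Y q \<tau>, Y q 1)))" if q: "q \<in> Q" for q
  proof -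
    have "continuous_on ({0..1} \<times> Q) (\<lambda>x. (\<lambda>(t, p). f t p) (fst x, (snd x, (Y q (fst x), Y q 1))))"
      by (rule continuous_on_compose2[OF cf])
        (auto intro!: continuous_on_Pair continuous_on_fst continuous_on_snd continuous_on_id continuous_on_const
          continuous_on_compose2[OF Y(1)[OF q]])
    then show ?thesis by (simp add: case_prod_beta)
  qed
  have cfyy: "continuous_on {0..1} (\<lambda>\<tau>. f \<tau> (q', (Y q \<tau>, Y q 1)))" if "q \<in> Q" "q' \<in> Q" for q q'
    by (rule continuous_on_family_slice[OF cfy[OF that(1)] that(2)])
  have "continuous_on ({0..1} \<times> Q) (\<lambda>(t, q). Y q t)"
  proof (rule continuous_familyI)
    show "continuous_on {0..1} (Y q)" if "q \<in> Q" for q by (rule Y(1)[OF that])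
    fix q and e :: real assume q: "q \<in> Q" and e: "e > 0"
    obtain d1 where d1: "d1 > 0"
      "\<And>t q'. t \<in> {0..1} \<Longrightarrow> q' \<in> Q \<Longrightarrow> dist q' q < d1 \<Longrightarrow> dist (\<beta> t q') (\<beta> t q) \<le> e / 4"
      using continuous_family_uniform[OF cb compact_Icc q, of "e / 4"] e by auto
    obtain d2 where d2: "d2 > 0"
      "\<And>t q'. t \<in> {0..1} \<Longrightarrow> q' \<in> Q \<Longrightarrow> dist q' q < d2 \<Longrightarrow>
         dist (f t (q', (Y q t, Y q 1))) (f t (q, (Y q t, Y q 1))) \<le> e / 4"
      using continuous_family_uniform[OF cfy[OF q] compact_Icc q, of "e / 4"] e by auto
    have "norm (Y q' t - Y q t) \<le> (e / 2) / (1 - 1 / 2)"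
      if q': "q' \<in> Q" "dist q' q < min d1 d2" and t: "t \<in> {0..1}" for q' t
    proof (rule sup_bound_absorb[OF _ _ _ t])
      show "continuous_on {0..1} (\<lambda>t. Y q' t - Y q t)" by (intro continuous_on_diff Y q q')
      fix t s assume t: "t \<in> {0..1::real}" and s: "\<And>\<tau>. \<tau> \<in> {0..1} \<Longrightarrow> norm (Y q' \<tau> - Y q \<tau>) \<le> s"
      have "Y q' t - Y q t = (\<beta> t q' - \<beta> t q)
          + integral {0..t} (\<lambda>\<tau>. f \<tau> (q', (Y q' \<tau>, Y q' 1)) - f \<tau> (q, (Y q \<tau>, Y q 1)))"
        using Y(2)[OF q t] Y(2)[OF q'(1) t]
        by (subst Henstock_Kurzweil_Integration.integral_diff)
          (auto intro!: integrable_on_initial[OF _ t] cfyy q q')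
      also have "norm \<dots> \<le> e / 4 + (s / 2 + e / 4)"
      proof (rule norm_triangle_le[OF add_mono])
        show "norm (\<beta> t q' - \<beta> t q) \<le> e / 4" using d1(2)[OF t q'(1)] q'(2) by (simp add: dist_norm)
        show "norm (integral {0..t} (\<lambda>\<tau>. f \<tau> (q', (Y q' \<tau>, Y q' 1)) - f \<tau> (q, (Y q \<tau>, Y q 1)))) \<le> s / 2 + e / 4"
        proof (rule norm_integral_initial_le[OF _ t])
          show "continuous_on {0..1} (\<lambda>\<tau>. f \<tau> (q', (Y q' \<tau>, Y q' 1)) - f \<tau> (q, (Y q \<tau>, Y q 1)))"
            by (intro continuous_on_diff cfyy q q')
          fix \<tau> :: real assume \<tau>: "\<tau> \<in> {0..1}"
          have "norm (f \<tau> (q', (Y q' \<tau>, Y q' 1)) - f \<tau> (q', (Y q \<tau>, Y q 1)))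
              \<le> norm ((Y q' \<tau>, Y q' 1) - (Y q \<tau>, Y q 1)) / 4" by (rule lip[OF \<tau> q'(1)])
          also have "\<dots> \<le> 2 * s / 4"
            by (intro divide_right_mono norm_pair_diff_le s \<tau>) auto
          finally have "norm (f \<tau> (q', (Y q' \<tau>, Y q' 1)) - f \<tau> (q', (Y q \<tau>, Y q 1))) \<le> s / 2" by simp
          moreover have "norm (f \<tau> (q', (Y q \<tau>, Y q 1)) - f \<tau> (q, (Y q \<tau>, Y q 1))) \<le> e / 4"
            using d2(2)[OF \<tau> q'(1)] q'(2) by (simp add: dist_norm)
          ultimately show "norm (f \<tau> (q', (Y q' \<tau>, Y q' 1)) - f \<tau> (q, (Y q \<tau>, Y q 1))) \<le> s / 2 + e / 4"
            using norm_triangle_ineq[of "f \<tau> (q', (Y q' \<tau>, Y q' 1)) - f \<tau> (q', (Y q \<tau>, Y q 1))"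
                "f \<tau> (q', (Y q \<tau>, Y q 1)) - f \<tau> (q, (Y q \<tau>, Y q 1))"] by simp
        qed
      qed
      finally show "norm (Y q' t - Y q t) \<le> e / 2 + 1 / 2 * s" by simp
    qed simp
    then show "\<exists>d>0. \<forall>q'\<in>Q. dist q' q < d \<longrightarrow> (\<forall>t\<in>{0..1}. dist (Y q' t) (Y q t) \<le> e)"
      using d1(1) d2(1) by (intro exI[of _ "min d1 d2"]) (auto simp: dist_norm)
  qed
  then have "solves Q f \<beta> (\<lambda>t q. Y q t)"
    unfolding solves_def using Y(2) by blast
  then show ?thesis by blast
qed

section \<open>Smooth dependence of solutions on the parameter\<close>

lemma norm_derivative_le_of_directional_lipschitz:
  assumes F: "(F has_derivative F') (at x)" and "\<delta> > 0"
    and lip: "\<And>s. 0 < s \<Longrightarrow> s < \<delta> \<Longrightarrow> norm (F (x + s *\<^sub>R w) - F x) \<le> s * K"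
  shows "norm (F' w) \<le> K"
proof (rule field_le_epsilon)
  fix e' :: real assume e': "e' > 0"
  define e where "e = e' / (norm w + 1)"
  have e: "e > 0" "e * norm w \<le> e'"
  proof -
    have p: "norm w + 1 > 0" by (simp add: add_nonneg_pos)
    show "e > 0" using e' p by (simp add: e_def)
    have "e' * norm w \<le> e' * (norm w + 1)" using e' by (intro mult_left_mono) auto
    then show "e * norm w \<le> e'" using p by (simp add: e_def pos_divide_le_eq)
  qed
  obtain d where d: "d > 0" "\<And>y. norm (y - x) < d \<Longrightarrow> norm (F y - F x - F' (y - x)) \<le> e * norm (y - x)"
    using F e(1) unfolding has_derivative_at_alt by blast
  define s where "s = min (\<delta> / 2) (d / (2 * (norm w + 1)))"
  have s: "s > 0" "s < \<delta>" using assms(2) d(1) by (auto simp: s_def add_nonneg_pos)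
  have "s * norm w \<le> d / (2 * (norm w + 1)) * norm w"
    by (intro mult_right_mono) (auto simp: s_def)
  also have "\<dots> < d" using d(1) by (simp add: field_simps add_nonneg_pos add_pos_nonneg)
  finally have "norm (F (x + s *\<^sub>R w) - F x - F' (s *\<^sub>R w)) \<le> e * (s * norm w)"
    using d(2)[of "x + s *\<^sub>R w"] s(1) by simp
  moreover have "norm (F (x + s *\<^sub>R w) - F x) \<le> s * K" by (rule lip[OF s])
  ultimately have "norm (F' (s *\<^sub>R w)) \<le> s * K + e * (s * norm w)"
    using norm_triangle_ineq3[of "F' (s *\<^sub>R w)" "F (x + s *\<^sub>R w) - F x"]
    by (simp add: norm_minus_commute)
  then have "s * norm (F' w) \<le> s * (K + e * norm w)"
    using s(1) by (simp add: linear_scale[OF has_derivative_linear[OF F]] algebra_simps)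
  then show "norm (F' w) \<le> K + e'" using s(1) e(2) by simp
qed

definition curve where
  "curve y t q = (q, (y t q, y (1::real) q))"

text \<open>Differentiating the integral equation in the direction \<open>v\<close> of the parameter gives an integral
  equation for the derivative.  The part of the derivative of \<open>f\<close> that acts on the unknown is the new
  right-hand side, the part that acts on \<open>v\<close> joins the inhomogeneity.\<close>

definition linearized_rhs where
  "linearized_rhs f y t x = D (f t) (curve y t (fst x)) (0, snd x)"

definition linearized_source where
  "linearized_source f \<beta> y v t q = D (\<beta> t) q v
     + integral {0..t} (\<lambda>\<tau>. D (f \<tau>) (curve y \<tau> q) (v, 0))"

locale integral_equation =
  fixes Q :: "'q::euclidean_space set" and \<Omega> :: "('q \<times> ('e::euclidean_space \<times> 'e)) set"
    and f :: "real \<Rightarrow> 'q \<times> ('e \<times> 'e) \<Rightarrow> 'e" and \<beta> y :: "real \<Rightarrow> 'q \<Rightarrow> 'e"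
  assumes Q: "open Q" and \<Omega>: "open \<Omega>"
    and lip: "quarter_lipschitz \<Omega> f"
    and sol: "solves Q f \<beta> y"
    and into: "\<And>t q. t \<in> {0..1} \<Longrightarrow> q \<in> Q \<Longrightarrow> curve y t q \<in> \<Omega>"
begin

lemma Ck_family_curve:
  assumes "Ck_family n {0..1} Q y"
  shows "Ck_family n {0..1} Q (curve y)"
proof -
  have "Ck_family n {0..1} Q (\<lambda>t q. (q, (y t q, y 1 q)))"
    by (intro Ck_family_Pair Ck_family_ident Q assms Ck_family_frozen_time[OF Q assms]) auto
  moreover have "curve y = (\<lambda>t q. (q, (y t q, y 1 q)))" by (simp add: curve_def fun_eq_iff)
  ultimately show ?thesis by simp
qed

lemma Ck_family_derivative_along:
  assumes "Ck_family (Suc n) {0..1} \<Omega> f" "Ck_family n {0..1} Q y"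
  shows "Ck_family n {0..1} Q (\<lambda>t q. D (f t) (curve y t q) w)"
  by (rule Ck_family_compose[OF Q _ Ck_family_curve[OF assms(2)] into,
        where f = "\<lambda>t x. D (f t) x w"])
    (use assms(1) in \<open>simp_all only: Ck_family.simps\<close>)

lemma linear_derivative_along:
  assumes "Ck_family (Suc n) {0..1} \<Omega> f" "t \<in> {0..1}" "q \<in> Q"
  shows "linear (D (f t) (curve y t q))"
  using assms into[OF assms(2,3)] by (auto intro: linear_frechet_derivative)

lemma Ck_family_linearized_rhs:
  assumes "Ck_family (Suc n) {0..1} \<Omega> f" "Ck_family n {0..1} Q y"
  shows "Ck_family n {0..1} (Q \<times> UNIV) (linearized_rhs f y)"
proof -
  have o: "open (Q \<times> (UNIV :: ('e \<times> 'e) set))" by (intro open_Times Q open_UNIV)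
  have fst: "Ck_family n {0..1} (Q \<times> (UNIV :: ('e \<times> 'e) set)) (\<lambda>t. fst)"
    by (rule Ck_family_bounded_linear[OF o bounded_linear_fst Ck_family_ident[OF o]])
  have "bounded_linear (\<lambda>x :: 'q \<times> 'e \<times> 'e. (0 :: 'q, snd x))"
    by (intro bounded_linear_Pair bounded_linear_zero bounded_linear_snd)
  from Ck_family_bounded_linear[OF o this Ck_family_ident[OF o]]
  have snd: "Ck_family n {0..1} (Q \<times> UNIV) (\<lambda>t x :: 'q \<times> 'e \<times> 'e. (0 :: 'q, snd x))" .
  have "Ck_family n {0..1} (Q \<times> UNIV) (\<lambda>t x :: 'q \<times> 'e \<times> 'e.
      D (f t) (curve y t (fst x)) (0 :: 'q, snd x))"
  proof (rule Ck_family_apply[OF o _ _ snd, where L = "\<lambda>t x. D (f t) (curve y t (fst x))"])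
    show "Ck_family n {0..1} (Q \<times> UNIV) (\<lambda>t x :: 'q \<times> 'e \<times> 'e. D (f t) (curve y t (fst x)) w)" for w
      by (rule Ck_family_compose[OF o Ck_family_derivative_along[OF assms] fst]) auto
    show "linear (D (f t) (curve y t (fst x)))"
      if "t \<in> {0..1}" "x \<in> Q \<times> UNIV" for t and x :: "'q \<times> 'e \<times> 'e"
      using that by (intro linear_derivative_along[OF assms(1)]) auto
  qed
  moreover have "linearized_rhs f y = (\<lambda>t x. D (f t) (curve y t (fst x)) (0, snd x))"
    by (simp add: linearized_rhs_def fun_eq_iff)
  ultimately show ?thesis by simp
qed

lemma Ck_family_linearized_source:
  assumes "Ck_family (Suc n) {0..1} \<Omega> f" "Ck_family (Suc n) {0..1} Q \<beta>" "Ck_family n {0..1} Q y"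
  shows "Ck_family n {0..1} Q (linearized_source f \<beta> y v)"
proof -
  have "Ck_family n {0..1} Q (\<lambda>t q. D (\<beta> t) q v
     + integral {0..t} (\<lambda>\<tau>. D (f \<tau>) (curve y \<tau> q) (v, 0)))"
    by (intro Ck_family_add Ck_family_integral Q Ck_family_derivative_along assms)
      (use assms(2) in \<open>simp_all only: Ck_family.simps\<close>)
  moreover have "linearized_source f \<beta> y v = (\<lambda>t q. D (\<beta> t) q v
     + integral {0..t} (\<lambda>\<tau>. D (f \<tau>) (curve y \<tau> q) (v, 0)))"
    by (simp add: linearized_source_def fun_eq_iff)
  ultimately show ?thesis by simp
qed

text \<open>The Lipschitz constant bounds the derivative, so the linearised equation is again a contraction on the
  same time interval.\<close>

lemma norm_linearized_rhs_le:
  assumes "Ck_family (Suc n) {0..1} \<Omega> f" "t \<in> {0..1}" "q \<in> Q"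
  shows "norm (D (f t) (curve y t q) (0, u)) \<le> norm u / 4"
proof -
  have "curve y t q \<in> \<Omega>" by (rule into[OF assms(2,3)])
  then obtain r where r: "r > 0" "ball (curve y t q) r \<subseteq> \<Omega>" using openE[OF \<Omega>] by blast
  have near: "curve y t q + s *\<^sub>R (0, u) \<in> \<Omega>" if "0 < s" "s < r / (norm u + 1)" for s
  proof -
    have "s * norm u \<le> s * (norm u + 1)" using that by simp
    also have "\<dots> < r"
    proof -
      have "norm u + 1 > 0" by (simp add: add_nonneg_pos)
      then show ?thesis using that(2) by (simp only: pos_less_divide_eq)
    qed
    finally have "curve y t q + s *\<^sub>R (0, u) \<in> ball (curve y t q) r"
      using that(1) by (simp add: dist_norm norm_Pair)
    then show ?thesis using r(2) by blast
  qed
  show ?thesis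
  proof (rule norm_derivative_le_of_directional_lipschitz[where F = "f t" and x = "curve y t q"
        and F' = "D (f t) (curve y t q)" and w = "(0, u)" and \<delta> = "r / (norm u + 1)"])
    show "(f t has_derivative D (f t) (curve y t q)) (at (curve y t q))"
      by (rule Ck_family_has_derivative[OF assms(1,2) into[OF assms(2,3)]])
    show "r / (norm u + 1) > 0" using r(1) by (simp add: add_nonneg_pos)
    fix s :: real assume s: "0 < s" "s < r / (norm u + 1)"
    define c where "c = (y t q, y 1 q)"
    have c: "curve y t q = (q, c)" by (simp add: curve_def c_def)
    have "(q, c + s *\<^sub>R u) \<in> \<Omega>" "(q, c) \<in> \<Omega>"
      using near[OF s] into[OF assms(2,3)] by (simp_all add: c)
    then have "norm (f t (q, c + s *\<^sub>R u) - f t (q, c)) \<le> norm (c + s *\<^sub>R u - c) / 4"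
      using lip assms(2) unfolding quarter_lipschitz_def by blast
    then show "norm (f t (curve y t q + s *\<^sub>R (0, u)) - f t (curve y t q)) \<le> s * (norm u / 4)"
      using s(1) by (simp add: c)
  qed
qed

lemma quarter_lipschitz_linearized_rhs:
  assumes "Ck_family (Suc n) {0..1} \<Omega> f"
  shows "quarter_lipschitz (Q \<times> UNIV) (linearized_rhs f y)"
  unfolding quarter_lipschitz_def
proof (intro ballI allI impI)
  fix t :: real and q u u' assume *: "t \<in> {0..1}" "(q, u) \<in> Q \<times> (UNIV :: ('e \<times> 'e) set)" "(q, u') \<in> Q \<times> (UNIV :: ('e \<times> 'e) set)"
  then have q: "q \<in> Q" by auto
  have "linearized_rhs f y t (q, u) - linearized_rhs f y t (q, u')
      = D (f t) (curve y t q) (0, u - u')"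
    using linear_diff[OF linear_derivative_along[OF assms *(1) q], of "(0, u)" "(0, u')"]
    by (simp add: linearized_rhs_def)
  then show "norm (linearized_rhs f y t (q, u) - linearized_rhs f y t (q, u')) \<le> norm (u - u') / 4"
    using norm_linearized_rhs_le[OF assms *(1) q] by simp
qed

text \<open>The candidate derivative is assembled linearly from the solutions of the linearised equation
  in the basis directions.  The error of the first-order expansion satisfies an inequality whose terms
  linear in the error have total factor at most \<open>3/4\<close>, and absorption yields differentiability.\<close>

lemma solution_has_derivative:
  assumes f: "Ck_family (Suc 0) {0..1} \<Omega> f" and \<beta>: "Ck_family (Suc 0) {0..1} Q \<beta>"
  shows "\<exists>z. \<forall>v. solves Q (linearized_rhs f y) (linearized_source f \<beta> y v) (z v) \<and>
    (\<forall>t\<in>{0..1}. \<forall>q\<in>Q. (y t has_derivative (\<lambda>v. z v t q)) (at q))"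
proof -
  let ?A = "\<lambda>\<tau> q. D (f \<tau>) (curve y \<tau> q)"
  have y0: "Ck_family 0 {0..1} Q y" using sol by (simp add: solves_def)
  have "\<exists>y'. solves Q (linearized_rhs f y) (linearized_source f \<beta> y v) y'" for v
    by (rule integral_equation_solution[OF Ck_family_continuous[OF Ck_family_linearized_rhs[OF f y0]]
          quarter_lipschitz_linearized_rhs[OF f]
          Ck_family_continuous[OF Ck_family_linearized_source[OF f \<beta> y0]]])
  then have "\<forall>v. \<exists>y'. solves Q (linearized_rhs f y) (linearized_source f \<beta> y v) y'" by blast
  from choice[OF this] obtain Z where Z: "\<And>v. solves Q (linearized_rhs f y) (linearized_source f \<beta> y v) (Z v)"
    by blast
  have cZ: "continuous_on {0..1} (\<lambda>t. Z v t q)" if "q \<in> Q" for v q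
    using Z[of v] that unfolding solves_def by (blast intro: continuous_on_family_slice)
  have lA: "linear (?A \<tau> q)" if "\<tau> \<in> {0..1}" "q \<in> Q" for \<tau> q
    by (rule linear_derivative_along[OF f that])
  have cA: "continuous_on {0..1} (\<lambda>\<tau>. ?A \<tau> q w)" if "q \<in> Q" for q w
    by (rule Ck_family_continuous_time[OF Ck_family_derivative_along[OF f y0] that])
  have cA': "continuous_on {0..1} (\<lambda>\<tau>. ?A \<tau> q (w \<tau>))" if "q \<in> Q" "continuous_on {0..1} w" for q w
  proof -
    have "continuous_on {0..1} (\<lambda>\<tau>. \<Sum>i\<in>Basis. (w \<tau> \<bullet> i) *\<^sub>R ?A \<tau> q i)"
      by (intro continuous_on_sum continuous_on_scaleR continuous_on_inner that cA continuous_on_const)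
    then show ?thesis
      by (rule continuous_on_eq) (simp add: linear_eq_Basis_sum[OF lA[OF _ that(1)], symmetric])
  qed
  have eqZ: "Z v t q = D (\<beta> t) q v + integral {0..t} (\<lambda>\<tau>. ?A \<tau> q (v, (Z v \<tau> q, Z v 1 q)))"
    if t: "t \<in> {0..1}" and q: "q \<in> Q" for v t q
  proof -
    have "Z v t q = D (\<beta> t) q v + (integral {0..t} (\<lambda>\<tau>. ?A \<tau> q (v, 0))
        + integral {0..t} (\<lambda>\<tau>. ?A \<tau> q (0, (Z v \<tau> q, Z v 1 q))))"
    proof -
      have "Z v t q = linearized_source f \<beta> y v t q
          + integral {0..t} (\<lambda>\<tau>. linearized_rhs f y \<tau> (q, (Z v \<tau> q, Z v 1 q)))"
        using Z[of v] t q unfolding solves_def by blast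
      then show ?thesis
        by (simp only: linearized_rhs_def linearized_source_def fst_conv snd_conv add.assoc)
    qed
    also have "integral {0..t} (\<lambda>\<tau>. ?A \<tau> q (v, 0)) + integral {0..t} (\<lambda>\<tau>. ?A \<tau> q (0, (Z v \<tau> q, Z v 1 q)))
        = integral {0..t} (\<lambda>\<tau>. ?A \<tau> q (v, 0) + ?A \<tau> q (0, (Z v \<tau> q, Z v 1 q)))"
      by (rule Henstock_Kurzweil_Integration.integral_add[symmetric])
        (intro integrable_on_initial[OF _ t] cA' q continuous_on_Pair continuous_on_const cZ)+
    also have "\<dots> = integral {0..t} (\<lambda>\<tau>. ?A \<tau> q (v, (Z v \<tau> q, Z v 1 q)))"
      by (rule Henstock_Kurzweil_Integration.integral_cong)
        (use t in \<open>auto simp: linear_add[OF lA[OF _ q], symmetric]\<close>)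
    finally show ?thesis .
  qed
  define z where "z v t q = (\<Sum>i\<in>Basis. (v \<bullet> i) *\<^sub>R Z i t q)" for v t q
  have lz: "linear (\<lambda>v. z v t q)" for t q
    by (rule linearI) (auto simp: z_def inner_add_left scaleR_add_left sum.distrib scaleR_sum_right)
  have cz: "continuous_on {0..1} (\<lambda>t. z v t q)" if "q \<in> Q" for v q
    unfolding z_def by (intro continuous_on_sum continuous_on_scaleR continuous_on_const cZ that)
  have pz: "(v, (z v \<tau> q, z v 1 q)) = (\<Sum>i\<in>Basis. (v \<bullet> i) *\<^sub>R (i, (Z i \<tau> q, Z i 1 q)))" for v \<tau> q
    by (simp add: prod_eq_iff fst_sum snd_sum z_def euclidean_representation)
  have eqz: "z v t q = D (\<beta> t) q v + integral {0..t} (\<lambda>\<tau>. ?A \<tau> q (v, (z v \<tau> q, z v 1 q)))"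
    if t: "t \<in> {0..1}" and q: "q \<in> Q" for v t q
  proof -
    have l\<beta>: "linear (D (\<beta> t) q)"
      using \<beta> t q by (auto intro: linear_frechet_derivative)
    have "integral {0..t} (\<lambda>\<tau>. ?A \<tau> q (v, (z v \<tau> q, z v 1 q)))
        = integral {0..t} (\<lambda>\<tau>. \<Sum>i\<in>Basis. (v \<bullet> i) *\<^sub>R ?A \<tau> q (i, (Z i \<tau> q, Z i 1 q)))"
      unfolding pz
      by (rule Henstock_Kurzweil_Integration.integral_cong)
        (use t in \<open>simp add: linear_sum[OF lA[OF _ q]] linear_scale[OF lA[OF _ q]] del: scaleR_Pair\<close>)
    also have "\<dots> = (\<Sum>i\<in>Basis. (v \<bullet> i) *\<^sub>R integral {0..t} (\<lambda>\<tau>. ?A \<tau> q (i, (Z i \<tau> q, Z i 1 q))))"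
      by (subst Henstock_Kurzweil_Integration.integral_sum)
        (auto intro!: integrable_on_initial[OF _ t] cA' q continuous_on_Pair continuous_on_const cZ continuous_on_scaleR)
    finally have "D (\<beta> t) q v + integral {0..t} (\<lambda>\<tau>. ?A \<tau> q (v, (z v \<tau> q, z v 1 q)))
        = (\<Sum>i\<in>Basis. (v \<bullet> i) *\<^sub>R D (\<beta> t) q i)
          + (\<Sum>i\<in>Basis. (v \<bullet> i) *\<^sub>R integral {0..t} (\<lambda>\<tau>. ?A \<tau> q (i, (Z i \<tau> q, Z i 1 q))))"
      using linear_eq_Basis_sum[OF l\<beta>, of v] by simp
    also have "\<dots> = z v t q"
      unfolding z_def
      by (subst sum.distrib[symmetric]) (simp add: eqZ[OF t q, symmetric] scaleR_add_right[symmetric])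
    finally show ?thesis by simp
  qed
  have "solves Q (linearized_rhs f y) (linearized_source f \<beta> y v) (z v)" for v
    unfolding solves_def
  proof (intro conjI ballI)
    have "continuous_on ({0..1} \<times> Q) (\<lambda>x. \<Sum>i\<in>Basis. (v \<bullet> i) *\<^sub>R Z i (fst x) (snd x))"
      using Z unfolding solves_def
      by (intro continuous_on_sum continuous_on_scaleR continuous_on_const) (simp add: case_prod_beta)
    then show "continuous_on ({0..1} \<times> Q) (\<lambda>(t, q). z v t q)"
      by (simp add: z_def case_prod_beta)
    fix q t assume q: "q \<in> Q" and t: "t \<in> {0..1::real}"
    have "integral {0..t} (\<lambda>\<tau>. ?A \<tau> q (v, (z v \<tau> q, z v 1 q)))
        = integral {0..t} (\<lambda>\<tau>. ?A \<tau> q (v, 0) + ?A \<tau> q (0, (z v \<tau> q, z v 1 q)))"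
      by (rule Henstock_Kurzweil_Integration.integral_cong)
        (use t in \<open>auto simp: linear_add[OF lA[OF _ q], symmetric]\<close>)
    also have "\<dots> = integral {0..t} (\<lambda>\<tau>. ?A \<tau> q (v, 0)) + integral {0..t} (\<lambda>\<tau>. ?A \<tau> q (0, (z v \<tau> q, z v 1 q)))"
      by (rule Henstock_Kurzweil_Integration.integral_add)
        (intro integrable_on_initial[OF _ t] cA' q continuous_on_Pair continuous_on_const cz)+
    finally show "z v t q = linearized_source f \<beta> y v t q +
        integral {0..t} (\<lambda>\<tau>. linearized_rhs f y \<tau> (q, (z v \<tau> q, z v 1 q)))"
      using eqz[OF t q, of v] by (simp add: linearized_rhs_def linearized_source_def)
  qed
  moreover have "(y t has_derivative (\<lambda>v. z v t q)) (at q)" if t: "t \<in> {0..1}" and q: "q \<in> Q" for t q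
  proof -
    have "\<exists>C\<ge>0. \<forall>v. \<forall>\<tau>\<in>{0..1}. norm (z v \<tau> q) \<le> C * norm v"
    proof -
      have "\<exists>M. \<forall>\<tau>\<in>{0..1}. norm (Z i \<tau> q) \<le> M" for i
        using compact_imp_bounded[OF compact_continuous_image[OF cZ[OF q, of i] compact_Icc]]
        by (auto simp: bounded_iff)
      then obtain M where M: "\<And>i \<tau>. \<tau> \<in> {0..1} \<Longrightarrow> norm (Z i \<tau> q) \<le> M i" by metis
      have M0: "M i \<ge> 0" for i using order_trans[OF norm_ge_zero M[of 0 i]] by simp
      have "norm (z v \<tau> q) \<le> (\<Sum>i\<in>Basis. M i) * norm v" if "\<tau> \<in> {0..1}" for v \<tau>
      proof -
        have "norm (z v \<tau> q) \<le> (\<Sum>i\<in>Basis. norm ((v \<bullet> i) *\<^sub>R Z i \<tau> q))"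
          unfolding z_def by (rule norm_sum)
        also have "\<dots> \<le> (\<Sum>i\<in>Basis. M i * norm v)"
        proof (rule sum_mono)
          fix i :: 'q assume "i \<in> Basis"
          then have "\<bar>v \<bullet> i\<bar> * norm (Z i \<tau> q) \<le> norm v * M i"
            by (intro mult_mono M that) (auto simp: Basis_le_norm)
          then show "norm ((v \<bullet> i) *\<^sub>R Z i \<tau> q) \<le> M i * norm v" by (simp add: mult.commute)
        qed
        finally show ?thesis by (simp add: sum_distrib_right)
      qed
      moreover have "(\<Sum>i\<in>Basis. M i) \<ge> 0" by (intro sum_nonneg M0)
      ultimately show ?thesis by blast
    qed
    then obtain C where C: "C \<ge> 0" "\<And>v \<tau>. \<tau> \<in> {0..1} \<Longrightarrow> norm (z v \<tau> q) \<le> C * norm v" by blast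
    have "\<exists>d>0. \<forall>x. norm (x - q) < d \<longrightarrow> norm (y t x - y t q - z (x - q) t q) \<le> e * norm (x - q)"
      if e: "e > 0" for e
    proof -
      \<comment> \<open>The bound \<open>1/8\<close> leaves the factor \<open>3/4\<close> in front of the error; the other bound yields \<open>e\<close> after absorption.\<close>
      define \<eta> where "\<eta> = min (1 / 8) (e / (8 * (1 + C)))"
      have \<eta>: "\<eta> > 0" "\<eta> \<le> 1 / 8" "8 * \<eta> * (1 + C) \<le> e"
      proof -
        show "\<eta> > 0" using e C(1) by (auto simp: \<eta>_def intro!: divide_pos_pos)
        show "\<eta> \<le> 1 / 8" by (simp only: \<eta>_def min.cobounded1)
        have "\<eta> \<le> e / (8 * (1 + C))" by (simp add: \<eta>_def)
        then show "8 * \<eta> * (1 + C) \<le> e" using C(1) by (simp add: field_simps)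
      qed
      have q01: "(\<lambda>_. q) ` {0..1::real} \<subseteq> Q" using q by auto
      obtain d1 where d1: "d1 > 0" "\<And>\<tau> x. \<tau> \<in> {0..1} \<Longrightarrow> norm (x - q) < d1 \<Longrightarrow> x \<in> Q \<and>
          norm (\<beta> \<tau> x - \<beta> \<tau> q - D (\<beta> \<tau>) q (x - q)) \<le> \<eta> * norm (x - q)"
        using Ck_family_uniform_remainder[OF Q \<beta> compact_Icc continuous_on_const q01 \<eta>(1)] by blast
      have cc: "continuous_on {0..1} (\<lambda>\<tau>. curve y \<tau> q)"
        by (rule Ck_family_continuous_time[OF Ck_family_curve[OF y0] q])
      obtain d2 where d2: "d2 > 0" "\<And>\<tau> x. \<tau> \<in> {0..1} \<Longrightarrow> norm (x - curve y \<tau> q) < d2 \<Longrightarrow> x \<in> \<Omega> \<and>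
          norm (f \<tau> x - f \<tau> (curve y \<tau> q) - ?A \<tau> q (x - curve y \<tau> q)) \<le> \<eta> * norm (x - curve y \<tau> q)"
        using Ck_family_uniform_remainder[OF \<Omega> f compact_Icc cc _ \<eta>(1)] into q by blast
      obtain d3 where d3: "d3 > 0" "\<And>\<tau> x. \<tau> \<in> {0..1} \<Longrightarrow> x \<in> Q \<Longrightarrow> dist x q < d3 \<Longrightarrow>
          dist (curve y \<tau> x) (curve y \<tau> q) \<le> d2 / 2"
        using continuous_family_uniform[OF Ck_family_continuous[OF Ck_family_curve[OF y0]] compact_Icc q, of "d2 / 2"] d2(1)
        by auto
      have "norm (y t x - y t q - z (x - q) t q) \<le> e * norm (x - q)" if x: "norm (x - q) < min d1 d3" for x
      proof -
        have xQ: "x \<in> Q" using d1(2)[of 0 x] x by simp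
        define v where "v = x - q"
        define E where "E \<tau> = y \<tau> x - y \<tau> q - z v \<tau> q" for \<tau>
        have cy: "continuous_on {0..1} (\<lambda>\<tau>. y \<tau> x)" if "x \<in> Q" for x
          by (rule Ck_family_continuous_time[OF y0 that])
        have cE: "continuous_on {0..1} E"
          unfolding E_def by (intro continuous_on_diff cy cz q xQ)
        have cf: "continuous_on {0..1} (\<lambda>\<tau>. f \<tau> (curve y \<tau> x))" if "x \<in> Q" for x
        proof -
          have "Ck_family 0 {0..1} Q (\<lambda>\<tau> x. f \<tau> (curve y \<tau> x))"
            by (rule Ck_family_compose[OF Q Ck_family_Suc_imp[OF f] Ck_family_curve[OF y0] into])
          from Ck_family_continuous_time[OF this that] show ?thesis .
        qed
        have "norm (E t) \<le> (2 * \<eta> * (1 + C) * norm v) / (1 - 3 / 4)"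
        proof (rule sup_bound_absorb[OF cE _ _ t])
          fix t s assume t: "t \<in> {0..1::real}" and s: "\<And>\<tau>. \<tau> \<in> {0..1} \<Longrightarrow> norm (E \<tau>) \<le> s"
          have s0: "s \<ge> 0" using order_trans[OF norm_ge_zero s[of 0]] by simp
          have ysol: "y t x = \<beta> t x + integral {0..t} (\<lambda>\<tau>. f \<tau> (curve y \<tau> x))" if "x \<in> Q" for x
            using sol t that unfolding solves_def curve_def by blast
          have cAz: "continuous_on {0..1} (\<lambda>\<tau>. ?A \<tau> q (v, (z v \<tau> q, z v 1 q)))"
            by (intro cA' q continuous_on_Pair continuous_on_const cz)
          have "E t = (\<beta> t x - \<beta> t q - D (\<beta> t) q v)
              + (integral {0..t} (\<lambda>\<tau>. f \<tau> (curve y \<tau> x)) - integral {0..t} (\<lambda>\<tau>. f \<tau> (curve y \<tau> q))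
                 - integral {0..t} (\<lambda>\<tau>. ?A \<tau> q (v, (z v \<tau> q, z v 1 q))))"
            unfolding E_def using ysol[OF xQ] ysol[OF q] eqz[OF t q, of v] by (simp add: algebra_simps)
          also have "integral {0..t} (\<lambda>\<tau>. f \<tau> (curve y \<tau> x)) - integral {0..t} (\<lambda>\<tau>. f \<tau> (curve y \<tau> q))
                 - integral {0..t} (\<lambda>\<tau>. ?A \<tau> q (v, (z v \<tau> q, z v 1 q)))
              = integral {0..t} (\<lambda>\<tau>. f \<tau> (curve y \<tau> x) - f \<tau> (curve y \<tau> q) - ?A \<tau> q (v, (z v \<tau> q, z v 1 q)))"
            by (simp add: Henstock_Kurzweil_Integration.integral_diff integrable_on_initial[OF _ t]
                cf xQ q cAz continuous_on_diff)
          also have "norm ((\<beta> t x - \<beta> t q - D (\<beta> t) q v) + \<dots>)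
              \<le> \<eta> * norm v + (\<eta> * (norm v + 2 * (s + C * norm v)) + s / 2)"
          proof (rule norm_triangle_le[OF add_mono])
            show "norm (\<beta> t x - \<beta> t q - D (\<beta> t) q v) \<le> \<eta> * norm v"
              using d1(2)[OF t, of x] x by (simp add: v_def)
            show "norm (integral {0..t} (\<lambda>\<tau>. f \<tau> (curve y \<tau> x) - f \<tau> (curve y \<tau> q) - ?A \<tau> q (v, (z v \<tau> q, z v 1 q))))
              \<le> \<eta> * (norm v + 2 * (s + C * norm v)) + s / 2"
            proof (rule norm_integral_initial_le[OF _ t])
              show "continuous_on {0..1} (\<lambda>\<tau>. f \<tau> (curve y \<tau> x) - f \<tau> (curve y \<tau> q) - ?A \<tau> q (v, (z v \<tau> q, z v 1 q)))"
                by (intro continuous_on_diff cf xQ q cAz)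
              fix \<tau> :: real assume \<tau>: "\<tau> \<in> {0..1}"
              let ?\<Delta> = "curve y \<tau> x - curve y \<tau> q"
              have "norm (y \<tau>' x - y \<tau>' q) \<le> s + C * norm v" if "\<tau>' \<in> {0..1}" for \<tau>'
                using norm_triangle_ineq[of "E \<tau>'" "z v \<tau>' q"] s[OF that] C(2)[OF that, of v]
                by (simp add: E_def)
              then have "norm ((y \<tau> x, y 1 x) - (y \<tau> q, y 1 q)) \<le> 2 * (s + C * norm v)"
                using \<tau> by (intro norm_pair_diff_le) auto
              then have \<Delta>: "norm ?\<Delta> \<le> norm v + 2 * (s + C * norm v)"
                using norm_Pair_le[of v "(y \<tau> x, y 1 x) - (y \<tau> q, y 1 q)"] by (simp add: curve_def v_def)
              have "norm ?\<Delta> < d2"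
                using d3(2)[OF \<tau> xQ] x d2(1) by (simp add: dist_norm)
              then have 1: "norm (f \<tau> (curve y \<tau> x) - f \<tau> (curve y \<tau> q) - ?A \<tau> q ?\<Delta>) \<le> \<eta> * norm ?\<Delta>"
                using d2(2)[OF \<tau>] by blast
              have "norm (E \<tau>, E 1) \<le> 2 * s"
                using norm_Pair_le[of "E \<tau>" "E 1"] s[OF \<tau>] s[of 1] by simp
              then have 2: "norm (?A \<tau> q (0, (E \<tau>, E 1))) \<le> s / 2"
                using norm_linearized_rhs_le[OF f \<tau> q, of "(E \<tau>, E 1)"] by simp
              have 3: "?\<Delta> - (v, (z v \<tau> q, z v 1 q)) = (0, (E \<tau>, E 1))"
                by (simp add: curve_def v_def E_def)
              have "?A \<tau> q ?\<Delta> - ?A \<tau> q (v, (z v \<tau> q, z v 1 q)) = ?A \<tau> q (0, (E \<tau>, E 1))"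
                unfolding 3[symmetric] by (rule linear_diff[OF lA[OF \<tau> q], symmetric])
              then have "f \<tau> (curve y \<tau> x) - f \<tau> (curve y \<tau> q) - ?A \<tau> q (v, (z v \<tau> q, z v 1 q))
                  = (f \<tau> (curve y \<tau> x) - f \<tau> (curve y \<tau> q) - ?A \<tau> q ?\<Delta>) + ?A \<tau> q (0, (E \<tau>, E 1))"
                by (simp add: algebra_simps)
              also have "norm \<dots> \<le> \<eta> * norm ?\<Delta> + s / 2"
                by (rule norm_triangle_le[OF add_mono[OF 1 2]])
              also have "\<eta> * norm ?\<Delta> \<le> \<eta> * (norm v + 2 * (s + C * norm v))"
                using \<eta>(1) \<Delta> by (intro mult_left_mono) auto
              finally show "norm (f \<tau> (curve y \<tau> x) - f \<tau> (curve y \<tau> q) - ?A \<tau> q (v, (z v \<tau> q, z v 1 q)))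
                  \<le> \<eta> * (norm v + 2 * (s + C * norm v)) + s / 2" by simp
            qed
          qed
          also have "\<dots> = 2 * \<eta> * (1 + C) * norm v + (2 * \<eta> + 1 / 2) * s"
            by (simp add: algebra_simps)
          also have "\<dots> \<le> 2 * \<eta> * (1 + C) * norm v + 3 / 4 * s"
            using \<eta>(2) s0 by (intro add_left_mono mult_right_mono) auto
          finally show "norm (E t) \<le> 2 * \<eta> * (1 + C) * norm v + 3 / 4 * s" .
        qed simp
        also have "\<dots> = (8 * \<eta> * (1 + C)) * norm v" by simp
        also have "\<dots> \<le> e * norm v" by (intro mult_right_mono \<eta>(3)) auto
        finally show ?thesis by (simp add: E_def v_def)
      qed
      then show ?thesis using d1(1) d3(1) by (intro exI[of _ "min d1 d3"]) auto
    qed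
    then show ?thesis
      using lz by (simp add: has_derivative_at_alt linear_conv_bounded_linear)
  qed
  ultimately show ?thesis by blast
qed

end

text \<open>Bootstrapping: the derivatives of the solution solve an equation of the same kind with the same
  parameter set and the same contraction constant, one order of differentiability lower.  Hence neither
  the time interval nor the parameter set shrinks as the order grows.\<close>

theorem solves_imp_Ck_family:
  assumes "integral_equation Q \<Omega> f \<beta> y" "Ck_family n {0..1} \<Omega> f" "Ck_family n {0..1} Q \<beta>"
  shows "Ck_family n {0..1} Q y"
  using assms
proof (induction n arbitrary: \<Omega> f \<beta> y)
  case 0
  then interpret integral_equation Q \<Omega> f \<beta> y by simp
  show ?case using sol by (simp add: solves_def)
next
  case (Suc n)
  then interpret integral_equation Q \<Omega> f \<beta> y by simp
  have y: "Ck_family n {0..1} Q y"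
    by (rule Suc.IH[OF Suc.prems(1) Ck_family_Suc_imp Ck_family_Suc_imp]) fact+
  have "Ck_family (Suc 0) {0..1} \<Omega> f" "Ck_family (Suc 0) {0..1} Q \<beta>"
    by (rule Ck_family_le[OF _ Suc.prems(2)] Ck_family_le[OF _ Suc.prems(3)], simp)+
  from solution_has_derivative[OF this] obtain z where
    z: "\<And>v. solves Q (linearized_rhs f y) (linearized_source f \<beta> y v) (z v)"
      "\<And>t q. t \<in> {0..1} \<Longrightarrow> q \<in> Q \<Longrightarrow> (y t has_derivative (\<lambda>v. z v t q)) (at q)" by blast
  show ?case
  proof (rule Ck_family_SucI[OF Q Ck_family_continuous[OF y] z(2)])
    fix v
    have "integral_equation Q (Q \<times> UNIV) (linearized_rhs f y) (linearized_source f \<beta> y v) (z v)"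
      using Q quarter_lipschitz_linearized_rhs[OF Suc.prems(2)] z(1)
      by unfold_locales (auto simp: curve_def intro: open_Times)
    then show "Ck_family n {0..1} Q (\<lambda>t q. z v t q)"
      by (rule Suc.IH[OF _ Ck_family_linearized_rhs[OF Suc.prems(2) y]
            Ck_family_linearized_source[OF Suc.prems(2,3) y]])
  qed
qed

section \<open>Flat sprays on an open subset of a vector space\<close>

lemma frechet_derivative_cong_open:
  assumes "open S" "z \<in> S" "\<And>z. z \<in> S \<Longrightarrow> F z = G z" "F differentiable at z"
  shows "D F z = D G z"
  by (rule frechet_derivative_transform_within_open[OF assms(4,1,2,3)])

lemma has_derivative_frechet_derivative_apply:
  fixes F :: "'p::euclidean_space \<Rightarrow> 'e::euclidean_space" and c :: "'a::real_normed_vector \<Rightarrow> 'p"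
  assumes S: "open S" and F: "times_differentiable_on (Suc (Suc 0)) S F"
    and c: "(c has_derivative c') (at p within X)" and W: "(W has_derivative W') (at p within X)"
    and p: "c p \<in> S"
  shows "((\<lambda>p. D F (c p) (W p)) has_derivative
    (\<lambda>d. D (\<lambda>x. D F x (W p)) (c p) (c' d)
       + D F (c p) (W' d))) (at p within X)"
proof -
  let ?D = "\<lambda>x. D F x"
  have lD: "linear (?D x)" if "x \<in> S" for x
    using F that by (auto intro: linear_frechet_derivative)
  have dD: "((\<lambda>x. ?D x w) has_derivative D (\<lambda>x. ?D x w) (c p)) (at (c p))" for w
    using F p unfolding times_differentiable_on.simps by (simp add: frechet_derivative_works)
  have expand: "?D x w = (\<Sum>i\<in>Basis. (w \<bullet> i) *\<^sub>R ?D x i)" if "x \<in> S" for x w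
    by (rule linear_eq_Basis_sum[OF lD[OF that]])
  have "((\<lambda>x. \<Sum>i\<in>Basis. (w \<bullet> i) *\<^sub>R ?D x i) has_derivative
      (\<lambda>v. \<Sum>i\<in>Basis. (w \<bullet> i) *\<^sub>R D (\<lambda>x. ?D x i) (c p) v)) (at (c p))" for w
    by (intro has_derivative_sum bounded_linear.has_derivative[OF bounded_linear_scaleR_right] dD)
  then have "((\<lambda>x. ?D x w) has_derivative
      (\<lambda>v. \<Sum>i\<in>Basis. (w \<bullet> i) *\<^sub>R D (\<lambda>x. ?D x i) (c p) v)) (at (c p))" for w
    by (rule has_derivative_transform_within_open[OF _ S p]) (rule expand[symmetric])
  from frechet_derivative_at[OF this, of "W p"]
  have D2: "D (\<lambda>x. ?D x (W p)) (c p) v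
      = (\<Sum>i\<in>Basis. (W p \<bullet> i) *\<^sub>R D (\<lambda>x. ?D x i) (c p) v)" for v
    by (rule fun_cong[OF sym])
  have "((\<lambda>p. \<Sum>i\<in>Basis. (W p \<bullet> i) *\<^sub>R ?D (c p) i) has_derivative
      (\<lambda>d. \<Sum>i\<in>Basis. (W p \<bullet> i) *\<^sub>R D (\<lambda>x. ?D x i) (c p) (c' d)
        + (W' d \<bullet> i) *\<^sub>R ?D (c p) i)) (at p within X)"
    by (intro has_derivative_sum has_derivative_scaleR has_derivative_compose[OF c dD]
        bounded_linear.has_derivative[OF bounded_linear_inner_left W])
  also have "(\<lambda>d. \<Sum>i\<in>Basis. (W p \<bullet> i) *\<^sub>R D (\<lambda>x. ?D x i) (c p) (c' d)
        + (W' d \<bullet> i) *\<^sub>R ?D (c p) i)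
      = (\<lambda>d. D (\<lambda>x. ?D x (W p)) (c p) (c' d) + ?D (c p) (W' d))"
    by (simp add: sum.distrib D2 expand[OF p, of "W' _"])
  finally have 1: "((\<lambda>p. \<Sum>i\<in>Basis. (W p \<bullet> i) *\<^sub>R ?D (c p) i) has_derivative
      (\<lambda>d. D (\<lambda>x. ?D x (W p)) (c p) (c' d) + ?D (c p) (W' d))) (at p within X)" .
  have "eventually (\<lambda>p. c p \<in> S) (at p within X)"
    using has_derivative_continuous[OF c] S p unfolding continuous_within by (rule topological_tendstoD)
  then have 2: "eventually (\<lambda>p. (\<Sum>i\<in>Basis. (W p \<bullet> i) *\<^sub>R ?D (c p) i) = ?D (c p) (W p)) (at p within X)"
    by eventually_elim (rule expand[symmetric])
  have "(\<Sum>i\<in>Basis. (W p \<bullet> i) *\<^sub>R ?D (c p) i) = ?D (c p) (W p)" by (rule expand[OF p, symmetric])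
  with 1 2 show ?thesis
    unfolding has_derivative_within
    by (auto elim!: Lim_transform_eventually simp: eventually_mono elim: eventually_mono)
qed

lemma lipschitz_on_compact_convex:
  fixes F :: "'p::euclidean_space \<Rightarrow> 'e::euclidean_space"
  assumes S: "open S" and F: "times_differentiable_on (Suc 0) S F"
    and K: "compact K" "convex K" "K \<subseteq> S"
  obtains L where "L \<ge> 0" "\<And>a b. a \<in> K \<Longrightarrow> b \<in> K \<Longrightarrow> norm (F a - F b) \<le> L * norm (a - b)"
proof -
  have "\<exists>M. \<forall>x\<in>K. norm (D F x i) \<le> M" for i
  proof -
    have "continuous_on S (\<lambda>x. D F x i)" using F by simp
    then have "continuous_on K (\<lambda>x. D F x i)" using K(3) by (rule continuous_on_subset)
    from compact_imp_bounded[OF compact_continuous_image[OF this K(1)]]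
    show ?thesis by (auto simp: bounded_iff)
  qed
  then obtain M where M: "\<And>i x. x \<in> K \<Longrightarrow> norm (D F x i) \<le> M i" by metis
  have d: "(F has_derivative D F x) (at x)" if "x \<in> K" for x
    using F K(3) that by (auto simp: frechet_derivative_works[symmetric])
  have "norm (F a - F b) \<le> (\<Sum>i\<in>Basis. M i) * norm (a - b)" if "a \<in> K" "b \<in> K" for a b
  proof (rule differentiable_bound[OF K(2) _ _ that])
    show "(F has_derivative D F x) (at x within K)" if "x \<in> K" for x
      by (rule has_derivative_at_withinI[OF d[OF that]])
    show "onorm (D F x) \<le> (\<Sum>i\<in>Basis. M i)" if "x \<in> K" for x
      by (rule order_trans[OF onorm_componentwise[OF has_derivative_bounded_linear[OF d[OF that]]]])
        (intro sum_mono M that)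
  qed
  then have "norm (F a - F b) \<le> \<bar>\<Sum>i\<in>Basis. M i\<bar> * norm (a - b)" if "a \<in> K" "b \<in> K" for a b
    by (rule order_trans[OF _ mult_right_mono]) (use that in auto)
  then show thesis by (rule that[rotated]) auto
qed

text \<open>The difference of the two equations is three times the claim; they arise from each other by
  exchanging the two directions in the derivative of the curvature.\<close>

lemma swapped_equations_imp_eq:
  fixes a b c d m t :: "'e::euclidean_space"
  assumes "2 *\<^sub>R a - (t + (b - 2 *\<^sub>R c)) - (d + m) = 0"
    and "2 *\<^sub>R b - (t + (a - 2 *\<^sub>R d)) - (c + m) = 0"
  shows "a - d = b - c"
proof (rule euclidean_eqI)
  fix i :: 'e
  have "(2 *\<^sub>R a - (t + (b - 2 *\<^sub>R c)) - (d + m)) \<bullet> i = 0"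
    "(2 *\<^sub>R b - (t + (a - 2 *\<^sub>R d)) - (c + m)) \<bullet> i = 0"
    by (simp_all only: assms inner_zero_left)
  then show "(a - d) \<bullet> i = (b - c) \<bullet> i" by (simp add: inner_simps)
qed

text \<open>\<open>N\<close> is the nonlinear connection \<open>N\<^sup>i\<^sub>k = \<partial>G\<^sup>i/\<partial>y\<^sup>k\<close>, applied to a vector; the horizontal lift of \<open>k\<close> at
  \<open>z\<close> is \<open>(k, - N z k)\<close>.\<close>

locale spray_coefficients =
  fixes \<Omega> :: "('e::euclidean_space \<times> 'e) set" and g :: "'e \<times> 'e \<Rightarrow> 'e" and N :: "'e \<times> 'e \<Rightarrow> 'e \<Rightarrow> 'e"
  defines "N \<equiv> \<lambda>z k. D g z (0, k)"
  assumes \<Omega>: "open \<Omega>" and smooth: "smooth_on \<Omega> g"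
    and cone: "\<And>x y t. (x, y) \<in> \<Omega> \<Longrightarrow> t > 0 \<Longrightarrow> (x, t *\<^sub>R y) \<in> \<Omega>"
    and homogeneous: "\<And>x y t. (x, y) \<in> \<Omega> \<Longrightarrow> t > 0 \<Longrightarrow> g (x, t *\<^sub>R y) = t\<^sup>2 *\<^sub>R g (x, y)"
begin

lemma times_differentiable_g: "times_differentiable_on n \<Omega> g"
  using smooth by (simp add: smooth_on_def)

lemma g_has_derivative: "z \<in> \<Omega> \<Longrightarrow> (g has_derivative D g z) (at z)"
  using times_differentiable_g[of 1] by (simp add: frechet_derivative_works)

lemma times_differentiable_Dg: "times_differentiable_on n \<Omega> (\<lambda>z. D g z v)"
  using times_differentiable_g[of "Suc n"] unfolding times_differentiable_on.simps by blast

lemma times_differentiable_N: "times_differentiable_on n \<Omega> (\<lambda>z. N z k)"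
  unfolding N_def by (rule times_differentiable_Dg)

lemma N_has_derivative:
  "z \<in> \<Omega> \<Longrightarrow> ((\<lambda>z. N z k) has_derivative D (\<lambda>z. N z k) z) (at z)"
  using times_differentiable_N[of "Suc 0" k] by (simp add: frechet_derivative_works)

lemma linear_N:
  assumes "z \<in> \<Omega>"
  shows "linear (N z)"
proof -
  have "linear (\<lambda>k :: 'e. (0 :: 'e, k))" by (intro linearI) auto
  from linear_compose[OF this has_derivative_linear[OF g_has_derivative[OF assms]]]
  show ?thesis by (simp add: N_def o_def)
qed

lemma N_homogeneous:
  assumes z: "(x, y) \<in> \<Omega>" and t: "t > 0"
  shows "N (x, t *\<^sub>R y) k = t *\<^sub>R N (x, y) k"
proof -
  let ?m = "\<lambda>z :: 'e \<times> 'e. (fst z, t *\<^sub>R snd z)"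
  have "(?m has_derivative ?m) (at (x, y))"
    by (auto intro!: derivative_eq_intros)
  moreover have "(g has_derivative D g (?m (x, y))) (at (?m (x, y)))"
    by (rule g_has_derivative) (use cone[OF z t] in simp)
  ultimately have 1: "((\<lambda>z. g (?m z)) has_derivative (\<lambda>v. D g (?m (x, y)) (?m v))) (at (x, y))"
    by (rule has_derivative_compose)
  have 2: "((\<lambda>z. g (?m z)) has_derivative (\<lambda>v. t\<^sup>2 *\<^sub>R D g (x, y) v)) (at (x, y))"
    by (rule has_derivative_transform_within_open[OF bounded_linear.has_derivative[OF
          bounded_linear_scaleR_right g_has_derivative[OF z]] \<Omega> z])
      (use homogeneous t in auto)
  have "D g (x, t *\<^sub>R y) (0, t *\<^sub>R k) = t\<^sup>2 *\<^sub>R N (x, y) k"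
    using fun_cong[OF has_derivative_unique[OF 1 2], of "(0, k)"] by (simp add: N_def)
  moreover have "D g (x, t *\<^sub>R y) (0, t *\<^sub>R k) = t *\<^sub>R N (x, t *\<^sub>R y) k"
    using linear_scale[OF linear_N[OF cone[OF z t]], of t k] by (simp add: N_def)
  ultimately have "t *\<^sub>R N (x, t *\<^sub>R y) k = t *\<^sub>R (t *\<^sub>R N (x, y) k)"
    by (simp add: power2_eq_square)
  then show ?thesis using t by (simp only: real_vector.scale_cancel_left) simp
qed

lemma DN_symmetric:
  assumes z: "z \<in> \<Omega>"
  shows "D (\<lambda>z. N z k) z (0, l) = D (\<lambda>z. N z l) z (0, k)"
  unfolding N_def by (rule second_derivative_symmetric[OF \<Omega> times_differentiable_g z])

lemma N_eq_sum: "z \<in> \<Omega> \<Longrightarrow> N z w = (\<Sum>i\<in>Basis. (w \<bullet> i) *\<^sub>R N z i)"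
  by (rule linear_eq_Basis_sum[OF linear_N])

lemma DN_eq_sum:
  assumes "z \<in> \<Omega>"
  shows "D (\<lambda>z. N z w) z v
    = (\<Sum>i\<in>Basis. (w \<bullet> i) *\<^sub>R D (\<lambda>z. N z i) z v)"
proof -
  have "((\<lambda>z. \<Sum>i\<in>Basis. (w \<bullet> i) *\<^sub>R N z i) has_derivative
      (\<lambda>v. \<Sum>i\<in>Basis. (w \<bullet> i) *\<^sub>R D (\<lambda>z. N z i) z v)) (at z)"
    by (intro has_derivative_sum bounded_linear.has_derivative[OF bounded_linear_scaleR_right]
        N_has_derivative assms)
  then have "((\<lambda>z. N z w) has_derivative
      (\<lambda>v. \<Sum>i\<in>Basis. (w \<bullet> i) *\<^sub>R D (\<lambda>z. N z i) z v)) (at z)"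
    by (rule has_derivative_transform_within_open[OF _ \<Omega> assms]) (rule N_eq_sum[symmetric])
  from fun_cong[OF frechet_derivative_at[OF this]] show ?thesis by (rule sym)
qed

lemma N_comp_has_derivative:
  fixes c :: "'p::real_normed_vector \<Rightarrow> 'e \<times> 'e" and h :: "'p \<Rightarrow> 'e"
  assumes c: "(c has_derivative c') (at p within S)" and h: "(h has_derivative h') (at p within S)"
    and p: "c p \<in> \<Omega>"
  shows "((\<lambda>p. N (c p) (h p)) has_derivative
    (\<lambda>d. D (\<lambda>z. N z (h p)) (c p) (c' d) + N (c p) (h' d))) (at p within S)"
  unfolding N_def
  by (rule has_derivative_frechet_derivative_apply[OF \<Omega> times_differentiable_g c
        has_derivative_Pair[OF has_derivative_const h] p])

end

text \<open>The flatness identity is \<open>R\<^sup>i\<^sub>k = 0\<close> contracted with a vector \<open>k\<close>: differentiating \<open>z \<mapsto> N z k\<close> along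
  \<open>(y, - 2 g)\<close> collects the two terms with second derivatives of the spray coefficients.\<close>

locale flat_spray = spray_coefficients \<Omega> g N
  for \<Omega> :: "('e::euclidean_space \<times> 'e) set" and g :: "'e \<times> 'e \<Rightarrow> 'e" and N :: "'e \<times> 'e \<Rightarrow> 'e \<Rightarrow> 'e" +
  assumes flat: "\<And>z k. z \<in> \<Omega> \<Longrightarrow>
    2 *\<^sub>R D g z (k, 0)
      - D (\<lambda>z. N z k) z (snd z, - 2 *\<^sub>R g z) - N z (N z k) = 0"
begin

text \<open>This is the vanishing of \<open>R\<^sup>i\<^sub>k\<^sub>l\<close>, the obstruction to integrability of the horizontal distribution.
  It is obtained by differentiating \<open>R\<^sup>i\<^sub>k = 0\<close> along the fibre direction \<open>h\<close> and antisymmetrising in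
  \<open>k\<close> and \<open>h\<close>: the third derivatives of the coefficients cancel by symmetry, and what is left is
  three times the wanted identity.\<close>

lemma horizontal_integrability:
  assumes z: "z \<in> \<Omega>"
  shows "D (\<lambda>z. N z h) z (k, - N z k) = D (\<lambda>z. N z k) z (h, - N z h)"
proof -
  let ?D = "\<lambda>k z. D (\<lambda>z. N z k) z"
  let ?S = "(snd z, - 2 *\<^sub>R g z)"
  define T where "T k l = D (\<lambda>x. ?D k x ?S) z (0, l)" for k l
  have lin: "linear (?D k z)" for k
    by (rule has_derivative_linear[OF N_has_derivative[OF z]])
  have T_sym: "T k l = T l k" for k l
  proof -
    have "T k l = D (\<lambda>x. ?D k x (0, l)) z ?S"
      unfolding T_def by (rule second_derivative_symmetric[OF \<Omega> times_differentiable_N z])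
    also have "\<dots> = D (\<lambda>x. ?D l x (0, k)) z ?S"
    proof (rule fun_cong[OF frechet_derivative_cong_open[OF \<Omega> z DN_symmetric]])
      show "(\<lambda>x. ?D k x (0, l)) differentiable at z"
        using times_differentiable_N[of "Suc (Suc 0)" k] z unfolding times_differentiable_on.simps by blast
    qed
    also have "\<dots> = T l k"
      unfolding T_def by (rule second_derivative_symmetric[OF \<Omega> times_differentiable_N z])
    finally show ?thesis .
  qed
  have eq: "2 *\<^sub>R ?D l z (k, 0) - (T k l + ?D k z (l, - 2 *\<^sub>R N z l))
      - (?D l z (0, N z k) + N z (?D k z (0, l))) = 0" for k l
  proof -
    have a: "((\<lambda>x. D g x (k, 0)) has_derivative
        D (\<lambda>x. D g x (k, 0)) z) (at z)"
      using times_differentiable_Dg[of "Suc 0" "(k, 0)"] z by (simp add: frechet_derivative_works)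
    have "((\<lambda>x. (snd x, - 2 *\<^sub>R g x)) has_derivative (\<lambda>v. (snd v, - 2 *\<^sub>R D g z v))) (at z)"
      by (intro has_derivative_Pair bounded_linear.has_derivative[OF bounded_linear_scaleR_right]
          g_has_derivative[OF z] bounded_linear_imp_has_derivative bounded_linear_snd)
    note b = has_derivative_frechet_derivative_apply[OF \<Omega> times_differentiable_N has_derivative_ident this z, of k]
    have "((\<lambda>x. (0 :: 'e, N x k)) has_derivative (\<lambda>v. (0, ?D k z v))) (at z)"
      by (intro has_derivative_Pair has_derivative_const N_has_derivative z)
    note c = has_derivative_frechet_derivative_apply[OF \<Omega> times_differentiable_g has_derivative_ident this z]
    note abc = has_derivative_diff[OF has_derivative_diff[OF
          bounded_linear.has_derivative[OF bounded_linear_scaleR_right a, of 2] b] c]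
    have "((\<lambda>x. 0 :: 'e) has_derivative (\<lambda>v. 0)) (at z)" by simp
    from has_derivative_transform_within_open[OF this \<Omega> z, of
        "\<lambda>x. 2 *\<^sub>R D g x (k, 0) - ?D k x (snd x, - 2 *\<^sub>R g x) - D g x (0, N x k)"]
    have "((\<lambda>x. 2 *\<^sub>R D g x (k, 0) - ?D k x (snd x, - 2 *\<^sub>R g x)
        - D g x (0, N x k)) has_derivative (\<lambda>v. 0)) (at z)"
      using flat[of _ k] by (simp add: N_def)
    from fun_cong[OF has_derivative_unique[OF abc this], of "(0, l)"]
    have "2 *\<^sub>R D (\<lambda>x. D g x (k, 0)) z (0, l)
        - (T k l + ?D k z (l, - 2 *\<^sub>R N z l))
        - (D (\<lambda>x. D g x (0, N z k)) z (0, l) + N z (?D k z (0, l))) = 0"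
      by (simp add: T_def N_def)
    moreover have "D (\<lambda>x. D g x (k, 0)) z (0, l) = ?D l z (k, 0)"
      unfolding N_def by (rule second_derivative_symmetric[OF \<Omega> times_differentiable_g z])
    moreover have "D (\<lambda>x. D g x (0, N z k)) z (0, l) = ?D l z (0, N z k)"
      unfolding N_def by (rule second_derivative_symmetric[OF \<Omega> times_differentiable_g z])
    ultimately show ?thesis by simp
  qed
  have split: "?D k z (l, c *\<^sub>R w) = ?D k z (l, 0) + c *\<^sub>R ?D k z (0, w)" for k l c w
    using linear_add[OF lin, of k "(l, 0)" "c *\<^sub>R (0, w)"] linear_scale[OF lin, of k c "(0, w)"] by simp
  have minus2: "u + - 2 *\<^sub>R w = u - 2 *\<^sub>R w" for u w :: 'e by simp
  have "?D h z (k, 0) - ?D h z (0, N z k) = ?D k z (h, 0) - ?D k z (0, N z h)"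
    by (rule swapped_equations_imp_eq[of _ "T k h" _ _ _ "N z (?D k z (0, h))"])
      (use eq[of h k] eq[of k h] T_sym[of h k] DN_symmetric[OF z, of h k] in
        \<open>simp_all only: split[of _ _ "-2"] minus2\<close>)
  then show ?thesis
    using split[of h k "-1" "N z k"] split[of k h "-1" "N z h"] by simp
qed

end

section \<open>Characteristics of the Funk equation\<close>

lemma integral_equation_unique:
  fixes y1 y2 :: "real \<Rightarrow> 'e::euclidean_space"
  assumes c: "continuous_on {0..1} y1" "continuous_on {0..1} y2"
    and cF: "continuous_on {0..1} (\<lambda>\<tau>. F \<tau> (y1 \<tau>, y1 1))" "continuous_on {0..1} (\<lambda>\<tau>. F \<tau> (y2 \<tau>, y2 1))"
    and eq: "\<And>t. t \<in> {0..1} \<Longrightarrow> y1 t = b t + integral {0..t} (\<lambda>\<tau>. F \<tau> (y1 \<tau>, y1 1))"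
      "\<And>t. t \<in> {0..1} \<Longrightarrow> y2 t = b t + integral {0..t} (\<lambda>\<tau>. F \<tau> (y2 \<tau>, y2 1))"
    and lip: "\<And>\<tau>. \<tau> \<in> {0..1} \<Longrightarrow>
      norm (F \<tau> (y1 \<tau>, y1 1) - F \<tau> (y2 \<tau>, y2 1)) \<le> norm ((y1 \<tau>, y1 1) - (y2 \<tau>, y2 1)) / 4"
    and t: "t \<in> {0..1}"
  shows "y1 t = y2 t"
proof -
  have "norm (y1 t - y2 t) \<le> 0 / (1 - 1 / 2)"
  proof (rule sup_bound_absorb[OF _ _ _ t])
    show "continuous_on {0..1} (\<lambda>t. y1 t - y2 t)" by (intro continuous_on_diff c)
    fix t s assume t: "t \<in> {0..1::real}" and s: "\<And>\<tau>. \<tau> \<in> {0..1} \<Longrightarrow> norm (y1 \<tau> - y2 \<tau>) \<le> s"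
    have "y1 t - y2 t = integral {0..t} (\<lambda>\<tau>. F \<tau> (y1 \<tau>, y1 1)) - integral {0..t} (\<lambda>\<tau>. F \<tau> (y2 \<tau>, y2 1))"
      unfolding eq(1)[OF t] eq(2)[OF t] by simp
    also have "\<dots> = integral {0..t} (\<lambda>\<tau>. F \<tau> (y1 \<tau>, y1 1) - F \<tau> (y2 \<tau>, y2 1))"
      by (rule Henstock_Kurzweil_Integration.integral_diff[symmetric]) (intro integrable_on_initial[OF _ t] cF)+
    also have "norm \<dots> \<le> s / 2"
    proof (rule norm_integral_initial_le[OF _ t])
      show "continuous_on {0..1} (\<lambda>\<tau>. F \<tau> (y1 \<tau>, y1 1) - F \<tau> (y2 \<tau>, y2 1))"
        by (intro continuous_on_diff cF)
      fix \<tau> :: real assume \<tau>: "\<tau> \<in> {0..1}"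
      have "norm ((y1 \<tau>, y1 1) - (y2 \<tau>, y2 1)) \<le> 2 * s"
        using \<tau> by (intro norm_pair_diff_le s) auto
      with lip[OF \<tau>] show "norm (F \<tau> (y1 \<tau>, y1 1) - F \<tau> (y2 \<tau>, y2 1)) \<le> s / 2" by simp
    qed
    finally show "norm (y1 t - y2 t) \<le> 0 + 1 / 2 * s" by simp
  qed simp
  then show ?thesis by simp
qed

lemma Ck_family_linear_ident:
  "open Q \<Longrightarrow> bounded_linear B \<Longrightarrow> Ck_family n T Q (\<lambda>t q. B q)"
  by (rule Ck_family_bounded_linear[OF _ _ Ck_family_ident])

text \<open>The nearest-point projection onto the ball of centre \<open>s c\<close> and radius \<open>s \<rho>\<close>, written so that joint
  continuity in the scale \<open>s\<close> and the point is evident.\<close>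

definition cone_proj :: "'e::euclidean_space \<Rightarrow> real \<Rightarrow> real \<Rightarrow> 'e \<Rightarrow> 'e" where
  "cone_proj c \<rho> s a = s *\<^sub>R closest_point (cball c \<rho>) ((1 / s) *\<^sub>R a)"

context
  fixes c :: "'e::euclidean_space" and \<rho> s :: real
  assumes \<rho>: "\<rho> > 0" and s: "s > 0"
begin

lemma cone_proj_in: "norm (cone_proj c \<rho> s a - s *\<^sub>R c) \<le> s * \<rho>"
proof -
  have "closest_point (cball c \<rho>) ((1 / s) *\<^sub>R a) \<in> cball c \<rho>"
    using \<rho> by (intro closest_point_in_set) auto
  then have "norm (closest_point (cball c \<rho>) ((1 / s) *\<^sub>R a) - c) \<le> \<rho>"
    by (simp add: dist_norm norm_minus_commute)
  then have "s * norm (closest_point (cball c \<rho>) ((1 / s) *\<^sub>R a) - c) \<le> s * \<rho>"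
    using s by (intro mult_left_mono) auto
  then show ?thesis
    using s by (simp add: cone_proj_def scaleR_diff_right[symmetric])
qed

lemma cone_proj_nonexpansive: "norm (cone_proj c \<rho> s a - cone_proj c \<rho> s b) \<le> norm (a - b)"
proof -
  have "dist (closest_point (cball c \<rho>) ((1 / s) *\<^sub>R a)) (closest_point (cball c \<rho>) ((1 / s) *\<^sub>R b))
      \<le> dist ((1 / s) *\<^sub>R a) ((1 / s) *\<^sub>R b)"
    using \<rho> by (intro closest_point_lipschitz) auto
  also have "\<dots> = norm (a - b) / s"
    using s by (simp add: dist_norm scaleR_diff_right[symmetric] divide_inverse_commute)
  finally have *: "dist (closest_point (cball c \<rho>) ((1 / s) *\<^sub>R a)) (closest_point (cball c \<rho>) ((1 / s) *\<^sub>R b))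
      \<le> norm (a - b) / s" .
  have "norm (cone_proj c \<rho> s a - cone_proj c \<rho> s b)
      = s * dist (closest_point (cball c \<rho>) ((1 / s) *\<^sub>R a)) (closest_point (cball c \<rho>) ((1 / s) *\<^sub>R b))"
    using s by (simp add: cone_proj_def dist_norm flip: scaleR_diff_right)
  also have "\<dots> \<le> s * (norm (a - b) / s)" using s by (intro mult_left_mono *) auto
  finally show ?thesis using s by simp
qed

lemma cone_proj_self:
  assumes "norm (a - s *\<^sub>R c) \<le> s * \<rho>"
  shows "cone_proj c \<rho> s a = a"
proof -
  have "(1 / s) *\<^sub>R a - c = (1 / s) *\<^sub>R (a - s *\<^sub>R c)" using s by (simp add: scaleR_diff_right)
  then have "norm ((1 / s) *\<^sub>R a - c) = norm (a - s *\<^sub>R c) / s"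
    using s by (simp add: divide_inverse_commute)
  then have "norm ((1 / s) *\<^sub>R a - c) \<le> \<rho>"
    using s assms by (simp add: pos_divide_le_eq mult.commute)
  then have "(1 / s) *\<^sub>R a \<in> cball c \<rho>" by (simp add: dist_norm norm_minus_commute)
  then show ?thesis using s by (simp add: cone_proj_def closest_point_self)
qed

end

lemma continuous_on_cone_proj:
  fixes c :: "'e::euclidean_space"
  assumes "\<rho> > 0" "continuous_on S \<sigma>" "continuous_on S a" "\<And>x. x \<in> S \<Longrightarrow> \<sigma> x \<noteq> 0"
  shows "continuous_on S (\<lambda>x. cone_proj c \<rho> (\<sigma> x) (a x))"
proof -
  have 1: "continuous_on UNIV (closest_point (cball c \<rho>))"
    using assms(1) by (intro continuous_on_closest_point) auto
  have 2: "continuous_on S (\<lambda>x. (1 / \<sigma> x) *\<^sub>R a x)"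
    using assms by (intro continuous_intros) auto
  have "continuous_on S (\<lambda>x. closest_point (cball c \<rho>) ((1 / \<sigma> x) *\<^sub>R a x))"
    by (rule continuous_on_compose2[OF 1 2]) auto
  then show ?thesis unfolding cone_proj_def by (intro continuous_on_scaleR assms(2))
qed

text \<open>A ball around the base point on which \<open>N\<close> is bounded and Lipschitz in the fibre variable, with a radius
  \<open>r\<close> in the base so small that the characteristics below exist up to the fibre over \<open>x0\<close>.  By
  homogeneity both bounds extend from the ball to the cone over it.  The functional
  \<open>\<alpha>\<close> serves two purposes: it selects the scale of a point of the cone, and it is the prescribed
  restriction of the Funk function to the fibre over \<open>x0\<close>.\<close>

locale flat_spray_near_point = flat_spray \<Omega> g N
  for \<Omega> :: "('e::euclidean_space \<times> 'e) set" and g :: "'e \<times> 'e \<Rightarrow> 'e" and N :: "'e \<times> 'e \<Rightarrow> 'e \<Rightarrow> 'e" +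
  fixes x0 y0 \<alpha> :: 'e and r \<rho> L B :: real
  assumes \<alpha>: "y0 \<bullet> \<alpha> = 1" and r: "r > 0" and \<rho>: "\<rho> > 0" and L: "L \<ge> 0" and B: "B \<ge> 0"
    and nbhd: "\<And>x a. norm (x - x0) < r \<Longrightarrow> norm (a - y0) \<le> \<rho> \<Longrightarrow> (x, a) \<in> \<Omega>"
    and N_lipschitz: "\<And>x a b h. norm (x - x0) < r \<Longrightarrow> norm (a - y0) \<le> \<rho> \<Longrightarrow> norm (b - y0) \<le> \<rho> \<Longrightarrow>
      norm (N (x, a) h - N (x, b) h) \<le> L * norm h * norm (a - b)"
    and N_bound: "\<And>x a h. norm (x - x0) < r \<Longrightarrow> norm (a - y0) \<le> \<rho> \<Longrightarrow> norm (N (x, a) h) \<le> B * norm h"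
    and small_lipschitz: "r * (L + norm \<alpha>) \<le> 1 / 4"
    and small_bound: "r * (B + norm \<alpha> * (norm y0 + \<rho>)) \<le> \<rho> / 4"
begin

definition ray where "ray t x = x + t *\<^sub>R (x0 - x)"

text \<open>The velocity of a characteristic that starts at \<open>(x, y)\<close> and lies over the segment from \<open>x\<close> to \<open>x0\<close>.
  The function to be constructed is constant along it, so its value is the one at time \<open>1\<close>, over \<open>x0\<close>,
  where it is prescribed to be the product with \<open>\<alpha>\<close>.  Inserting
  this end value into the equation avoids solving an implicit equation for the Funk function.\<close>

definition rhs where
  "rhs t p = - (N (ray t (fst (fst p)), fst (snd p)) (x0 - fst (fst p))
      + (snd (snd p) \<bullet> \<alpha>) *\<^sub>R (x0 - fst (fst p)))"

text \<open>The domain of the Funk function, where \<open>snd q \<bullet> \<alpha>\<close> is the scale of \<open>q\<close>.  The radius \<open>\<rho> / 2\<close> leaves room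
  for the characteristics to move within the cone of radius \<open>\<rho>\<close>.\<close>

definition Q where
  "Q = {q. norm (fst q - x0) < r \<and> 0 < snd q \<bullet> \<alpha> \<and>
     norm (snd q - (snd q \<bullet> \<alpha>) *\<^sub>R y0) < (snd q \<bullet> \<alpha>) * (\<rho> / 2)}"

definition \<Omega>' where
  "\<Omega>' = {p :: ('e \<times> 'e) \<times> ('e \<times> 'e). norm (fst (fst p) - x0) < r \<and> 0 < snd (fst p) \<bullet> \<alpha> \<and>
     norm (fst (snd p) - (snd (fst p) \<bullet> \<alpha>) *\<^sub>R y0) < (snd (fst p) \<bullet> \<alpha>) * \<rho>}"

lemma open_Q: "open Q"
  unfolding Q_def by (intro open_Collect_conj open_Collect_less continuous_intros)

lemma open_\<Omega>': "open \<Omega>'"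
  unfolding \<Omega>'_def by (intro open_Collect_conj open_Collect_less continuous_intros)

lemma ray_in:
  assumes "norm (x - x0) < r" "t \<in> {0..1}"
  shows "norm (ray t x - x0) < r"
proof -
  have "ray t x - x0 = (1 - t) *\<^sub>R (x - x0)" by (simp add: ray_def algebra_simps)
  then have "norm (ray t x - x0) = (1 - t) * norm (x - x0)" using assms(2) by simp
  also have "\<dots> \<le> 1 * norm (x - x0)" using assms(2) by (intro mult_right_mono) auto
  finally show ?thesis using assms(1) by simp
qed

lemma unscale:
  assumes "s > 0" "norm (a - s *\<^sub>R y0) \<le> s * \<rho>"
  obtains a' where "a = s *\<^sub>R a'" "norm (a' - y0) \<le> \<rho>"
proof
  show "a = s *\<^sub>R ((1 / s) *\<^sub>R a)" using assms(1) by simp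
  have "(1 / s) *\<^sub>R a - y0 = (1 / s) *\<^sub>R (a - s *\<^sub>R y0)" using assms(1) by (simp add: scaleR_diff_right)
  then have "norm ((1 / s) *\<^sub>R a - y0) = norm (a - s *\<^sub>R y0) / s"
    using assms(1) by (simp add: divide_inverse_commute)
  then show "norm ((1 / s) *\<^sub>R a - y0) \<le> \<rho>"
    using assms by (simp add: pos_divide_le_eq mult.commute)
qed

lemma scaled_in_\<Omega>:
  assumes "norm (x - x0) < r" "s > 0" "norm (a - s *\<^sub>R y0) \<le> s * \<rho>"
  shows "(x, a) \<in> \<Omega>"
  using unscale[OF assms(2,3)] nbhd[OF assms(1)] cone assms(2) by metis

lemma scaled_N_lipschitz:
  assumes "norm (x - x0) < r" "s > 0" "norm (a - s *\<^sub>R y0) \<le> s * \<rho>" "norm (b - s *\<^sub>R y0) \<le> s * \<rho>"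
  shows "norm (N (x, a) h - N (x, b) h) \<le> L * norm h * norm (a - b)"
proof -
  obtain a' where a': "a = s *\<^sub>R a'" "norm (a' - y0) \<le> \<rho>" by (rule unscale[OF assms(2,3)])
  obtain b' where b': "b = s *\<^sub>R b'" "norm (b' - y0) \<le> \<rho>" by (rule unscale[OF assms(2,4)])
  have "N (x, a) h - N (x, b) h = s *\<^sub>R (N (x, a') h - N (x, b') h)"
    unfolding a'(1) b'(1) using N_homogeneous[OF nbhd[OF assms(1) a'(2)] assms(2)]
      N_homogeneous[OF nbhd[OF assms(1) b'(2)] assms(2)] by (simp add: scaleR_diff_right)
  then have "norm (N (x, a) h - N (x, b) h) = s * norm (N (x, a') h - N (x, b') h)"
    using assms(2) by simp
  also have "\<dots> \<le> s * (L * norm h * norm (a' - b'))"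
    using assms(2) by (intro mult_left_mono N_lipschitz assms(1) a' b') auto
  also have "\<dots> = L * norm h * norm (a - b)"
    unfolding a'(1) b'(1) using assms(2) by (simp add: scaleR_diff_right[symmetric])
  finally show ?thesis .
qed

lemma scaled_N_bound:
  assumes "norm (x - x0) < r" "s > 0" "norm (a - s *\<^sub>R y0) \<le> s * \<rho>"
  shows "norm (N (x, a) h) \<le> s * (B * norm h)"
proof -
  obtain a' where a': "a = s *\<^sub>R a'" "norm (a' - y0) \<le> \<rho>" by (rule unscale[OF assms(2,3)])
  have "norm (N (x, a) h) = s * norm (N (x, a') h)"
    unfolding a'(1) using N_homogeneous[OF nbhd[OF assms(1) a'(2)] assms(2)] assms(2) by simp
  also have "\<dots> \<le> s * (B * norm h)"
    using assms(2) by (intro mult_left_mono N_bound assms(1) a') auto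
  finally show ?thesis .
qed

lemma rhs_lipschitz:
  assumes t: "t \<in> {0..1}" and x: "norm (x - x0) < r" and s: "s > 0"
    and a: "norm (a - s *\<^sub>R y0) \<le> s * \<rho>" "norm (a' - s *\<^sub>R y0) \<le> s * \<rho>"
  shows "norm (rhs t ((x, y), (a, b)) - rhs t ((x, y'), (a', b'))) \<le> norm ((a, b) - (a', b')) / 4"
proof -
  let ?h = "x0 - x" and ?\<Delta> = "norm ((a, b) - (a', b'))"
  have h: "norm ?h \<le> r" using x by (simp add: norm_minus_commute)
  have \<Delta>: "norm (a - a') \<le> ?\<Delta>" "norm (b - b') \<le> ?\<Delta>"
    using norm_fst_le[of "a - a'" "b - b'"] norm_snd_le[of "b - b'" "a - a'"] by simp_all
  have "rhs t ((x, y), (a, b)) - rhs t ((x, y'), (a', b'))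
      = - ((N (ray t x, a) ?h - N (ray t x, a') ?h) + ((b - b') \<bullet> \<alpha>) *\<^sub>R ?h)"
    by (simp add: rhs_def inner_diff_left scaleR_diff_left)
  also have "norm \<dots> \<le> L * norm ?h * norm (a - a') + (norm (b - b') * norm \<alpha>) * norm ?h"
    unfolding norm_minus_cancel
  proof (rule norm_triangle_le[OF add_mono])
    show "norm (N (ray t x, a) ?h - N (ray t x, a') ?h) \<le> L * norm ?h * norm (a - a')"
      by (rule scaled_N_lipschitz[OF ray_in[OF x t] s a])
    show "norm (((b - b') \<bullet> \<alpha>) *\<^sub>R ?h) \<le> (norm (b - b') * norm \<alpha>) * norm ?h"
      using Cauchy_Schwarz_ineq2[of "b - b'" \<alpha>] by (simp add: mult_right_mono)
  qed
  also have "\<dots> \<le> L * r * ?\<Delta> + (?\<Delta> * norm \<alpha>) * r"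
    using L h \<Delta> r by (intro add_mono mult_mono mult_nonneg_nonneg) auto
  also have "\<dots> = (r * (L + norm \<alpha>)) * ?\<Delta>" by (simp add: algebra_simps)
  also have "\<dots> \<le> (1 / 4) * ?\<Delta>" by (intro mult_right_mono small_lipschitz) auto
  finally show ?thesis by simp
qed

lemma rhs_bound:
  assumes t: "t \<in> {0..1}" and x: "norm (x - x0) < r" and s: "s > 0"
    and a: "norm (a - s *\<^sub>R y0) \<le> s * \<rho>" and b: "norm (b - s *\<^sub>R y0) \<le> s * \<rho>"
  shows "norm (rhs t ((x, y), (a, b))) \<le> s * (\<rho> / 4)"
proof -
  let ?h = "x0 - x"
  have h: "norm ?h \<le> r" using x by (simp add: norm_minus_commute)
  have "norm b \<le> s * (norm y0 + \<rho>)"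
    using norm_triangle_ineq[of "b - s *\<^sub>R y0" "s *\<^sub>R y0"] b s by (simp add: algebra_simps)
  then have b': "\<bar>b \<bullet> \<alpha>\<bar> \<le> s * (norm y0 + \<rho>) * norm \<alpha>"
    using Cauchy_Schwarz_ineq2[of b \<alpha>] by (meson mult_right_mono norm_ge_zero order_trans)
  have "norm (rhs t ((x, y), (a, b))) \<le> s * (B * norm ?h) + (s * (norm y0 + \<rho>) * norm \<alpha>) * norm ?h"
    unfolding rhs_def norm_minus_cancel fst_conv snd_conv
  proof (rule norm_triangle_le[OF add_mono])
    show "norm (N (ray t x, a) ?h) \<le> s * (B * norm ?h)"
      by (rule scaled_N_bound[OF ray_in[OF x t] s a])
    show "norm ((b \<bullet> \<alpha>) *\<^sub>R ?h) \<le> (s * (norm y0 + \<rho>) * norm \<alpha>) * norm ?h"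
      using b' by (simp add: mult_right_mono)
  qed
  also have "\<dots> = s * (norm ?h * (B + norm \<alpha> * (norm y0 + \<rho>)))" by (simp add: algebra_simps)
  also have "\<dots> \<le> s * (r * (B + norm \<alpha> * (norm y0 + \<rho>)))"
    using s h B \<rho> by (intro mult_left_mono mult_right_mono add_nonneg_nonneg mult_nonneg_nonneg) auto
  also have "\<dots> \<le> s * (\<rho> / 4)" using s by (intro mult_left_mono small_bound) auto
  finally show ?thesis .
qed

lemma \<Omega>'_ray: "p \<in> \<Omega>' \<Longrightarrow> t \<in> {0..1} \<Longrightarrow> (ray t (fst (fst p)), fst (snd p)) \<in> \<Omega>"
  unfolding \<Omega>'_def by (auto intro!: scaled_in_\<Omega>[OF ray_in])

lemma Ck_family_rhs: "Ck_family n {0..1} \<Omega>' rhs"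
proof -
  note o = open_\<Omega>'
  have lin: "bounded_linear (\<lambda>p :: ('e \<times> 'e) \<times> ('e \<times> 'e). fst (fst p))"
    "bounded_linear (\<lambda>p :: ('e \<times> 'e) \<times> ('e \<times> 'e). fst (snd p))"
    "bounded_linear (\<lambda>p :: ('e \<times> 'e) \<times> ('e \<times> 'e). snd (snd p) \<bullet> \<alpha>)"
    by (intro bounded_linear_fst_comp bounded_linear_snd_comp bounded_linear_fst bounded_linear_snd
        bounded_linear_inner_left_comp)+
  note l = Ck_family_linear_ident[OF o lin(1)] Ck_family_linear_ident[OF o lin(2)] Ck_family_linear_ident[OF o lin(3)]
  have h: "Ck_family n {0..1} \<Omega>' (\<lambda>t p. x0 - fst (fst p))"
  proof -
    have "Ck_family n {0..1} \<Omega>' (\<lambda>t p. x0 + - 1 *\<^sub>R fst (fst p))"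
      by (intro Ck_family_add[OF o] Ck_family_time[OF o] continuous_on_const
          Ck_family_bounded_linear[OF o bounded_linear_scaleR_right] l)
    then show ?thesis by simp
  qed
  have "Ck_family n {0..1} \<Omega>' (\<lambda>t p. fst (fst p) + t *\<^sub>R (x0 - fst (fst p)))"
    by (intro Ck_family_add[OF o] Ck_family_bilinear[OF o bounded_bilinear_scaleR] l h
        Ck_family_time[OF o] continuous_on_id)
  then have z: "Ck_family n {0..1} \<Omega>' (\<lambda>t p. (ray t (fst (fst p)), fst (snd p)))"
    unfolding ray_def by (intro Ck_family_Pair[OF o] l)
  have "Ck_family n {0..1} \<Omega>' (\<lambda>t p. N (ray t (fst (fst p)), fst (snd p)) (x0 - fst (fst p)))"
  proof (rule Ck_family_apply[OF o _ _ h, where L = "\<lambda>t p. N (ray t (fst (fst p)), fst (snd p))"])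
    show "Ck_family n {0..1} \<Omega>' (\<lambda>t p. N (ray t (fst (fst p)), fst (snd p)) w)" for w
      by (rule Ck_family_compose[OF o Ck_family_of_times_differentiable_on[OF times_differentiable_N[of n w]] z])
        (rule \<Omega>'_ray)
    show "linear (N (ray t (fst (fst p)), fst (snd p)))" if "t \<in> {0..1}" "p \<in> \<Omega>'" for t p
      by (rule linear_N[OF \<Omega>'_ray[OF that(2,1)]])
  qed
  then have "Ck_family n {0..1} \<Omega>' (\<lambda>t p. - 1 *\<^sub>R (N (ray t (fst (fst p)), fst (snd p)) (x0 - fst (fst p))
      + (snd (snd p) \<bullet> \<alpha>) *\<^sub>R (x0 - fst (fst p))))"
    by (intro Ck_family_bounded_linear[OF o bounded_linear_scaleR_right] Ck_family_add[OF o]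
        Ck_family_bilinear[OF o bounded_bilinear_scaleR] l h)
  moreover have "(\<lambda>t p. - 1 *\<^sub>R (N (ray t (fst (fst p)), fst (snd p)) (x0 - fst (fst p))
      + (snd (snd p) \<bullet> \<alpha>) *\<^sub>R (x0 - fst (fst p)))) = rhs"
    by (simp add: rhs_def fun_eq_iff)
  ultimately show ?thesis by (rule back_subst)
qed

lemma quarter_lipschitz_rhs: "quarter_lipschitz \<Omega>' rhs"
  unfolding quarter_lipschitz_def
proof (intro ballI allI impI)
  fix t :: real and q :: "'e \<times> 'e" and u u' :: "'e \<times> 'e"
  assume *: "t \<in> {0..1}" "(q, u) \<in> \<Omega>'" "(q, u') \<in> \<Omega>'"
  obtain x y a b a' b' where e: "q = (x, y)" "u = (a, b)" "u' = (a', b')"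
    by (metis surj_pair)
  show "norm (rhs t (q, u) - rhs t (q, u')) \<le> norm (u - u') / 4"
    unfolding e by (rule rhs_lipschitz[OF *(1), of _ "y \<bullet> \<alpha>"]) (use * in \<open>auto simp: \<Omega>'_def e\<close>)
qed

text \<open>Projecting the state to the cone of radius \<open>3 \<rho> / 4\<close> makes the right-hand side globally Lipschitz.  The
  solution moves by at most \<open>\<rho> / 4\<close> times the scale, hence stays where the projection
  is the identity.\<close>

lemma solution_exists:
  "\<exists>Y. solves Q rhs (\<lambda>t. snd) Y \<and> (\<forall>t\<in>{0..1}. \<forall>q\<in>Q. curve Y t q \<in> \<Omega>' \<and> (q, (Y t q, Y t q)) \<in> \<Omega>')"
proof -
  define \<rho>' where "\<rho>' = 3 / 4 * \<rho>"
  have \<rho>': "\<rho>' > 0" "\<rho>' < \<rho>" using \<rho> by (auto simp: \<rho>'_def)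
  define pr where "pr q a = cone_proj y0 \<rho>' (snd q \<bullet> \<alpha>) a" for q :: "'e \<times> 'e" and a
  define f where "f t p = rhs t (fst p, (pr (fst p) (fst (snd p)), pr (fst p) (snd (snd p))))" for t p
  have Q_pos: "snd q \<bullet> \<alpha> > 0" "norm (fst q - x0) < r" if "q \<in> Q" for q using that by (auto simp: Q_def)
  have pr_in: "norm (pr q a - (snd q \<bullet> \<alpha>) *\<^sub>R y0) \<le> (snd q \<bullet> \<alpha>) * \<rho>'" if "q \<in> Q" for q a
    unfolding pr_def by (rule cone_proj_in[OF \<rho>'(1) Q_pos(1)[OF that]])
  have lt: "(snd q \<bullet> \<alpha>) * \<rho>' < (snd q \<bullet> \<alpha>) * \<rho>" if "q \<in> Q" for q
    using Q_pos(1)[OF that] \<rho>'(2) by simp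
  have pr_in': "norm (pr q a - (snd q \<bullet> \<alpha>) *\<^sub>R y0) \<le> (snd q \<bullet> \<alpha>) * \<rho>" if "q \<in> Q" for q a
    using pr_in[OF that, of a] lt[OF that] by simp
  have "\<exists>Y. solves Q f (\<lambda>t. snd) Y"
  proof (rule integral_equation_solution)
    have "continuous_on ({0..1} \<times> (Q \<times> UNIV)) (\<lambda>(t, p). rhs t (fst p, (pr (fst p) (fst (snd p)), pr (fst p) (snd (snd p)))))"
    proof (rule continuous_on_family_compose[OF Ck_family_continuous[OF Ck_family_rhs[of 0]]])
      have "continuous_on ({0..1 :: real} \<times> (Q \<times> (UNIV :: ('e \<times> 'e) set)))
          (\<lambda>x. (fst (snd x), (pr (fst (snd x)) (fst (snd (snd x))), pr (fst (snd x)) (snd (snd (snd x))))))"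
        unfolding pr_def
        by (intro continuous_on_Pair continuous_on_cone_proj[OF \<rho>'(1)] continuous_on_fst continuous_on_snd
            continuous_on_id continuous_on_inner continuous_on_const) (use Q_pos in force)+
      then show "continuous_on ({0..1 :: real} \<times> (Q \<times> UNIV))
          (\<lambda>(t, p). (fst p, (pr (fst p) (fst (snd p)), pr (fst p) (snd (snd p)))))"
        by (simp add: case_prod_beta)
      show "(fst p, (pr (fst p) (fst (snd p)), pr (fst p) (snd (snd p)))) \<in> \<Omega>'"
        if "p \<in> Q \<times> UNIV" for p
      proof -
        have "fst p \<in> Q" using that by auto
        from Q_pos[OF this] le_less_trans[OF pr_in[OF this, of "fst (snd p)"] lt[OF this]] show ?thesis
          by (simp add: \<Omega>'_def)
      qed
    qed
    then show "continuous_on ({0..1} \<times> Q \<times> UNIV) (\<lambda>(t, p). f t p)" by (simp add: f_def)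
    show "quarter_lipschitz (Q \<times> UNIV) f"
      unfolding quarter_lipschitz_def
    proof (intro ballI allI impI)
      fix t :: real and q and u u' :: "'e \<times> 'e" assume *: "t \<in> {0..1}" "(q, u) \<in> Q \<times> (UNIV :: ('e \<times> 'e) set)"
      then have q: "q \<in> Q" by auto
      obtain x y a b a' b' where e: "q = (x, y)" "u = (a, b)" "u' = (a', b')"
        by (metis surj_pair)
      have "norm (f t (q, u) - f t (q, u')) \<le> norm ((pr q a, pr q b) - (pr q a', pr q b')) / 4"
        unfolding f_def e fst_conv snd_conv
        by (rule rhs_lipschitz[OF *(1), of _ "y \<bullet> \<alpha>"])
          (use Q_pos[OF q] pr_in'[OF q] in \<open>auto simp: e\<close>)
      also have "norm ((pr q a, pr q b) - (pr q a', pr q b')) \<le> norm (u - u')"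
        unfolding e diff_Pair norm_Pair pr_def
        by (intro real_sqrt_le_mono add_mono power_mono norm_ge_zero
            cone_proj_nonexpansive[OF \<rho>'(1) Q_pos(1)[OF q, unfolded e]])
      finally show "norm (f t (q, u) - f t (q, u')) \<le> norm (u - u') / 4" by simp
    qed
    show "continuous_on ({0..1 :: real} \<times> Q) (\<lambda>(t, q). snd q)"
      by (simp add: case_prod_beta continuous_on_snd continuous_on_id)
  qed
  then obtain Y where Y: "solves Q f (\<lambda>t. snd) Y" by blast
  have near: "norm (Y t q - (snd q \<bullet> \<alpha>) *\<^sub>R y0) \<le> (snd q \<bullet> \<alpha>) * \<rho>'" if t: "t \<in> {0..1}" and q: "q \<in> Q" for t q
  proof -
    have eq: "Y t q = snd q + integral {0..t} (\<lambda>\<tau>. f \<tau> (q, (Y \<tau> q, Y 1 q)))"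
      using Y t q unfolding solves_def by blast
    have bd: "norm (f \<tau> (q, u)) \<le> (snd q \<bullet> \<alpha>) * (\<rho> / 4)" if "\<tau> \<in> {0..1}" for \<tau> u
    proof -
      have "norm (rhs \<tau> ((fst q, snd q), (pr q (fst u), pr q (snd u)))) \<le> (snd q \<bullet> \<alpha>) * (\<rho> / 4)"
        by (rule rhs_bound[OF that Q_pos(2,1)[OF q] pr_in'[OF q] pr_in'[OF q]])
      then show ?thesis by (simp add: f_def)
    qed
    have Bnn: "(snd q \<bullet> \<alpha>) * (\<rho> / 4) \<ge> 0" using Q_pos[OF q] \<rho> by simp
    have "norm (integral {0..t} (\<lambda>\<tau>. f \<tau> (q, (Y \<tau> q, Y 1 q)))) \<le> (snd q \<bullet> \<alpha>) * (\<rho> / 4)"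
    proof (cases "(\<lambda>\<tau>. f \<tau> (q, (Y \<tau> q, Y 1 q))) integrable_on {0..t}")
      case True
      have "norm (integral {0..t} (\<lambda>\<tau>. f \<tau> (q, (Y \<tau> q, Y 1 q)))) \<le> (snd q \<bullet> \<alpha>) * (\<rho> / 4) * measure lebesgue (cbox 0 t)"
        using has_integral_bound[OF Bnn, of "\<lambda>\<tau>. f \<tau> (q, (Y \<tau> q, Y 1 q))" _ 0 t] True bd t
        by (auto simp: integrable_integral)
      also have "\<dots> \<le> (snd q \<bullet> \<alpha>) * (\<rho> / 4) * 1" using t Bnn by (intro mult_left_mono) auto
      finally show ?thesis by simp
    next
      case False
      then show ?thesis using Bnn by (simp add: not_integrable_integral)
    qed
    moreover have "norm (snd q - (snd q \<bullet> \<alpha>) *\<^sub>R y0) \<le> (snd q \<bullet> \<alpha>) * (\<rho> / 2)"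
      using q by (simp add: Q_def)
    ultimately have "norm ((snd q - (snd q \<bullet> \<alpha>) *\<^sub>R y0) + integral {0..t} (\<lambda>\<tau>. f \<tau> (q, (Y \<tau> q, Y 1 q))))
        \<le> (snd q \<bullet> \<alpha>) * (\<rho> / 2) + (snd q \<bullet> \<alpha>) * (\<rho> / 4)"
      by (intro norm_triangle_le add_mono)
    also have "\<dots> = (snd q \<bullet> \<alpha>) * \<rho>'" by (simp add: \<rho>'_def)
    also have "(snd q - (snd q \<bullet> \<alpha>) *\<^sub>R y0) + integral {0..t} (\<lambda>\<tau>. f \<tau> (q, (Y \<tau> q, Y 1 q))) = Y t q - (snd q \<bullet> \<alpha>) *\<^sub>R y0"
      by (subst eq) simp
    finally show ?thesis .
  qed
  have pr_Y: "pr q (Y t q) = Y t q" if "t \<in> {0..1}" "q \<in> Q" for t q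
    unfolding pr_def by (rule cone_proj_self[OF \<rho>'(1) Q_pos(1)[OF that(2)] near[OF that]])
  have "solves Q rhs (\<lambda>t. snd) Y"
    unfolding solves_def
  proof (intro conjI ballI)
    show "continuous_on ({0..1} \<times> Q) (\<lambda>(t, q). Y t q)" using Y by (simp add: solves_def)
    fix q t assume q: "q \<in> Q" and t: "t \<in> {0..1::real}"
    have "Y t q = snd q + integral {0..t} (\<lambda>\<tau>. f \<tau> (q, (Y \<tau> q, Y 1 q)))"
      using Y t q unfolding solves_def by blast
    also have "integral {0..t} (\<lambda>\<tau>. f \<tau> (q, (Y \<tau> q, Y 1 q))) = integral {0..t} (\<lambda>\<tau>. rhs \<tau> (q, (Y \<tau> q, Y 1 q)))"
      by (rule Henstock_Kurzweil_Integration.integral_cong) (use t q in \<open>simp add: f_def pr_Y\<close>)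
    finally show "Y t q = snd q + integral {0..t} (\<lambda>\<tau>. rhs \<tau> (q, (Y \<tau> q, Y 1 q)))" .
  qed
  moreover have "(q, (Y t q, b)) \<in> \<Omega>'" if "t \<in> {0..1}" "q \<in> Q" for t q b
    using le_less_trans[OF near[OF that] lt[OF that(2)]] Q_pos[OF that(2)] by (simp add: \<Omega>'_def)
  ultimately show ?thesis by (intro exI[of _ Y]) (auto simp: curve_def)
qed

end

section \<open>The Funk function in a chart\<close>

context flat_spray_near_point
begin

lemma rhs_has_derivative:
  assumes t: "t \<in> {0..1}" and p: "((x, y), (a, b)) \<in> \<Omega>'"
  shows "(rhs t has_derivative (\<lambda>d. - (D (\<lambda>z. N z (x0 - x)) (ray t x, a)
        ((1 - t) *\<^sub>R fst (fst d), fst (snd d)) + N (ray t x, a) (- fst (fst d))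
      + ((b \<bullet> \<alpha>) *\<^sub>R (- fst (fst d)) + (snd (snd d) \<bullet> \<alpha>) *\<^sub>R (x0 - x))))) (at ((x, y), (a, b)))"
proof -
  let ?p = "((x, y), (a, b))"
  have in\<Omega>: "(ray t x, a) \<in> \<Omega>" using \<Omega>'_ray[OF p t] by simp
  have c: "((\<lambda>p :: ('e \<times> 'e) \<times> ('e \<times> 'e). (ray t (fst (fst p)), fst (snd p))) has_derivative
      (\<lambda>d. ((1 - t) *\<^sub>R fst (fst d), fst (snd d)))) (at ?p)"
    unfolding ray_def by (auto intro!: derivative_eq_intros simp: algebra_simps)
  have h: "((\<lambda>p :: ('e \<times> 'e) \<times> ('e \<times> 'e). x0 - fst (fst p)) has_derivative (\<lambda>d. - fst (fst d))) (at ?p)"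
    by (auto intro!: derivative_eq_intros)
  have b: "((\<lambda>p :: ('e \<times> 'e) \<times> ('e \<times> 'e). snd (snd p) \<bullet> \<alpha>) has_derivative (\<lambda>d. snd (snd d) \<bullet> \<alpha>)) (at ?p)"
    by (auto intro!: derivative_eq_intros)
  have "((\<lambda>p. - (N (ray t (fst (fst p)), fst (snd p)) (x0 - fst (fst p))
      + (snd (snd p) \<bullet> \<alpha>) *\<^sub>R (x0 - fst (fst p)))) has_derivative
    (\<lambda>d. - (D (\<lambda>z. N z (x0 - x)) (ray t x, a)
        ((1 - t) *\<^sub>R fst (fst d), fst (snd d)) + N (ray t x, a) (- fst (fst d))
      + ((b \<bullet> \<alpha>) *\<^sub>R (- fst (fst d)) + (snd (snd d) \<bullet> \<alpha>) *\<^sub>R (x0 - x))))) (at ?p)"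
    using has_derivative_minus[OF has_derivative_add[OF N_comp_has_derivative[OF c h] has_derivative_scaleR[OF b h]]] in\<Omega>
    by simp
  then show ?thesis unfolding rhs_def .
qed

lemma Q_cone:
  assumes "(x, y) \<in> Q" "s > 0"
  shows "(x, s *\<^sub>R y) \<in> Q"
proof -
  have "s *\<^sub>R y - ((s *\<^sub>R y) \<bullet> \<alpha>) *\<^sub>R y0 = s *\<^sub>R (y - (y \<bullet> \<alpha>) *\<^sub>R y0)" by (simp add: scaleR_diff_right)
  then have "norm (s *\<^sub>R y - ((s *\<^sub>R y) \<bullet> \<alpha>) *\<^sub>R y0) = s * norm (y - (y \<bullet> \<alpha>) *\<^sub>R y0)"
    using assms(2) by simp
  also have "\<dots> < s * ((y \<bullet> \<alpha>) * (\<rho> / 2))"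
    using assms by (intro mult_strict_left_mono) (auto simp: Q_def)
  finally show ?thesis using assms by (simp add: Q_def mult.assoc)
qed

lemma Q_subset: "Q \<subseteq> \<Omega>"
proof
  fix q assume q: "q \<in> Q"
  have "(snd q \<bullet> \<alpha>) * (\<rho> / 2) \<le> (snd q \<bullet> \<alpha>) * \<rho>"
    using q \<rho> by (intro mult_left_mono) (auto simp: Q_def)
  moreover have "norm (snd q - (snd q \<bullet> \<alpha>) *\<^sub>R y0) < (snd q \<bullet> \<alpha>) * (\<rho> / 2)"
    using q by (simp add: Q_def)
  ultimately have "norm (snd q - (snd q \<bullet> \<alpha>) *\<^sub>R y0) \<le> (snd q \<bullet> \<alpha>) * \<rho>" by linarith
  then have "(fst q, snd q) \<in> \<Omega>"
    using q by (intro scaled_in_\<Omega>[of _ "snd q \<bullet> \<alpha>"]) (auto simp: Q_def)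
  then show "q \<in> \<Omega>" by simp
qed

lemma base_point_in_Q: "(x0, y0) \<in> Q"
  using r \<rho> \<alpha> by (simp add: Q_def)

text \<open>The function is \<open>P q = Y 1 q \<bullet> \<alpha>\<close> for the family \<open>Y\<close> of characteristics.  Scaling a characteristic
  gives a solution with scaled initial value, so uniqueness makes \<open>P\<close> homogeneous.  For the Funk
  equation, let \<open>W t k\<close> be the vertical part of the lift of \<open>k\<close> at time \<open>t\<close>.  Because the
  distribution of these lifts is integrable, \<open>(1 - t) W t k\<close> solves the equation of
  characteristics linearised in the direction \<open>(k, W 0 k)\<close>; it is therefore the derivative of \<open>Y t\<close> in that
  direction, and at \<open>t = 1\<close> it vanishes.\<close>

theorem funk_function_on_Q:
  "\<exists>P. smooth_on Q P \<and> (\<forall>x y s. (x, y) \<in> Q \<longrightarrow> s > 0 \<longrightarrow> P (x, s *\<^sub>R y) = s * P (x, y)) \<and>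
    (\<forall>z\<in>Q. \<forall>k. D P z (k, - (N z k + P z *\<^sub>R k)) = 0) \<and> P (x0, y0) = 1"
proof -
  obtain Y where Y: "solves Q rhs (\<lambda>t. snd) Y"
    "\<And>t q. t \<in> {0..1} \<Longrightarrow> q \<in> Q \<Longrightarrow> curve Y t q \<in> \<Omega>'"
    using solution_exists by blast
  interpret IE: integral_equation Q \<Omega>' rhs "\<lambda>t. snd" Y
    by unfold_locales (intro open_Q open_\<Omega>' quarter_lipschitz_rhs Y; assumption)+
  have \<beta>: "Ck_family n {0..1} Q (\<lambda>t. snd)" for n
    by (rule Ck_family_linear_ident[OF open_Q bounded_linear_snd])
  have Ck: "Ck_family n {0..1} Q Y" for n
    by (rule solves_imp_Ck_family[OF IE.integral_equation_axioms Ck_family_rhs \<beta>])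
  have Y_eq: "Y t q = snd q + integral {0..t} (\<lambda>\<tau>. rhs \<tau> (curve Y \<tau> q))" if "t \<in> {0..1}" "q \<in> Q" for t q
    using Y(1) that unfolding solves_def curve_def by blast
  have Y_0: "Y 0 q = snd q" if "q \<in> Q" for q using Y_eq[of 0 q] that by simp
  have cY: "continuous_on {0..1} (\<lambda>t. Y t q)" if "q \<in> Q" for q
    by (rule Ck_family_continuous_time[OF Ck[of 0] that])
  have c_rhs: "continuous_on {0..1} (\<lambda>t. rhs t (curve Y t q))" if "q \<in> Q" for q
  proof -
    have "Ck_family 0 {0..1} Q (\<lambda>t q. rhs t (curve Y t q))"
      by (rule Ck_family_compose[OF open_Q Ck_family_rhs IE.Ck_family_curve[OF Ck] Y(2)])
    from Ck_family_continuous_time[OF this that] show ?thesis .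
  qed
  define P where "P q = Y 1 q \<bullet> \<alpha>" for q
  have "smooth_on Q (\<lambda>q. Y 1 q \<bullet> \<alpha>)"
  proof (rule smooth_on_of_Ck_family[where T = "{0..1}" and t = 1 and g = "\<lambda>t q. Y t q \<bullet> \<alpha>"])
    show "Ck_family n {0..1} Q (\<lambda>t q. Y t q \<bullet> \<alpha>)" for n
      by (rule Ck_family_bounded_linear[OF open_Q bounded_linear_inner_left Ck])
  qed simp
  then have smooth: "smooth_on Q P" by (simp add: P_def[abs_def])

  have homog: "P (x, s *\<^sub>R y) = s * P (x, y)" if q: "(x, y) \<in> Q" and s: "s > 0" for x y s
  proof -
    let ?q = "(x, y)" and ?q' = "(x, s *\<^sub>R y)"
    have q': "?q' \<in> Q" by (rule Q_cone[OF q s])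
    have scale: "rhs \<tau> (?q', (s *\<^sub>R Y \<tau> ?q, s *\<^sub>R Y 1 ?q)) = s *\<^sub>R rhs \<tau> (curve Y \<tau> ?q)" if \<tau>: "\<tau> \<in> {0..1}" for \<tau>
    proof -
      have "(ray \<tau> x, Y \<tau> ?q) \<in> \<Omega>" using \<Omega>'_ray[OF Y(2)[OF \<tau> q] \<tau>] by (simp add: curve_def)
      from N_homogeneous[OF this s] show ?thesis
        by (simp add: rhs_def curve_def algebra_simps)
    qed
    have Yq': "Y 1 ?q' = s *\<^sub>R Y 1 ?q"
    proof (rule integral_equation_unique[where F = "\<lambda>\<tau> u. rhs \<tau> (?q', u)" and b = "\<lambda>_. s *\<^sub>R y"
          and ?y1.0 = "\<lambda>t. Y t ?q'" and ?y2.0 = "\<lambda>t. s *\<^sub>R Y t ?q"])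
      show "continuous_on {0..1} (\<lambda>t. Y t ?q')" by (rule cY[OF q'])
      show "continuous_on {0..1} (\<lambda>t. s *\<^sub>R Y t ?q)" by (intro continuous_on_scaleR continuous_on_const cY[OF q])
      show "continuous_on {0..1} (\<lambda>\<tau>. rhs \<tau> (?q', (Y \<tau> ?q', Y 1 ?q')))"
        using c_rhs[OF q'] by (simp add: curve_def)
      have "continuous_on {0..1} (\<lambda>\<tau>. s *\<^sub>R rhs \<tau> (curve Y \<tau> ?q))"
        by (intro continuous_on_scaleR continuous_on_const c_rhs[OF q])
      then show "continuous_on {0..1} (\<lambda>\<tau>. rhs \<tau> (?q', (s *\<^sub>R Y \<tau> ?q, s *\<^sub>R Y 1 ?q)))"
        by (rule continuous_on_eq) (rule scale[symmetric])
      fix t :: real assume t: "t \<in> {0..1}"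
      show "Y t ?q' = s *\<^sub>R y + integral {0..t} (\<lambda>\<tau>. rhs \<tau> (?q', (Y \<tau> ?q', Y 1 ?q')))"
        using Y_eq[OF t q'] unfolding curve_def by simp
      have "s *\<^sub>R Y t ?q = s *\<^sub>R y + integral {0..t} (\<lambda>\<tau>. s *\<^sub>R rhs \<tau> (curve Y \<tau> ?q))"
        unfolding Y_eq[OF t q] by (simp add: scaleR_add_right)
      also have "integral {0..t} (\<lambda>\<tau>. s *\<^sub>R rhs \<tau> (curve Y \<tau> ?q))
          = integral {0..t} (\<lambda>\<tau>. rhs \<tau> (?q', (s *\<^sub>R Y \<tau> ?q, s *\<^sub>R Y 1 ?q)))"
        by (rule Henstock_Kurzweil_Integration.integral_cong) (use t in \<open>simp add: scale\<close>)
      finally show "s *\<^sub>R Y t ?q = s *\<^sub>R y + integral {0..t} (\<lambda>\<tau>. rhs \<tau> (?q', (s *\<^sub>R Y \<tau> ?q, s *\<^sub>R Y 1 ?q)))" .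
      have 1: "(?q', (Y t ?q', Y 1 ?q')) \<in> \<Omega>'" using Y(2)[OF t q'] by (simp add: curve_def)
      have "s *\<^sub>R Y t ?q - ((s *\<^sub>R y) \<bullet> \<alpha>) *\<^sub>R y0 = s *\<^sub>R (Y t ?q - (y \<bullet> \<alpha>) *\<^sub>R y0)" by (simp add: scaleR_diff_right)
      then have "norm (s *\<^sub>R Y t ?q - ((s *\<^sub>R y) \<bullet> \<alpha>) *\<^sub>R y0) = s * norm (Y t ?q - (y \<bullet> \<alpha>) *\<^sub>R y0)"
        using s by simp
      also have "\<dots> < s * ((y \<bullet> \<alpha>) * \<rho>)"
        using s Y(2)[OF t q] by (intro mult_strict_left_mono) (auto simp: curve_def \<Omega>'_def)
      finally have "(?q', (s *\<^sub>R Y t ?q, s *\<^sub>R Y 1 ?q)) \<in> \<Omega>'"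
        using s Y(2)[OF t q] by (simp add: curve_def \<Omega>'_def mult.assoc)
      with 1 show "norm (rhs t (?q', (Y t ?q', Y 1 ?q')) - rhs t (?q', (s *\<^sub>R Y t ?q, s *\<^sub>R Y 1 ?q)))
          \<le> norm ((Y t ?q', Y 1 ?q') - (s *\<^sub>R Y t ?q, s *\<^sub>R Y 1 ?q)) / 4"
        using quarter_lipschitz_rhs t unfolding quarter_lipschitz_def by blast
    qed simp
    show ?thesis by (simp add: P_def Yq')
  qed

  have Ck1: "Ck_family (Suc 0) {0..1} \<Omega>' rhs" "Ck_family (Suc 0) {0..1} Q (\<lambda>t. snd)"
    by (rule Ck_family_rhs \<beta>)+
  obtain z where z: "\<And>v. solves Q (linearized_rhs rhs Y) (linearized_source rhs (\<lambda>t. snd) Y v) (z v)"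
    "\<And>t q. t \<in> {0..1} \<Longrightarrow> q \<in> Q \<Longrightarrow> (Y t has_derivative (\<lambda>v. z v t q)) (at q)"
    using IE.solution_has_derivative[OF Ck1] by blast

  have funk: "D P q (k, - (N q k + P q *\<^sub>R k)) = 0" if q: "q \<in> Q" for q k
  proof -
    define x y h s where "x = fst q" and "y = snd q" and "h = x0 - x" and "s = P q"
    have q_eq: "q = (x, y)" by (simp add: x_def y_def)
    define c where "c t = (ray t x, Y t q)" for t
    have c_in: "c t \<in> \<Omega>" if "t \<in> {0..1}" for t
      using \<Omega>'_ray[OF Y(2)[OF that q] that] by (simp add: curve_def c_def x_def)
    have c_0: "c 0 = q" using Y_0[OF q] by (simp add: c_def ray_def q_eq)
    define W where "W t k = - (N (c t) k + s *\<^sub>R k)" for t k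
    \<comment> \<open>The expected derivative of the characteristics in the direction \<open>(k, W 0 k)\<close>.\<close>
    define \<zeta> where "\<zeta> t = (1 - t) *\<^sub>R W t k" for t
    define v where "v = (k, W 0 k)"
    let ?DN = "\<lambda>w t. D (\<lambda>z. N z w) (c t)"
    have lDN: "linear (?DN w t)" if "t \<in> {0..1}" for w t
      by (rule has_derivative_linear[OF N_has_derivative[OF c_in[OF that]]])
    have rhs_W: "rhs t (curve Y t q) = W t h" for t
      by (simp add: rhs_def curve_def W_def c_def h_def x_def s_def P_def)
    \<comment> \<open>Adding \<open>s k\<close> to the connection preserves integrability, as fibre derivatives of \<open>N\<close> are symmetric.\<close>
    have flat_W: "?DN h t (k, W t k) = ?DN k t (h, W t h)" if t: "t \<in> {0..1}" for t
    proof -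
      have split: "?DN w t (u, W t u) = ?DN w t (u, - N (c t) u) - s *\<^sub>R ?DN w t (0, u)" for w u
        using linear_diff[OF lDN[OF t], of w "(u, - N (c t) u)" "s *\<^sub>R (0, u)"]
          linear_scale[OF lDN[OF t], of w s "(0, u)"] by (simp add: W_def)
      show ?thesis
        unfolding split horizontal_integrability[OF c_in[OF t], of h k] DN_symmetric[OF c_in[OF t], of h k] ..
    qed
    have deriv_\<zeta>: "(\<zeta> has_vector_derivative - W t k - (1 - t) *\<^sub>R ?DN k t (h, W t h)) (at t within {0..1})"
      if t: "t \<in> {0..1}" for t
    proof -
      have "((\<lambda>t. snd q + integral {0..t} (\<lambda>\<tau>. rhs \<tau> (curve Y \<tau> q))) has_vector_derivative rhs t (curve Y t q)) (at t within {0..1})"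
        using integral_has_vector_derivative[OF c_rhs[OF q] t] by (auto intro!: derivative_eq_intros)
      then have "((\<lambda>t. Y t q) has_vector_derivative W t h) (at t within {0..1})"
        unfolding rhs_W[symmetric]
        by (rule has_vector_derivative_transform[OF t, rotated]) (rule Y_eq[OF _ q])
      then have Y': "((\<lambda>t. Y t q) has_derivative (\<lambda>d. d *\<^sub>R W t h)) (at t within {0..1})"
        by (simp add: has_vector_derivative_def)
      have "((\<lambda>t. ray t x) has_derivative (\<lambda>d. d *\<^sub>R h)) (at t within {0..1})"
        unfolding ray_def h_def by (auto intro!: derivative_eq_intros)
      from has_derivative_Pair[OF this Y']
      have "(c has_derivative (\<lambda>d. d *\<^sub>R (h, W t h))) (at t within {0..1})"
        by (simp add: c_def[abs_def])
      from N_comp_has_derivative[OF this has_derivative_const c_in[OF t], of k]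
      have "((\<lambda>t. N (c t) k) has_derivative (\<lambda>d. d *\<^sub>R ?DN k t (h, W t h))) (at t within {0..1})"
        by (simp add: linear_scale[OF lDN[OF t]] linear_0[OF linear_N[OF c_in[OF t]]] del: scaleR_Pair)
      then have "((\<lambda>t. - (N (c t) k + s *\<^sub>R k)) has_derivative (\<lambda>d. - (d *\<^sub>R ?DN k t (h, W t h)))) (at t within {0..1})"
        by (auto intro!: derivative_eq_intros)
      then have "((\<lambda>t. W t k) has_vector_derivative - ?DN k t (h, W t h)) (at t within {0..1})"
        by (simp add: W_def[abs_def] has_vector_derivative_def)
      then show ?thesis
        unfolding \<zeta>_def by (auto intro!: derivative_eq_intros simp: algebra_simps)
    qed
    have A: "D (rhs t) (curve Y t q) (v, (\<zeta> t, 0)) = - W t k - (1 - t) *\<^sub>R ?DN k t (h, W t h)"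
      if t: "t \<in> {0..1}" for t
    proof -
      have p: "((x, y), (Y t q, Y 1 q)) \<in> \<Omega>'" using Y(2)[OF t q] by (simp add: curve_def q_eq)
      have "curve Y t q = ((x, y), (Y t q, Y 1 q))" by (simp add: curve_def q_eq)
      then have "D (rhs t) (curve Y t q) (v, (\<zeta> t, 0))
          = - (?DN h t ((1 - t) *\<^sub>R k, \<zeta> t) + N (c t) (- k) + s *\<^sub>R (- k))"
        using fun_cong[OF frechet_derivative_at[OF rhs_has_derivative[OF t p]], of "(v, (\<zeta> t, 0))"]
        by (simp add: v_def c_def h_def s_def P_def)
      also have "((1 - t) *\<^sub>R k, \<zeta> t) = (1 - t) *\<^sub>R (k, W t k)" by (simp add: \<zeta>_def)
      also have "?DN h t ((1 - t) *\<^sub>R (k, W t k)) = (1 - t) *\<^sub>R ?DN h t (k, W t k)"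
        by (rule linear_scale[OF lDN[OF t]])
      also have "N (c t) (- k) = - N (c t) k" by (rule linear_neg[OF linear_N[OF c_in[OF t]]])
      finally show ?thesis unfolding flat_W[OF t] by (simp add: W_def)
    qed
    have \<zeta>_1: "\<zeta> 1 = 0" by (simp add: \<zeta>_def)
    have c\<zeta>: "continuous_on {0..1} \<zeta>"
      unfolding continuous_on_eq_continuous_within
      by (auto intro: has_vector_derivative_continuous deriv_\<zeta>)
    have c_lin: "continuous_on {0..1} (\<lambda>\<tau>. linearized_rhs rhs Y \<tau> (q, w \<tau>))" if "continuous_on {0..1} w" for w
    proof -
      have "continuous_on {0..1} (\<lambda>\<tau>. (\<lambda>(t, p). linearized_rhs rhs Y t p) (\<tau>, (q, w \<tau>)))"
        by (rule continuous_on_compose2[OF Ck_family_continuous[OF IE.Ck_family_linearized_rhs[OF Ck1(1) Ck]]])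
          (use q that in \<open>auto intro!: continuous_on_Pair continuous_on_id continuous_on_const\<close>)
      then show ?thesis by simp
    qed
    have lA: "linear (D (rhs t) (curve Y t q))" if "t \<in> {0..1}" for t
      by (rule IE.linear_derivative_along[OF Ck1(1) that q])
    \<comment> \<open>Both sides solve the same linearised equation.\<close>
    have z\<zeta>: "z v 1 q = \<zeta> 1"
    proof (rule integral_equation_unique[where F = "\<lambda>\<tau> u. linearized_rhs rhs Y \<tau> (q, u)"
          and b = "\<lambda>t. linearized_source rhs (\<lambda>t. snd) Y v t q" and ?y1.0 = "\<lambda>t. z v t q"])
      have cz: "continuous_on {0..1} (\<lambda>t. z v t q)"
        using z(1)[of v] q unfolding solves_def by (blast intro: continuous_on_family_slice)
      then show "continuous_on {0..1} (\<lambda>t. z v t q)" .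
      show "continuous_on {0..1} \<zeta>" by (rule c\<zeta>)
      show "continuous_on {0..1} (\<lambda>\<tau>. linearized_rhs rhs Y \<tau> (q, (z v \<tau> q, z v 1 q)))"
        by (intro c_lin continuous_on_Pair cz continuous_on_const)
      show "continuous_on {0..1} (\<lambda>\<tau>. linearized_rhs rhs Y \<tau> (q, (\<zeta> \<tau>, \<zeta> 1)))"
        by (intro c_lin continuous_on_Pair c\<zeta> continuous_on_const)
      fix t :: real assume t: "t \<in> {0..1}"
      show "z v t q = linearized_source rhs (\<lambda>t. snd) Y v t q + integral {0..t} (\<lambda>\<tau>. linearized_rhs rhs Y \<tau> (q, (z v \<tau> q, z v 1 q)))"
        using z(1)[of v] q t unfolding solves_def by blast
      have "((\<lambda>\<tau>. D (rhs \<tau>) (curve Y \<tau> q) (v, (\<zeta> \<tau>, 0))) has_integral (\<zeta> t - \<zeta> 0)) {0..t}"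
      proof (rule fundamental_theorem_of_calculus)
        fix \<tau> assume \<tau>: "\<tau> \<in> {0..t}"
        then have \<tau>': "\<tau> \<in> {0..1}" using t by auto
        show "(\<zeta> has_vector_derivative D (rhs \<tau>) (curve Y \<tau> q) (v, (\<zeta> \<tau>, 0))) (at \<tau> within {0..t})"
          unfolding A[OF \<tau>'] by (rule has_vector_derivative_within_subset[OF deriv_\<zeta>[OF \<tau>']]) (use t in auto)
      qed (use t in auto)
      then have "\<zeta> t - \<zeta> 0 = integral {0..t} (\<lambda>\<tau>. D (rhs \<tau>) (curve Y \<tau> q) (v, (\<zeta> \<tau>, 0)))"
        by (rule integral_unique[symmetric])
      also have "\<dots> = integral {0..t} (\<lambda>\<tau>. D (rhs \<tau>) (curve Y \<tau> q) (v, 0)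
          + linearized_rhs rhs Y \<tau> (q, (\<zeta> \<tau>, \<zeta> 1)))"
        by (rule Henstock_Kurzweil_Integration.integral_cong)
          (use t in \<open>auto simp: linearized_rhs_def \<zeta>_1 linear_add[OF lA, symmetric]\<close>)
      also have "\<dots> = integral {0..t} (\<lambda>\<tau>. D (rhs \<tau>) (curve Y \<tau> q) (v, 0))
          + integral {0..t} (\<lambda>\<tau>. linearized_rhs rhs Y \<tau> (q, (\<zeta> \<tau>, \<zeta> 1)))"
        by (intro Henstock_Kurzweil_Integration.integral_add integrable_on_initial[OF _ t] c_lin
            continuous_on_Pair c\<zeta> continuous_on_const
            Ck_family_continuous_time[OF IE.Ck_family_derivative_along[OF Ck1(1) Ck] q])
      finally have *: "\<zeta> t = \<zeta> 0 + (integral {0..t} (\<lambda>\<tau>. D (rhs \<tau>) (curve Y \<tau> q) (v, 0))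
          + integral {0..t} (\<lambda>\<tau>. linearized_rhs rhs Y \<tau> (q, (\<zeta> \<tau>, \<zeta> 1))))" by (simp add: algebra_simps)
      have "D snd q v = snd v"
        by (rule fun_cong[OF frechet_derivative_at[OF bounded_linear_imp_has_derivative[OF bounded_linear_snd], symmetric]])
      also have "\<dots> = \<zeta> 0" by (simp add: v_def \<zeta>_def)
      finally show "\<zeta> t = linearized_source rhs (\<lambda>t. snd) Y v t q + integral {0..t} (\<lambda>\<tau>. linearized_rhs rhs Y \<tau> (q, (\<zeta> \<tau>, \<zeta> 1)))"
        unfolding linearized_source_def by (subst *) (simp only: add.assoc)
      show "norm (linearized_rhs rhs Y t (q, (z v t q, z v 1 q)) - linearized_rhs rhs Y t (q, (\<zeta> t, \<zeta> 1)))
          \<le> norm ((z v t q, z v 1 q) - (\<zeta> t, \<zeta> 1)) / 4"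
        using IE.quarter_lipschitz_linearized_rhs[OF Ck1(1)] t q unfolding quarter_lipschitz_def by blast
    qed simp
    have "(P has_derivative (\<lambda>v. z v 1 q \<bullet> \<alpha>)) (at q)"
      unfolding P_def[abs_def] using z(2)[OF _ q, of 1]
      by (intro bounded_linear.has_derivative[OF bounded_linear_inner_left]) simp
    from fun_cong[OF frechet_derivative_at[OF this], of v]
    have "D P q v = 0" by (simp add: z\<zeta> \<zeta>_1)
    then show ?thesis by (simp add: v_def W_def c_0 s_def)
  qed

  have "Y 1 (x0, y0) = y0"
  proof -
    have "rhs \<tau> (curve Y \<tau> (x0, y0)) = 0" if "\<tau> \<in> {0..1}" for \<tau>
      using linear_0[OF linear_N[OF \<Omega>'_ray[OF Y(2)[OF that base_point_in_Q] that]]]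
      by (simp add: rhs_def curve_def)
    then have "integral {0..1} (\<lambda>\<tau>. rhs \<tau> (curve Y \<tau> (x0, y0))) = 0"
      by (intro integral_unique has_integral_is_0) auto
    then show ?thesis using Y_eq[of 1 "(x0, y0)"] base_point_in_Q by simp
  qed
  then have "P (x0, y0) = 1" using \<alpha> by (simp add: P_def)
  with smooth homog funk show ?thesis by blast
qed

end

section \<open>From curvature components to the flatness identity\<close>

text \<open>Compactness provides the bounds on \<open>N\<close>, and the radius in the base is shrunk to
  make the two smallness conditions hold.\<close>

theorem (in flat_spray) exists_funk_function_near:
  assumes base: "(x0, y0) \<in> \<Omega>" and y0: "y0 \<noteq> 0"
  shows "\<exists>U P. open U \<and> (x0, y0) \<in> U \<and> U \<subseteq> \<Omega> \<and> (\<forall>x y s. (x, y) \<in> U \<longrightarrow> s > 0 \<longrightarrow> (x, s *\<^sub>R y) \<in> U) \<and>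
    smooth_on U P \<and> (\<forall>x y s. (x, y) \<in> U \<longrightarrow> s > 0 \<longrightarrow> P (x, s *\<^sub>R y) = s * P (x, y)) \<and>
    (\<forall>z\<in>U. \<forall>k. D P z (k, - (N z k + P z *\<^sub>R k)) = 0) \<and> P (x0, y0) = (1 :: real)"
proof -
  obtain e where e: "e > 0" "cball (x0, y0) e \<subseteq> \<Omega>"
    using \<Omega> base open_contains_cball by blast
  define \<rho> where "\<rho> = e / 2"
  have \<rho>: "\<rho> > 0" using e(1) by (simp add: \<rho>_def)
  define K where "K = cball x0 \<rho> \<times> cball y0 \<rho>"
  have K: "compact K" "convex K" by (auto simp: K_def intro: compact_Times convex_Times)
  have K\<Omega>: "K \<subseteq> \<Omega>"
  proof
    fix z assume "z \<in> K"
    then have "norm (x0 - fst z) \<le> \<rho>" "norm (y0 - snd z) \<le> \<rho>" by (auto simp: K_def dist_norm)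
    then have "norm ((x0, y0) - z) \<le> e"
      using norm_Pair_le[of "x0 - fst z" "y0 - snd z"] by (simp add: \<rho>_def minus_prod_def)
    then show "z \<in> \<Omega>" using e(2) by (auto simp: dist_norm)
  qed
  have "\<exists>L\<ge>0. \<forall>a\<in>K. \<forall>b\<in>K. norm (N a i - N b i) \<le> L * norm (a - b)" for i
    using lipschitz_on_compact_convex[OF \<Omega> times_differentiable_N K K\<Omega>, of i] by metis
  then obtain Li where Li: "\<And>i. Li i \<ge> 0" "\<And>i a b. a \<in> K \<Longrightarrow> b \<in> K \<Longrightarrow> norm (N a i - N b i) \<le> Li i * norm (a - b)"
    by metis
  have "\<exists>M. \<forall>a\<in>K. norm (N a i) \<le> M" for i
  proof -
    have "continuous_on \<Omega> (\<lambda>z. N z i)" using times_differentiable_N[of 0 i] by simp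
    from compact_imp_bounded[OF compact_continuous_image[OF continuous_on_subset[OF this K\<Omega>] K(1)]]
    show ?thesis by (auto simp: bounded_iff)
  qed
  then obtain Bi where Bi: "\<And>i a. a \<in> K \<Longrightarrow> norm (N a i) \<le> Bi i" by metis
  have base_K: "(x0, y0) \<in> K" using \<rho> by (simp add: K_def)
  have Bi0: "Bi i \<ge> 0" for i using order_trans[OF norm_ge_zero Bi[OF base_K]] .
  define L where "L = (\<Sum>i\<in>Basis. Li i)"
  define B where "B = (\<Sum>i\<in>Basis. Bi i)"
  have L0: "L \<ge> 0" "B \<ge> 0" by (auto simp: L_def B_def intro: sum_nonneg Li Bi0)
  have sum_bound: "norm (\<Sum>i\<in>Basis. (h \<bullet> i) *\<^sub>R w i) \<le> (\<Sum>i\<in>Basis. C i) * norm h * m"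
    if "\<And>i. norm (w i) \<le> C i * m" for h :: 'e and w :: "'e \<Rightarrow> 'e" and C m
  proof -
    have "norm (\<Sum>i\<in>Basis. (h \<bullet> i) *\<^sub>R w i) \<le> (\<Sum>i\<in>Basis. norm ((h \<bullet> i) *\<^sub>R w i))" by (rule norm_sum)
    also have "\<dots> \<le> (\<Sum>i\<in>Basis. C i * (norm h * m))"
    proof (rule sum_mono)
      fix i :: 'e assume "i \<in> Basis"
      then have "\<bar>h \<bullet> i\<bar> * norm (w i) \<le> norm h * (C i * m)"
        by (intro mult_mono that) (auto simp: Basis_le_norm)
      then show "norm ((h \<bullet> i) *\<^sub>R w i) \<le> C i * (norm h * m)" by (simp add: algebra_simps)
    qed
    finally show ?thesis by (simp add: sum_distrib_right mult.assoc)
  qed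
  \<comment> \<open>With this normalisation \<open>y0\<close> has scale \<open>1\<close>.\<close>
  define \<alpha> where "\<alpha> = (1 / (y0 \<bullet> y0)) *\<^sub>R y0"
  define T where "T = B + norm \<alpha> * (norm y0 + \<rho>)"
  have T0: "T \<ge> 0" "L + norm \<alpha> \<ge> 0" using L0 \<rho> by (auto simp: T_def)
  define r where "r = min \<rho> (min (1 / (4 * (L + norm \<alpha> + 1))) (\<rho> / (4 * (T + 1))))"
  have r: "r > 0" "r \<le> \<rho>" using \<rho> T0 by (auto simp: r_def)
  have \<alpha>: "y0 \<bullet> \<alpha> = 1" using y0 by (simp add: \<alpha>_def)
  have in_K: "(x, a) \<in> K" if "norm (x - x0) < r" "norm (a - y0) \<le> \<rho>" for x a
    using that r(2) by (simp add: K_def dist_norm norm_minus_commute)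
  have nbhd: "(x, a) \<in> \<Omega>" if "norm (x - x0) < r" "norm (a - y0) \<le> \<rho>" for x a
    using in_K[OF that] K\<Omega> by blast
  have bound: "norm (N (x, a) h) \<le> B * norm h" if "norm (x - x0) < r" "norm (a - y0) \<le> \<rho>" for x a h
  proof -
    have z: "(x, a) \<in> K" by (rule in_K[OF that])
    then have "N (x, a) h = (\<Sum>i\<in>Basis. (h \<bullet> i) *\<^sub>R N (x, a) i)" by (intro N_eq_sum) (use K\<Omega> in blast)
    then show ?thesis using sum_bound[of "\<lambda>i. N (x, a) i" Bi 1 h] Bi[OF z] by (simp add: B_def)
  qed
  have lipschitz: "norm (N (x, a) h - N (x, b) h) \<le> L * norm h * norm (a - b)"
    if "norm (x - x0) < r" "norm (a - y0) \<le> \<rho>" "norm (b - y0) \<le> \<rho>" for x a b h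
  proof -
    have z: "(x, a) \<in> K" "(x, b) \<in> K" using that by (auto intro: in_K)
    have "N (x, a) h = (\<Sum>i\<in>Basis. (h \<bullet> i) *\<^sub>R N (x, a) i)"
      "N (x, b) h = (\<Sum>i\<in>Basis. (h \<bullet> i) *\<^sub>R N (x, b) i)"
      by (rule N_eq_sum, use K\<Omega> z in blast)+
    then have "N (x, a) h - N (x, b) h = (\<Sum>i\<in>Basis. (h \<bullet> i) *\<^sub>R (N (x, a) i - N (x, b) i))"
      by (simp add: scaleR_diff_right sum_subtractf)
    also have "norm \<dots> \<le> L * norm h * norm (a - b)"
      unfolding L_def by (rule sum_bound) (use Li(2)[OF z] in simp)
    finally show ?thesis .
  qed
  have "r * (L + norm \<alpha>) \<le> 1 / (4 * (L + norm \<alpha> + 1)) * (L + norm \<alpha>)"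
    using T0 by (intro mult_right_mono) (auto simp: r_def)
  also have "\<dots> \<le> 1 / 4" using T0(2) by (simp add: field_simps)
  finally have small1: "r * (L + norm \<alpha>) \<le> 1 / 4" .
  have "r * T \<le> \<rho> / (4 * (T + 1)) * T"
    using T0 by (intro mult_right_mono) (auto simp: r_def)
  also have "\<dots> \<le> \<rho> / 4" using T0(1) \<rho> by (simp add: field_simps)
  finally have small2: "r * (B + norm \<alpha> * (norm y0 + \<rho>)) \<le> \<rho> / 4" by (simp add: T_def)
  interpret flat_spray_near_point \<Omega> g N x0 y0 \<alpha> r \<rho> L B
    by unfold_locales (fact \<alpha> r(1) \<rho> L0 nbhd bound[unfolded N_def] lipschitz[unfolded N_def] small1 small2)+
  obtain P where "smooth_on Q P" "\<forall>x y s. (x, y) \<in> Q \<longrightarrow> s > 0 \<longrightarrow> P (x, s *\<^sub>R y) = s * P (x, y)"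
    "\<forall>z\<in>Q. \<forall>k. D P z (k, - (N z k + P z *\<^sub>R k)) = 0" "P (x0, y0) = 1"
    using funk_function_on_Q by blast
  then show ?thesis
    using open_Q base_point_in_Q Q_subset Q_cone by blast
qed

lemma component_frechet_derivative:
  fixes F :: "'p::euclidean_space \<Rightarrow> real^'n"
  assumes "F differentiable at z"
  shows "D (\<lambda>z. F z $ i) z v = D F z v $ i"
proof -
  have "((\<lambda>z. F z $ i) has_derivative (\<lambda>v. D F z v $ i)) (at z)"
    using assms by (intro bounded_linear.has_derivative[OF bounded_linear_vec_nth])
      (simp add: frechet_derivative_works)
  from fun_cong[OF frechet_derivative_at[OF this]] show ?thesis by (rule sym)
qed

lemma linear_eq_axis_sum:
  fixes F :: "real^'n \<Rightarrow> 'e::real_vector"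
  assumes "linear F"
  shows "F v = (\<Sum>j\<in>UNIV. v $ j *\<^sub>R F (axis j 1))"
proof -
  have "F v = F (\<Sum>j\<in>UNIV. v $ j *\<^sub>R axis j 1)"
    by (simp add: basis_expansion flip: scalar_mult_eq_scaleR)
  then show ?thesis by (simp add: linear_sum[OF assms] linear_scale[OF assms])
qed

lemma linear_Pair_left: "linear F \<Longrightarrow> linear (\<lambda>v. F (v, 0))"
  by (rule linearI) (metis add_Pair add.right_neutral linear_add, metis scaleR_Pair scaleR_zero_right linear_scale)

lemma linear_Pair_right: "linear F \<Longrightarrow> linear (\<lambda>v. F (0, v))"
  by (rule linearI) (metis add_Pair add.right_neutral linear_add, metis scaleR_Pair scaleR_zero_right linear_scale)

text \<open>The flatness identity is linear in \<open>k\<close>, so it suffices to check its components on coordinate vectors,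
  where they are the components of the curvature.\<close>

lemma flat_spray_of_riemann_curvature:
  fixes g :: "(real^'n) \<times> (real^'n) \<Rightarrow> real^'n"
  assumes sp: "spray_coefficients \<Omega> g"
    and R: "\<And>z i k. z \<in> \<Omega> \<Longrightarrow> riemann_curvature (\<lambda>i z. g z $ i) i k z = 0"
  shows "flat_spray \<Omega> g"
proof -
  define N where "N = (\<lambda>z k. D g z (0, k))"
  interpret spray_coefficients \<Omega> g N by (rule sp) (simp add: N_def)
  let ?DN = "\<lambda>k z. D (\<lambda>z. N z k) z"
  define F where "F z k = 2 *\<^sub>R D g z (k, 0) - ?DN k z (snd z, - 2 *\<^sub>R g z) - N z (N z k)" for z k
  have F_axis: "F z (axis k 1) $ i = 0" if z: "z \<in> \<Omega>" for z k i
  proof -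
    let ?e = "\<lambda>j. axis j (1 :: real) :: real^'n"
    have dg: "g differentiable at z" if "z \<in> \<Omega>" for z
      using g_has_derivative[OF that] by (auto simp: differentiable_def)
    have dN: "(\<lambda>z. N z w) differentiable at z" for w
      using N_has_derivative[OF z] by (auto simp: differentiable_def)
    have lDN: "linear (?DN (?e k) z)" by (rule has_derivative_linear[OF N_has_derivative[OF z]])
    have py: "partial_y j (\<lambda>z. g z $ i) z = N z (?e j) $ i" if "z \<in> \<Omega>" for i j z
      unfolding partial_y_def N_def by (rule component_frechet_derivative[OF dg[OF that]])
    have px: "partial_x j (\<lambda>z. g z $ i) z = D g z (?e j, 0) $ i" for i j
      unfolding partial_x_def by (rule component_frechet_derivative[OF dg[OF z]])
    have d2: "D (partial_y k (\<lambda>z. g z $ i)) z v = ?DN (?e k) z v $ i" for v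
    proof -
      have "D (\<lambda>z. N z (?e k) $ i) z = D (partial_y k (\<lambda>z. g z $ i)) z"
      proof (rule frechet_derivative_cong_open[OF \<Omega> z])
        have "((\<lambda>z. N z (?e k) $ i) has_derivative (\<lambda>v. ?DN (?e k) z v $ i)) (at z)"
          by (rule bounded_linear.has_derivative[OF bounded_linear_vec_nth N_has_derivative[OF z]])
        then show "(\<lambda>z. N z (?e k) $ i) differentiable at z" by (auto simp: differentiable_def)
      qed (rule py[symmetric])
      then show ?thesis using component_frechet_derivative[OF dN, of "?e k" i v] by simp
    qed
    have 1: "(\<Sum>j\<in>UNIV. snd z $ j * partial_x j (partial_y k (\<lambda>z. g z $ i)) z) = ?DN (?e k) z (snd z, 0) $ i"
      unfolding partial_x_def d2
      by (subst linear_eq_axis_sum[OF linear_Pair_left[OF lDN]]) simp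
    have 2: "(\<Sum>j\<in>UNIV. g z $ j * partial_y j (partial_y k (\<lambda>z. g z $ i)) z) = ?DN (?e k) z (0, g z) $ i"
      unfolding partial_y_def[of _ "partial_y k _"] d2
      by (subst linear_eq_axis_sum[OF linear_Pair_right[OF lDN]]) simp
    have 3: "(\<Sum>j\<in>UNIV. partial_y j (\<lambda>z. g z $ i) z * partial_y k (\<lambda>z. g z $ j) z) = N z (N z (?e k)) $ i"
      unfolding py[OF z]
      by (subst (2) linear_eq_axis_sum[OF linear_N[OF z]]) (simp add: mult.commute)
    have "?DN (?e k) z (snd z, - 2 *\<^sub>R g z) = ?DN (?e k) z (snd z, 0) - 2 *\<^sub>R ?DN (?e k) z (0, g z)"
      using linear_diff[OF lDN, of "(snd z, 0)" "2 *\<^sub>R (0, g z)"] linear_scale[OF lDN, of 2 "(0, g z)"] by simp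
    then show ?thesis
      using R[OF z, of i k] unfolding riemann_curvature_def 1 2 3 px by (simp add: F_def)
  qed
  have lF: "linear (F z)" if z: "z \<in> \<Omega>" for z
  proof -
    have "linear (\<lambda>k. D g z (k, 0))"
      by (rule linear_Pair_left[OF has_derivative_linear[OF g_has_derivative[OF z]]])
    moreover have "linear (\<lambda>k. ?DN k z w)" for w
    proof (rule linearI)
      show "?DN (a + b) z w = ?DN a z w + ?DN b z w" for a b
        unfolding DN_eq_sum[OF z, of "a + b"] DN_eq_sum[OF z, of a] DN_eq_sum[OF z, of b]
        by (simp add: inner_add_left scaleR_add_left sum.distrib)
      show "?DN (s *\<^sub>R a) z w = s *\<^sub>R ?DN a z w" for s a
        unfolding DN_eq_sum[OF z, of "s *\<^sub>R a"] DN_eq_sum[OF z, of a]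
        by (simp add: scaleR_sum_right)
    qed
    moreover have "linear (\<lambda>k. N z (N z k))"
      using linear_compose[OF linear_N[OF z] linear_N[OF z]] by (simp add: o_def)
    ultimately show ?thesis
      unfolding F_def[abs_def] by (intro linear_compose_sub linear_compose_scale_right)
  qed
  have "F z k = 0" if z: "z \<in> \<Omega>" for z k
  proof -
    have "F z (axis j 1) = 0" for j by (simp add: vec_eq_iff F_axis[OF z])
    then show ?thesis by (subst linear_eq_axis_sum[OF lF[OF z]]) simp
  qed
  then have "flat_spray_axioms \<Omega> g" unfolding flat_spray_axioms_def F_def N_def by blast
  with sp show ?thesis by (rule flat_spray.intro)
qed

section \<open>Charts of the tangent bundle\<close>

lemma topology_generated_by_induct [consumes 1, case_names empty Int Union base]:
  assumes "openin (topology_generated_by S) W"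
    and "P {}" "\<And>a b. P a \<Longrightarrow> P b \<Longrightarrow> P (a \<inter> b)" "\<And>K. (\<And>k. k \<in> K \<Longrightarrow> P k) \<Longrightarrow> P (\<Union>K)"
    and "\<And>s. s \<in> S \<Longrightarrow> P s"
  shows "P W"
proof -
  have "generate_topology_on S W" using assms(1) by (simp add: openin_topology_generated_by_iff)
  then show ?thesis by induction (use assms(2-) in auto)
qed

locale smooth_atlas =
  fixes M :: "'a topology" and A :: "('a, 'e::euclidean_space) chart set"
  assumes manifold: "smooth_manifold M A"
begin

abbreviation overlap :: "('a, 'e) chart \<Rightarrow> ('a, 'e) chart \<Rightarrow> 'e set" where
  "overlap c c' \<equiv> chart_image c (chart_dom c')"

abbreviation jacobian :: "('a, 'e) chart \<Rightarrow> ('a, 'e) chart \<Rightarrow> 'e \<Rightarrow> 'e \<Rightarrow> 'e" where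
  "jacobian c c' x \<equiv> D (transition c c') x"

lemma chart_facts:
  assumes "c \<in> A"
  shows "openin M (chart_dom c)" "open (overlap c c)"
    "homeomorphic_map (subtopology M (chart_dom c)) (top_of_set (overlap c c)) (chart_map c)"
  using manifold assms unfolding smooth_manifold_def by blast+

lemma chart_inj: "c \<in> A \<Longrightarrow> inj_on (chart_map c) (chart_dom c)"
  using homeomorphic_imp_injective_map[OF chart_facts(3)] openin_subset[OF chart_facts(1)]
  by (simp add: topspace_subtopology Int_absorb1)

lemma chart_inv_map: "c \<in> A \<Longrightarrow> p \<in> chart_dom c \<Longrightarrow> chart_inv c (chart_map c p) = p"
  by (simp add: chart_inv_def chart_inj)

lemma chart_map_in: "p \<in> chart_dom c \<Longrightarrow> p \<in> W \<Longrightarrow> chart_map c p \<in> chart_image c W"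
  by (auto simp: chart_image_def)

lemma chart_inv_in:
  assumes "c \<in> A" "x \<in> chart_image c W"
  shows "chart_inv c x \<in> chart_dom c" "chart_inv c x \<in> W" "chart_map c (chart_inv c x) = x"
  using assms chart_inv_map[OF assms(1)] by (auto simp: chart_image_def)

lemma open_overlap:
  assumes "c \<in> A" "c' \<in> A"
  shows "open (overlap c c')"
proof -
  have "openin (subtopology M (chart_dom c)) (chart_dom c' \<inter> chart_dom c)"
    by (rule openin_subtopology_Int[OF chart_facts(1)[OF assms(2)]])
  then have "openin (top_of_set (overlap c c)) (chart_map c ` (chart_dom c' \<inter> chart_dom c))"
    using homeomorphic_imp_open_map[OF chart_facts(3)[OF assms(1)]] by (simp add: open_map_def)
  then show ?thesis
    using chart_facts(2)[OF assms(1)] openin_open_trans by (auto simp: chart_image_def)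
qed

lemma overlap_subset: "overlap c c' \<subseteq> overlap c c"
  by (auto simp: chart_image_def)

lemma in_overlap_iff:
  "c \<in> A \<Longrightarrow> x \<in> overlap c c' \<longleftrightarrow> x \<in> overlap c c \<and> chart_inv c x \<in> chart_dom c'"
  using overlap_subset chart_inv_in chart_map_in by (metis subsetD)

lemma transition_eq: "transition c c' x = chart_map c' (chart_inv c x)"
  by (simp add: transition_def)

lemma transition_in:
  assumes "c \<in> A" "c' \<in> A" "x \<in> overlap c c'"
  shows "transition c c' x \<in> overlap c' c" "chart_inv c' (transition c c' x) = chart_inv c x"
  using chart_inv_in[OF assms(1,3)]
  by (simp_all add: transition_eq chart_map_in chart_inv_map[OF assms(2)])

lemma smooth_transition: "c \<in> A \<Longrightarrow> c' \<in> A \<Longrightarrow> smooth_on (overlap c c') (transition c c')"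
  using manifold unfolding smooth_manifold_def by blast

lemma times_differentiable_transition:
  "c \<in> A \<Longrightarrow> c' \<in> A \<Longrightarrow> times_differentiable_on n (overlap c c') (transition c c')"
  using smooth_transition unfolding smooth_on_def by blast

lemma transition_has_derivative:
  "c \<in> A \<Longrightarrow> c' \<in> A \<Longrightarrow> x \<in> overlap c c' \<Longrightarrow>
    (transition c c' has_derivative jacobian c c' x) (at x)"
  using times_differentiable_transition[of c c' "Suc 0"] by (simp add: frechet_derivative_works)

lemma linear_jacobian: "c \<in> A \<Longrightarrow> c' \<in> A \<Longrightarrow> x \<in> overlap c c' \<Longrightarrow> linear (jacobian c c' x)"
  by (rule has_derivative_linear[OF transition_has_derivative])

lemma jacobian_self:
  assumes "c \<in> A" "x \<in> overlap c c"
  shows "jacobian c c x y = y"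
proof -
  have "(transition c c has_derivative (\<lambda>y. y)) (at x)"
    by (rule has_derivative_transform_within_open[OF has_derivative_ident chart_facts(2)[OF assms(1)] assms(2)])
      (simp add: transition_eq chart_inv_in[OF assms(1)])
  from fun_cong[OF frechet_derivative_at[OF this]] show ?thesis by (rule sym)
qed

text \<open>The chain rule; it makes the coordinates of a tangent vector consistent across charts.\<close>

lemma jacobian_cocycle:
  assumes c: "c \<in> A" "c' \<in> A" "c'' \<in> A" and x: "x \<in> overlap c c'" "x \<in> overlap c c''"
  shows "jacobian c c'' x y = jacobian c' c'' (transition c c' x) (jacobian c c' x y)"
proof -
  have eq: "transition c' c'' (transition c c' x) = transition c c'' x" "transition c c' x \<in> overlap c' c''"
    if "x \<in> overlap c c'" "x \<in> overlap c c''" for x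
    using chart_inv_in(2)[OF c(1) that(1)] chart_inv_in(2)[OF c(1) that(2)] chart_map_in
      transition_in(2)[OF c(1,2) that(1)]
    by (simp_all only: transition_eq)
  have "((\<lambda>x. transition c' c'' (transition c c' x)) has_derivative
      (\<lambda>y. jacobian c' c'' (transition c c' x) (jacobian c c' x y))) (at x)"
    by (rule has_derivative_compose[OF transition_has_derivative[OF c(1,2) x(1)]
          transition_has_derivative[OF c(2,3) eq(2)[OF x]]])
  then have "(transition c c'' has_derivative
      (\<lambda>y. jacobian c' c'' (transition c c' x) (jacobian c c' x y))) (at x)"
    by (rule has_derivative_transform_within_open[OF _ open_Int[OF open_overlap[OF c(1,2)] open_overlap[OF c(1,3)]]])
      (use x eq(1) in auto)
  from fun_cong[OF frechet_derivative_at[OF this]] show ?thesis by (rule sym)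
qed

text \<open>The tangent vector with coordinates \<open>z\<close> in the chart \<open>c\<close>; this is an explicit inverse of the chart
  of the tangent bundle induced by \<open>c\<close>.\<close>

definition lift :: "('a, 'e) chart \<Rightarrow> 'e \<times> 'e \<Rightarrow> ('a, 'e) tangent" where
  "lift c z = (chart_inv c (fst z), \<lambda>c'. if c' \<in> A \<and> chart_inv c (fst z) \<in> chart_dom c'
     then jacobian c c' (fst z) (snd z) else 0)"

definition bundle_transition :: "('a, 'e) chart \<Rightarrow> ('a, 'e) chart \<Rightarrow> 'e \<times> 'e \<Rightarrow> 'e \<times> 'e" where
  "bundle_transition c c' z = (transition c c' (fst z), jacobian c c' (fst z) (snd z))"

lemma tangent_chart_simps:
  "chart_dom (tangent_chart A c) = {u \<in> tangent_bundle A. fst u \<in> chart_dom c}"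
  "chart_map (tangent_chart A c) u = (chart_map c (fst u), snd u c)"
  by (auto simp: tangent_chart_def case_prod_beta)

lemma lift_in_bundle:
  assumes c: "c \<in> A" and z: "fst z \<in> overlap c c"
  shows "lift c z \<in> tangent_bundle A"
proof -
  let ?p = "chart_inv c (fst z)"
  have p: "?p \<in> chart_dom c" by (rule chart_inv_in(1)[OF c z])
  have "snd (lift c z) \<in> tangent_space A ?p"
    unfolding tangent_space_def
  proof (intro CollectI conjI allI ballI impI)
    fix c1 assume "\<not> (c1 \<in> A \<and> ?p \<in> chart_dom c1)"
    then show "snd (lift c z) c1 = 0" by (auto simp: lift_def)
  next
    fix c1 c2 assume c12: "c1 \<in> A" "c2 \<in> A" and "?p \<in> chart_dom c1 \<inter> chart_dom c2"
    then have p12: "?p \<in> chart_dom c1" "?p \<in> chart_dom c2" by auto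
    have x: "fst z \<in> overlap c c1" "fst z \<in> overlap c c2"
      using in_overlap_iff[OF c] z p12 by blast+
    have "snd (lift c z) c1 = jacobian c c1 (fst z) (snd z)" "snd (lift c z) c2 = jacobian c c2 (fst z) (snd z)"
      using c12 p12 by (auto simp: lift_def)
    then show "snd (lift c z) c2 = jacobian c1 c2 (chart_map c1 ?p) (snd (lift c z) c1)"
      using jacobian_cocycle[OF c c12 x, of "snd z"] by (simp add: transition_eq[of c c1])
  qed
  then show ?thesis
    using p c by (auto simp: tangent_bundle_def lift_def)
qed

lemma lift_in_chart:
  assumes c: "c \<in> A" "c' \<in> A" and z: "fst z \<in> overlap c c'"
  shows "lift c z \<in> chart_dom (tangent_chart A c')"
    "chart_map (tangent_chart A c') (lift c z) = bundle_transition c c' z"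
proof -
  have "fst z \<in> overlap c c" using z overlap_subset by blast
  then show "lift c z \<in> chart_dom (tangent_chart A c')"
    using lift_in_bundle[OF c(1)] chart_inv_in(2)[OF c(1) z] by (simp add: tangent_chart_simps lift_def)
  show "chart_map (tangent_chart A c') (lift c z) = bundle_transition c c' z"
    using chart_inv_in(2)[OF c(1) z] c(2)
    by (simp add: tangent_chart_simps lift_def bundle_transition_def transition_eq)
qed

lemma bundle_transition_self:
  assumes "c \<in> A" "fst z \<in> overlap c c"
  shows "bundle_transition c c z = z"
  using jacobian_self[OF assms] chart_inv_in(3)[OF assms]
  by (simp add: bundle_transition_def transition_eq)

lemma lift_chart_map:
  assumes c: "c \<in> A" and u: "u \<in> chart_dom (tangent_chart A c)"
  shows "fst (chart_map (tangent_chart A c) u) \<in> overlap c c" "lift c (chart_map (tangent_chart A c) u) = u"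
proof -
  obtain p v where pv: "u = (p, v)" by fastforce
  have p: "p \<in> chart_dom c" and v: "v \<in> tangent_space A p"
    using u by (auto simp: tangent_chart_simps pv tangent_bundle_def)
  show "fst (chart_map (tangent_chart A c) u) \<in> overlap c c"
    using p by (simp add: tangent_chart_simps pv chart_map_in)
  have "v c' = (if c' \<in> A \<and> p \<in> chart_dom c' then jacobian c c' (chart_map c p) (v c) else 0)" for c'
  proof (cases "c' \<in> A \<and> p \<in> chart_dom c'")
    case True
    then have "v c' = jacobian c c' (chart_map c p) (v c)"
      using v c p unfolding tangent_space_def by blast
    with True show ?thesis by (simp only: True if_True simp_thms)
  next
    case False
    then have "v c' = 0" using v unfolding tangent_space_def by blast
    with False show ?thesis by (simp only: if_False)
  qed
  then have "(\<lambda>c'. if c' \<in> A \<and> p \<in> chart_dom c' then jacobian c c' (chart_map c p) (v c) else 0) = v"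
    by (rule ext[THEN sym])
  then show "lift c (chart_map (tangent_chart A c) u) = u"
    by (simp only: lift_def tangent_chart_simps pv fst_conv snd_conv chart_inv_map[OF c p])
qed

lemma lift_bundle_transition:
  assumes c: "c \<in> A" "c' \<in> A" and z: "fst z \<in> overlap c c'"
  shows "lift c' (bundle_transition c c' z) = lift c z"
  using lift_chart_map(2)[OF c(2) lift_in_chart(1)[OF c z]] by (simp add: lift_in_chart(2)[OF c z])

lemma tangent_chart_inv:
  assumes c: "c \<in> A" and z: "fst z \<in> overlap c c"
  shows "chart_inv (tangent_chart A c) z = lift c z"
proof -
  have inj: "inj_on (chart_map (tangent_chart A c)) (chart_dom (tangent_chart A c))"
    by (rule inj_on_inverseI[where g = "lift c"]) (rule lift_chart_map(2)[OF c])
  have "chart_map (tangent_chart A c) (lift c z) = z"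
    using lift_in_chart(2)[OF c c z] bundle_transition_self[OF c z] by simp
  then show ?thesis
    using inv_into_f_f[OF inj lift_in_chart(1)[OF c c z]] by (simp add: chart_inv_def)
qed

lemma tangent_image_eq:
  assumes c: "c \<in> A"
  shows "tangent_image A c W = {z. fst z \<in> overlap c c \<and> lift c z \<in> W}"
proof (intro set_eqI iffI)
  fix z assume "z \<in> tangent_image A c W"
  then obtain u where "u \<in> W" "u \<in> chart_dom (tangent_chart A c)" "z = chart_map (tangent_chart A c) u"
    by (auto simp: tangent_image_def chart_image_def)
  then show "z \<in> {z. fst z \<in> overlap c c \<and> lift c z \<in> W}" using lift_chart_map[OF c] by auto
next
  fix z assume "z \<in> {z. fst z \<in> overlap c c \<and> lift c z \<in> W}"
  then have z: "fst z \<in> overlap c c" "lift c z \<in> W" by auto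
  have "z = chart_map (tangent_chart A c) (lift c z)"
    using lift_in_chart(2)[OF c c z(1)] bundle_transition_self[OF c z(1)] by simp
  with z lift_in_chart(1)[OF c c z(1)] show "z \<in> tangent_image A c W"
    unfolding tangent_image_def chart_image_def by blast
qed

lemma local_expr_eq:
  assumes "c \<in> A" "fst z \<in> overlap c c"
  shows "local_expr A c P z = P (lift c z)"
  by (simp add: local_expr_def tangent_chart_inv[OF assms])

lemma smooth_bundle_transition:
  assumes c: "c \<in> A" "c' \<in> A"
  shows "Ck_family n T (overlap c c' \<times> UNIV) (\<lambda>_. bundle_transition c c')"
proof -
  have o: "open (overlap c c' \<times> (UNIV :: 'e set))" by (intro open_Times open_overlap c open_UNIV)
  have fst: "Ck_family n T (overlap c c' \<times> (UNIV :: 'e set)) (\<lambda>_. fst)"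
    and snd: "Ck_family n T (overlap c c' \<times> (UNIV :: 'e set)) (\<lambda>_. snd)"
    by (intro Ck_family_linear_ident o bounded_linear_fst bounded_linear_snd)+
  have "Ck_family n T (overlap c c' \<times> (UNIV :: 'e set)) (\<lambda>_ z. transition c c' (fst z))"
    by (rule Ck_family_compose[OF o Ck_family_of_times_differentiable_on[OF times_differentiable_transition[OF c]] fst])
      auto
  moreover have "Ck_family n T (overlap c c' \<times> (UNIV :: 'e set)) (\<lambda>_ z. jacobian c c' (fst z) (snd z))"
  proof (rule Ck_family_apply[OF o _ _ snd, where L = "\<lambda>_ z. jacobian c c' (fst z)"])
    fix w
    have "times_differentiable_on n (overlap c c') (\<lambda>x. jacobian c c' x w)"
      using times_differentiable_transition[OF c, of "Suc n"] unfolding times_differentiable_on.simps by blast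
    from Ck_family_compose[OF o Ck_family_of_times_differentiable_on[OF this] fst]
    show "Ck_family n T (overlap c c' \<times> (UNIV :: 'e set)) (\<lambda>_ z. jacobian c c' (fst z) w)" by auto
  qed (auto intro: linear_jacobian c)
  ultimately have "Ck_family n T (overlap c c' \<times> (UNIV :: 'e set))
      (\<lambda>_ z. (transition c c' (fst z), jacobian c c' (fst z) (snd z)))"
    by (rule Ck_family_Pair[OF o])
  then show ?thesis by (simp add: bundle_transition_def[abs_def])
qed

lemma bundle_transition_has_derivative:
  assumes c: "c \<in> A" "c' \<in> A" and x: "x \<in> overlap c c'"
  shows "(bundle_transition c c' has_derivative (\<lambda>d. (jacobian c c' x (fst d),
    D (\<lambda>x. jacobian c c' x y) x (fst d) + jacobian c c' x (snd d)))) (at (x, y))"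
proof -
  have fst: "(fst has_derivative fst) (at (x, y))" and snd: "(snd has_derivative snd) (at (x, y))"
    by (intro bounded_linear_imp_has_derivative bounded_linear_fst bounded_linear_snd)+
  have t: "((\<lambda>z. transition c c' (fst z)) has_derivative (\<lambda>d. jacobian c c' x (fst d))) (at (x, y))"
    using has_derivative_compose[OF fst] transition_has_derivative[OF c x] by auto
  have "((\<lambda>z. jacobian c c' (fst z) (snd z)) has_derivative
      (\<lambda>d. D (\<lambda>x. jacobian c c' x y) x (fst d) + jacobian c c' x (snd d))) (at (x, y))"
    using has_derivative_frechet_derivative_apply[OF open_overlap[OF c] times_differentiable_transition[OF c] fst snd] x
    by simp
  from has_derivative_Pair[OF t this] show ?thesis by (simp add: bundle_transition_def[abs_def])
qed

text \<open>Over the overlap of two charts, a generating open set of the tangent bundle is the preimage of an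
  open set under the continuous coordinate change.\<close>

lemma open_tangent_image:
  assumes "openin (tangent_topology A) W" "c \<in> A"
  shows "open (tangent_image A c W)"
  using assms(1) unfolding tangent_topology_def
proof (induction rule: topology_generated_by_induct)
  case empty
  then show ?case by (simp add: tangent_image_eq[OF assms(2)])
next
  case (Int a b)
  have "tangent_image A c (a \<inter> b) = tangent_image A c a \<inter> tangent_image A c b"
    by (auto simp: tangent_image_eq[OF assms(2)])
  then show ?case using Int by auto
next
  case (Union K)
  have "tangent_image A c (\<Union>K) = (\<Union>k\<in>K. tangent_image A c k)"
    by (auto simp: tangent_image_eq[OF assms(2)])
  then show ?case using Union by auto
next
  case (base s)
  then obtain c' V where s: "s = {u \<in> chart_dom (tangent_chart A c'). chart_map (tangent_chart A c') u \<in> V}"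
    and c': "c' \<in> A" and V: "open V" by auto
  have o: "open (overlap c c' \<times> (UNIV :: 'e set))" by (intro open_Times open_overlap assms c' open_UNIV)
  have cont: "continuous_on (overlap c c' \<times> UNIV) (bundle_transition c c')"
    using times_differentiable_on_imp_continuous_on[OF times_differentiable_on_of_Ck_family[OF
        smooth_bundle_transition[OF assms(2) c', of 0 "{0}"], of 0]] by simp
  have "tangent_image A c s = (overlap c c' \<times> UNIV) \<inter> bundle_transition c c' -` V"
  proof (intro set_eqI iffI)
    fix z assume "z \<in> tangent_image A c s"
    then have z: "fst z \<in> overlap c c" "lift c z \<in> s" by (auto simp: tangent_image_eq[OF assms(2)])
    then have "chart_inv c (fst z) \<in> chart_dom c'" by (simp add: s tangent_chart_simps lift_def)
    then have x: "fst z \<in> overlap c c'" using in_overlap_iff[OF assms(2)] z(1) by blast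
    with z(2) lift_in_chart(2)[OF assms(2) c' x]
    show "z \<in> (overlap c c' \<times> UNIV) \<inter> bundle_transition c c' -` V"
      by (cases z) (simp add: s)
  next
    fix z assume "z \<in> (overlap c c' \<times> UNIV) \<inter> bundle_transition c c' -` V"
    then have x: "fst z \<in> overlap c c'" and V: "bundle_transition c c' z \<in> V" by auto
    have "fst z \<in> overlap c c" using x overlap_subset by blast
    then show "z \<in> tangent_image A c s"
      using V lift_in_chart[OF assms(2) c' x] by (auto simp: tangent_image_eq[OF assms(2)] s)
  qed
  then show ?case using continuous_on_open_vimage[OF o] cont V by (auto simp: Int_commute)
qed

end

section \<open>Change of chart for sprays and Funk functions\<close>

text \<open>The Funk equation says that the derivative vanishes on the vectors \<open>(k, - (N k + f k))\<close>, a form that does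
  not mention components and is convenient for changing charts.\<close>

lemma horizontal_derivative_eq:
  fixes g :: "(real^'n) \<times> (real^'n) \<Rightarrow> real^'n"
  assumes g: "g differentiable at z" and f: "f differentiable at z"
  shows "horizontal_derivative (\<lambda>i z. g z $ i) k f z - f z * partial_y k f z
    = D f z (axis k 1, - (D g z (0, axis k 1) + f z *\<^sub>R axis k 1))"
proof -
  let ?D = "D f z" and ?e = "\<lambda>r. axis r (1 :: real) :: real^'n"
  let ?n = "D g z (0, ?e k)"
  have lD: "linear ?D" by (rule linear_frechet_derivative[OF f])
  have "(\<Sum>r\<in>UNIV. partial_y k (\<lambda>z. g z $ r) z * partial_y r f z) = ?D (0, ?n)"
    unfolding partial_y_def component_frechet_derivative[OF g]
    by (subst linear_eq_axis_sum[OF linear_Pair_right[OF lD], of ?n]) simp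
  moreover have "?D (?e k, - (?n + f z *\<^sub>R ?e k)) = ?D (?e k, 0) - ?D (0, ?n) - f z * ?D (0, ?e k)"
    using linear_diff[OF lD, of "(?e k, 0) - (0, ?n)" "f z *\<^sub>R (0, ?e k)"] linear_diff[OF lD, of "(?e k, 0)" "(0, ?n)"]
      linear_scale[OF lD, of "f z" "(0, ?e k)"] by simp
  ultimately show ?thesis
    by (simp add: horizontal_derivative_def partial_x_def partial_y_def)
qed

lemma smooth_on_bounded_linear:
  assumes "open S" "bounded_linear L" "smooth_on S f"
  shows "smooth_on S (\<lambda>x. L (f x))"
  using smooth_on_of_Ck_family[of "{0}" S "\<lambda>_ x. L (f x)" 0]
    Ck_family_bounded_linear[OF assms(1,2) smooth_on_imp_Ck_family[OF assms(3)]] by simp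

lemma smooth_on_imp_differentiable: "smooth_on S f \<Longrightarrow> z \<in> S \<Longrightarrow> f differentiable at z"
  unfolding smooth_on_def by (metis times_differentiable_on.simps(2))

locale spray_manifold = smooth_atlas M A
  for M :: "'a topology" and A :: "('a, real^'n) chart set" +
  fixes C :: "('a, real^'n) tangent set"
    and G :: "(('a, real^'n) tangent, (real^'n) \<times> (real^'n)) vector_field"
  assumes spray: "spray A C G"
begin

definition coeff :: "('a, real^'n) chart \<Rightarrow> (real^'n) \<times> (real^'n) \<Rightarrow> real^'n" where
  "coeff c z = - (1 / 2) *\<^sub>R snd (local_expr A c G z (tangent_chart A c))"

lemma spray_coeff_eq: "spray_coeff A G c = (\<lambda>i z. coeff c z $ i)"
  by (simp add: fun_eq_iff spray_coeff_def coeff_def)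

lemma conical: "conical_region A C" using spray by (simp add: spray_def)

lemma open_image_C: "c \<in> A \<Longrightarrow> open (tangent_image A c C)"
  using conical open_tangent_image unfolding conical_region_def by blast

lemma smooth_coeff:
  assumes c: "c \<in> A"
  shows "smooth_on (tangent_image A c C) (coeff c)"
proof -
  have "smooth_on (tangent_image A c C) (\<lambda>z. local_expr A c G z (tangent_chart A c))"
    using spray c unfolding spray_def smooth_vector_field_on_def tangent_atlas_def tangent_image_def local_expr_def
    by blast
  from smooth_on_bounded_linear[OF open_image_C[OF c] bounded_linear_compose[OF bounded_linear_scaleR_right bounded_linear_snd] this]
  show ?thesis unfolding coeff_def[abs_def] .
qed

lemma lift_scale:
  assumes c: "c \<in> A" and x: "x \<in> overlap c c"
  shows "lift c (x, t *\<^sub>R y) = tangent_scale t (lift c (x, y))"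
proof -
  have "x \<in> overlap c c'" if "chart_inv c x \<in> chart_dom c'" for c'
    using that x in_overlap_iff[OF c] by blast
  then show ?thesis
    by (auto simp: lift_def tangent_scale_def fun_eq_iff linear_scale[OF linear_jacobian[OF c]])
qed

lemma spray_coefficients_coeff:
  assumes c: "c \<in> A"
  shows "spray_coefficients (tangent_image A c C) (coeff c)"
proof
  show "open (tangent_image A c C)" by (rule open_image_C[OF c])
  show "smooth_on (tangent_image A c C) (coeff c)" by (rule smooth_coeff[OF c])
  fix x y and t :: real assume z: "(x, y) \<in> tangent_image A c C" and t: "t > 0"
  have x: "x \<in> overlap c c" "lift c (x, y) \<in> C" using z by (auto simp: tangent_image_eq[OF c])
  then have "tangent_scale t (lift c (x, y)) \<in> C" using conical t unfolding conical_region_def by blast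
  then show "(x, t *\<^sub>R y) \<in> tangent_image A c C"
    using x by (simp add: tangent_image_eq[OF c] lift_scale[OF c])
  have "spray_coeff A G c i (x, t *\<^sub>R y) = t\<^sup>2 * spray_coeff A G c i (x, y)" for i
    using spray c z t unfolding spray_def by blast
  then show "coeff c (x, t *\<^sub>R y) = t\<^sup>2 *\<^sub>R coeff c (x, y)"
    by (simp add: vec_eq_iff spray_coeff_eq)
qed

text \<open>The second derivative of the coordinate change, \<open>v\<close> being the direction differentiated first.\<close>

definition hessian :: "('a, real^'n) chart \<Rightarrow> ('a, real^'n) chart \<Rightarrow> real^'n \<Rightarrow> real^'n \<Rightarrow> real^'n \<Rightarrow> real^'n" where
  "hessian c c' x v w = D (\<lambda>x. jacobian c c' x v) x w"

lemma hessian_symmetric: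
  assumes "c \<in> A" "c' \<in> A" "x \<in> overlap c c'"
  shows "hessian c c' x v w = hessian c c' x w v"
  unfolding hessian_def
  by (rule second_derivative_symmetric[OF open_overlap[OF assms(1,2)] times_differentiable_transition[OF assms(1,2)] assms(3)])

lemma bounded_bilinear_hessian:
  assumes c: "c \<in> A" "c' \<in> A" and x: "x \<in> overlap c c'"
  shows "bounded_bilinear (hessian c c' x)"
proof -
  have lin: "linear (hessian c c' x v)" for v
  proof -
    have "(\<lambda>x. jacobian c c' x v) differentiable at x"
      using times_differentiable_transition[OF c, of "Suc (Suc 0)"] x unfolding times_differentiable_on.simps by blast
    from linear_frechet_derivative[OF this] show ?thesis by (simp add: hessian_def[abs_def])
  qed
  have "(\<lambda>v. hessian c c' x v w) = hessian c c' x w" for w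
    by (rule ext) (rule hessian_symmetric[OF c x])
  then have "bilinear (hessian c c' x)" using lin by (simp add: bilinear_def)
  then show ?thesis by (simp add: bilinear_conv_bounded_bilinear)
qed

text \<open>The second component of the transformation law of the vector field \<open>G = (y, - 2 coeff)\<close>
  under the coordinate change of the tangent bundle.\<close>

lemma coeff_transformation:
  assumes c: "c \<in> A" "c' \<in> A" and z: "(x, y) \<in> tangent_image A c C" and x: "x \<in> overlap c c'"
  shows "coeff c' (bundle_transition c c' (x, y)) = jacobian c c' x (coeff c (x, y)) - (1 / 2) *\<^sub>R hessian c c' x y y"
    and "bundle_transition c c' (x, y) \<in> tangent_image A c' C"
proof -
  let ?tc = "tangent_chart A c" and ?tc' = "tangent_chart A c'"
  define u where "u = lift c (x, y)"
  have xc: "x \<in> overlap c c" and u: "u \<in> C" using z by (auto simp: tangent_image_eq[OF c(1)] u_def)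
  have x': "transition c c' x \<in> overlap c' c'"
    using transition_in(1)[OF c x] overlap_subset by blast
  have lift': "lift c' (bundle_transition c c' (x, y)) = u"
    using lift_bundle_transition[OF c, of "(x, y)"] x by (simp add: u_def)
  show "bundle_transition c c' (x, y) \<in> tangent_image A c' C"
    using lift' u x' by (simp add: tangent_image_eq[OF c(2)] bundle_transition_def)
  have o: "open (overlap c c' \<times> (UNIV :: (real^'n) set))" by (intro open_Times open_overlap c open_UNIV)
  have "transition ?tc ?tc' z = bundle_transition c c' z" if "z \<in> overlap c c' \<times> UNIV" for z
    using that tangent_chart_inv[OF c(1)] lift_in_chart(2)[OF c] subsetD[OF overlap_subset[of c c']]
    by (auto simp: transition_def)
  then have "(transition ?tc ?tc' has_derivative (\<lambda>d. (jacobian c c' x (fst d),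
      D (\<lambda>x. jacobian c c' x y) x (fst d) + jacobian c c' x (snd d)))) (at (x, y))"
    using x by (intro has_derivative_transform_within_open[OF bundle_transition_has_derivative[OF c x] o]) auto
  note dt = fun_cong[OF frechet_derivative_at[OF this], symmetric]
  have "G u \<in> tangent_space (tangent_atlas A) u"
    using spray u unfolding spray_def smooth_vector_field_on_def by blast
  then have rule: "G u c2 = D (transition c1 c2) (chart_map c1 u) (G u c1)"
    if "c1 \<in> tangent_atlas A" "c2 \<in> tangent_atlas A" "u \<in> chart_dom c1 \<inter> chart_dom c2" for c1 c2
    using that unfolding tangent_space_def by blast
  have "u \<in> chart_dom ?tc" "u \<in> chart_dom ?tc'" "chart_map ?tc u = (x, y)"
    using lift_in_chart[OF c(1) c(1), of "(x, y)"] lift_in_chart[OF c, of "(x, y)"] x xc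
      bundle_transition_self[OF c(1), of "(x, y)"] by (simp_all add: u_def)
  with rule[of ?tc ?tc'] have "G u ?tc' = D (transition ?tc ?tc') (x, y) (G u ?tc)"
    using c by (simp only: tangent_atlas_def imageI IntI)
  then have "snd (G u ?tc') = hessian c c' x y (fst (G u ?tc)) + jacobian c c' x (snd (G u ?tc))"
    by (simp add: dt hessian_def)
  moreover have "fst (G u ?tc) = y"
  proof -
    have "fst (local_expr A c G (x, y) ?tc) = y"
      using spray c(1) z unfolding spray_def by blast
    then show ?thesis using xc by (simp add: local_expr_eq[OF c(1)] u_def)
  qed
  moreover have "coeff c (x, y) = - (1 / 2) *\<^sub>R snd (G u ?tc)"
    using xc by (simp add: coeff_def local_expr_eq[OF c(1)] u_def)
  moreover have "coeff c' (bundle_transition c c' (x, y)) = - (1 / 2) *\<^sub>R snd (G u ?tc')"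
    using x' lift' by (simp add: coeff_def local_expr_eq[OF c(2)] bundle_transition_def)
  ultimately show "coeff c' (bundle_transition c c' (x, y))
      = jacobian c c' x (coeff c (x, y)) - (1 / 2) *\<^sub>R hessian c c' x y y"
    by (simp only: linear_scale[OF linear_jacobian[OF c x]]) (simp add: algebra_simps)
qed

text \<open>The transformation law of the coefficients is differentiated along the fibre, where the point \<open>x\<close>
  of the base is fixed and the hessian is a symmetric bilinear map.\<close>

lemma connection_transformation:
  assumes c: "c \<in> A" "c' \<in> A" and z: "(x, y) \<in> tangent_image A c C" and x: "x \<in> overlap c c'"
  shows "D (coeff c') (bundle_transition c c' (x, y)) (0, jacobian c c' x h)
    = jacobian c c' x (D (coeff c) (x, y) (0, h)) - hessian c c' x y h"
proof -
  interpret hes: bounded_bilinear "hessian c c' x" by (rule bounded_bilinear_hessian[OF c x])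
  let ?J = "jacobian c c' x"
  have J: "bounded_linear ?J" by (rule has_derivative_bounded_linear[OF transition_has_derivative[OF c x]])
  have dc: "(coeff c'' has_derivative D (coeff c'') z) (at z)"
    if "c'' \<in> A" "z \<in> tangent_image A c'' C" for c'' z
    using smooth_on_imp_differentiable[OF smooth_coeff[OF that(1)] that(2)] by (simp add: frechet_derivative_works)
  have i: "((\<lambda>k. (x, k)) has_derivative (\<lambda>k. (0, k))) (at y)"
    by (auto intro!: derivative_eq_intros)
  have b: "((\<lambda>k. bundle_transition c c' (x, k)) has_derivative (\<lambda>k. (0, ?J k))) (at y)"
  proof -
    have "((\<lambda>k. (transition c c' x, ?J k)) has_derivative (\<lambda>k. (0, ?J k))) (at y)"
      by (intro has_derivative_Pair has_derivative_const bounded_linear_imp_has_derivative J)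
    then show ?thesis by (simp add: bundle_transition_def)
  qed
  have 1: "((\<lambda>k. coeff c' (bundle_transition c c' (x, k))) has_derivative
      (\<lambda>k. D (coeff c') (bundle_transition c c' (x, y)) (0, ?J k))) (at y)"
    by (rule has_derivative_compose[OF b dc[OF c(2) coeff_transformation(2)[OF c z x]]])
  have "((\<lambda>k. ?J (coeff c (x, k)) - (1 / 2) *\<^sub>R hessian c c' x k k) has_derivative
      (\<lambda>k. ?J (D (coeff c) (x, y) (0, k))
        - (1 / 2) *\<^sub>R (hessian c c' x y k + hessian c c' x k y))) (at y)"
    by (intro has_derivative_diff bounded_linear.has_derivative[OF J] has_derivative_compose[OF i dc[OF c(1) z]]
        bounded_linear.has_derivative[OF bounded_linear_scaleR_right] hes.FDERIV has_derivative_ident)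
  moreover have "open {k. (x, k) \<in> tangent_image A c C}"
    using open_vimage[OF open_image_C[OF c(1)], of "\<lambda>k. (x, k)"]
    by (simp add: vimage_def continuous_on_Pair)
  ultimately have 2: "((\<lambda>k. coeff c' (bundle_transition c c' (x, k))) has_derivative
      (\<lambda>k. ?J (D (coeff c) (x, y) (0, k))
        - (1 / 2) *\<^sub>R (hessian c c' x y k + hessian c c' x k y))) (at y)"
    by (rule has_derivative_transform_within_open)
      (use z coeff_transformation(1)[OF c _ x] in auto)
  from fun_cong[OF has_derivative_unique[OF 1 2], of h]
  show ?thesis
    by (simp add: hessian_symmetric[OF c x, of h y] scaleR_2[symmetric])
qed

text \<open>The coordinate change maps the horizontal lift of \<open>k\<close> to the horizontal lift of its image: the hessian
  in its derivative cancels the one in the transformation law of the connection.\<close>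

lemma funk_equation_transformation:
  assumes c: "c \<in> A" "c' \<in> A" and z: "(x, y) \<in> tangent_image A c C" and x: "x \<in> overlap c c'"
    and p: "p differentiable at (bundle_transition c c' (x, y))"
    and funk: "\<And>k. D p (bundle_transition c c' (x, y))
      (k, - (D (coeff c') (bundle_transition c c' (x, y)) (0, k)
        + p (bundle_transition c c' (x, y)) *\<^sub>R k)) = 0"
  shows "D (\<lambda>z. p (bundle_transition c c' z)) (x, y)
      (k, - (D (coeff c) (x, y) (0, k) + p (bundle_transition c c' (x, y)) *\<^sub>R k)) = (0 :: real)"
proof -
  let ?J = "jacobian c c' x" and ?z' = "bundle_transition c c' (x, y)"
  let ?n = "D (coeff c) (x, y) (0, k)" and ?s = "p ?z'"
  have lJ: "linear ?J" by (rule linear_jacobian[OF c x])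
  have "((\<lambda>z. p (bundle_transition c c' z)) has_derivative
      (\<lambda>d. D p ?z' (?J (fst d), hessian c c' x y (fst d) + ?J (snd d)))) (at (x, y))"
    unfolding hessian_def
    by (rule has_derivative_compose[OF bundle_transition_has_derivative[OF c x]])
      (use p in \<open>simp add: frechet_derivative_works\<close>)
  from fun_cong[OF frechet_derivative_at[OF this], of "(k, - (?n + ?s *\<^sub>R k))"]
  have "D (\<lambda>z. p (bundle_transition c c' z)) (x, y) (k, - (?n + ?s *\<^sub>R k))
      = D p ?z' (?J k, hessian c c' x y k + ?J (- (?n + ?s *\<^sub>R k)))" by simp
  also have "hessian c c' x y k + ?J (- (?n + ?s *\<^sub>R k))
      = - (D (coeff c') ?z' (0, ?J k) + ?s *\<^sub>R ?J k)"
    unfolding connection_transformation[OF c z x]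
    by (simp add: linear_neg[OF lJ] linear_diff[OF lJ] linear_add[OF lJ] linear_scale[OF lJ])
  also have "D p ?z' (?J k, \<dots>) = 0" by (rule funk)
  finally show ?thesis .
qed

end

theorem theorem1p2:
  fixes M :: "'a topology"
    and A :: "('a, real^'n) chart set"
    and C :: "('a, real^'n) tangent set"
    and G :: "(('a, real^'n) tangent, (real^'n) \<times> (real^'n)) vector_field"
    and u :: "('a, real^'n) tangent"
  assumes "smooth_manifold M A"
    and "spray A C G"
    and "R_flat A C G"
    and "u \<in> C"
  shows "\<exists>U P. conical_region A U \<and> u \<in> U \<and> U \<subseteq> C \<and>
               funk_function A G U P \<and> (\<exists>w\<in>U. P w \<noteq> 0)"
proof -
  interpret spray_manifold M A C G by unfold_locales (fact assms)+
  have u_slit: "u \<in> slit_tangent_bundle A" using conical assms(4) by (auto simp: conical_region_def)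
  then have uTB: "u \<in> tangent_bundle A" "snd u \<noteq> (\<lambda>c. 0)" by (auto simp: slit_tangent_bundle_def)
  then obtain c where c: "c \<in> A" "fst u \<in> chart_dom c" by (auto simp: tangent_bundle_def)
  let ?tc = "tangent_chart A c"
  have u_dom: "u \<in> chart_dom ?tc" using uTB c by (simp add: tangent_chart_simps)
  obtain x0 y0 where z0: "chart_map ?tc u = (x0, y0)" by fastforce
  have x0: "x0 \<in> overlap c c" "lift c (x0, y0) = u" using lift_chart_map[OF c(1) u_dom] z0 by auto
  \<comment> \<open>A tangent vector that vanishes in one chart vanishes in all.\<close>
  have y0: "y0 \<noteq> 0"
  proof
    assume 0: "y0 = 0"
    have "jacobian c c' x0 0 = 0" if "c' \<in> A" "chart_inv c x0 \<in> chart_dom c'" for c'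
    proof -
      have "x0 \<in> overlap c c'" using in_overlap_iff[OF c(1)] x0(1) that(2) by blast
      then show ?thesis by (rule linear_0[OF linear_jacobian[OF c(1) that(1)]])
    qed
    then have "snd (lift c (x0, y0)) = (\<lambda>c. 0)" unfolding 0 lift_def by (auto simp: fun_eq_iff)
    then show False using uTB(2) x0(2) by simp
  qed
  have z0_in: "(x0, y0) \<in> tangent_image A c C" using x0 assms(4) by (simp add: tangent_image_eq[OF c(1)])
  have "flat_spray (tangent_image A c C) (coeff c)"
    using assms(3) c(1)
    by (intro flat_spray_of_riemann_curvature spray_coefficients_coeff)
      (auto simp: R_flat_def spray_coeff_eq[symmetric])
  from flat_spray.exists_funk_function_near[OF this z0_in y0]
  obtain U0 p where U0: "open U0" "(x0, y0) \<in> U0" "U0 \<subseteq> tangent_image A c C"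
    and U0_cone: "\<And>x y s. (x, y) \<in> U0 \<Longrightarrow> s > 0 \<Longrightarrow> (x, s *\<^sub>R y) \<in> U0"
    and p_smooth: "smooth_on U0 p"
    and p_hom: "\<And>x y s. (x, y) \<in> U0 \<Longrightarrow> s > 0 \<Longrightarrow> p (x, s *\<^sub>R y) = s * p (x, y)"
    and p_funk: "\<And>z k. z \<in> U0 \<Longrightarrow>
      D p z (k, - (D (coeff c) z (0, k) + p z *\<^sub>R k)) = 0"
    and p_base: "p (x0, y0) = 1" by blast
  \<comment> \<open>The Funk function lives over the domain of the single chart \<open>c\<close>; other charts only see it through coordinate changes.\<close>
  define U where "U = {u \<in> chart_dom ?tc. chart_map ?tc u \<in> U0}"
  define P where "P u = p (chart_map ?tc u)" for u
  have UC: "U \<subseteq> C"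
  proof
    fix w assume w: "w \<in> U"
    then have "chart_map ?tc w \<in> tangent_image A c C" "w \<in> chart_dom ?tc" using U0(3) by (auto simp: U_def)
    then show "w \<in> C" using lift_chart_map(2)[OF c(1)] by (auto simp: tangent_image_eq[OF c(1)])
  qed
  have scale: "tangent_scale t w \<in> U" "P (tangent_scale t w) = t * P w" if w: "w \<in> U" and t: "t > 0" for w t
  proof -
    obtain x y where xy: "chart_map ?tc w = (x, y)" by fastforce
    have "tangent_scale t w \<in> C" using conical UC w t unfolding conical_region_def by blast
    then have "tangent_scale t w \<in> tangent_bundle A"
      using conical unfolding conical_region_def slit_tangent_bundle_def by auto
    moreover have "chart_map ?tc (tangent_scale t w) = (x, t *\<^sub>R y)"
      using xy by (simp add: tangent_chart_simps tangent_scale_def)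
    ultimately show "tangent_scale t w \<in> U" "P (tangent_scale t w) = t * P w"
      using w t U0_cone p_hom xy by (auto simp: U_def P_def tangent_chart_simps(1) tangent_scale_def)
  qed
  have U_open: "openin (tangent_topology A) U"
    unfolding tangent_topology_def U_def
    by (rule topology_generated_by_Basis) (use c U0(1) in blast)
  have region: "conical_region A U"
    using U_open UC conical scale unfolding conical_region_def by blast

  have image_U: "z \<in> tangent_image A c' U \<Longrightarrow> fst z \<in> overlap c' c' \<and> fst z \<in> overlap c' c \<and>
      bundle_transition c' c z \<in> U0 \<and> z \<in> tangent_image A c' C \<and>
      local_expr A c' P z = p (bundle_transition c' c z)" if c': "c' \<in> A" for c' z
  proof -
    assume "z \<in> tangent_image A c' U"
    then have z: "fst z \<in> overlap c' c'" "lift c' z \<in> U" by (auto simp: tangent_image_eq[OF c'])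
    then have "chart_inv c' (fst z) \<in> chart_dom c" by (auto simp: U_def tangent_chart_simps lift_def)
    then have o: "fst z \<in> overlap c' c" using in_overlap_iff[OF c'] z(1) by blast
    show ?thesis
      using z o UC lift_in_chart(2)[OF c' c(1) o]
      by (auto simp: U_def P_def tangent_image_eq[OF c'] local_expr_eq[OF c'])
  qed
  have smooth_P: "smooth_on (tangent_image A c' U) (local_expr A c' P)" if c': "c' \<in> A" for c'
  proof -
    have o: "open (tangent_image A c' U)" by (rule open_tangent_image[OF U_open c'])
    have "Ck_family n {0} (tangent_image A c' U) (\<lambda>_ z. p (bundle_transition c' c z))" for n
    proof (rule Ck_family_compose[OF o smooth_on_imp_Ck_family[OF p_smooth]])
      show "Ck_family n {0} (tangent_image A c' U) (\<lambda>_. bundle_transition c' c)"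
        by (rule Ck_family_subset[OF smooth_bundle_transition[OF c' c(1), of n "{0}"]])
          (use image_U[OF c'] in \<open>auto simp: mem_Times_iff\<close>)
    qed (use image_U[OF c'] in auto)
    then have "Ck_family n {0} (tangent_image A c' U) (\<lambda>_. local_expr A c' P)" for n
      by (rule Ck_family_cong[OF o, rotated]) (use image_U[OF c'] in auto)
    then show ?thesis by (rule smooth_on_of_Ck_family) auto
  qed
  have "funk_function A G U P"
    unfolding funk_function_def
  proof (intro conjI ballI allI impI)
    fix c' assume c': "c' \<in> A"
    show "smooth_on (tangent_image A c' U) (local_expr A c' P)" by (rule smooth_P[OF c'])
    fix z k assume z: "z \<in> tangent_image A c' U"
    obtain x y where xy: "z = (x, y)" by fastforce
    have o: "open (tangent_image A c' U)" by (rule open_tangent_image[OF U_open c'])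
    have zC: "(x, y) \<in> tangent_image A c' C" and x: "x \<in> overlap c' c" and z': "bundle_transition c' c (x, y) \<in> U0"
      and Pz: "local_expr A c' P z = p (bundle_transition c' c (x, y))"
      using image_U[OF c' z] by (auto simp: xy)
    have dP: "local_expr A c' P differentiable at z"
      by (rule smooth_on_imp_differentiable[OF smooth_P[OF c'] z])
    have dc: "coeff c' differentiable at z"
      by (rule smooth_on_imp_differentiable[OF smooth_coeff[OF c']]) (use zC xy in simp)
    have "D (local_expr A c' P) z = D (\<lambda>z. p (bundle_transition c' c z)) z"
      by (rule frechet_derivative_cong_open[OF o z _ dP]) (use image_U[OF c'] in blast)
    then have "D (local_expr A c' P) z
        (axis k 1, - (D (coeff c') z (0, axis k 1) + local_expr A c' P z *\<^sub>R axis k 1)) = 0"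
      using funk_equation_transformation[OF c' c(1) zC x smooth_on_imp_differentiable[OF p_smooth z'] p_funk[OF z']]
      by (simp only: Pz[unfolded xy] xy)
    then show "horizontal_derivative (spray_coeff A G c') k (local_expr A c' P) z =
        local_expr A c' P z * partial_y k (local_expr A c' P) z"
      using horizontal_derivative_eq[OF dc dP, of k] by (simp add: spray_coeff_eq)
  qed (rule scale(2))
  moreover have "u \<in> U" using u_dom z0 U0(2) by (simp add: U_def)
  moreover have "P u \<noteq> 0" using p_base z0 by (simp add: P_def)
  ultimately show ?thesis using region UC by blast
qed

end
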